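(* Let $K\subset\mathbb R^3$ be a convex body with boundary $\partial K$ of class $C^5$, and put $L(3)=31$. Suppose that for every point $p\in\partial K$ there are at least $L(3)$ point light sources on the tangent plane $T_p\partial K$, in a general linear position with respect to $p$, each of which creates a flat shadow boundary on $K$. Then $K$ is an ellipsoid.
   Context: A convex body in $\mathbb R^3$ is a compact convex set with non-empty interior. $T_p\partial K$ denotes the affine plane tangent to $\partial K$ at $p$. A point light source is a point $q\in\mathbb R^3\setminus K$. The shadow boundary it creates on $K$ is the set of points $x\in\partial K$ such that the line through $q$ and $x$ supports $K$ (does not meet the interior of $K$); since $\partial K$ is $C^1$, this is the set $\{x\in\partial K: q\in T_x\partial K\}$. The shadow boundary is flat if it is contained in an affine plane of $\mathbb R^3$. A set containing at least $d$ points in a $d$-dimensional affine space is in a general linear position with respect to a point $p$ if no $d$ of its points lie in a hyperplane (of that $d$-dimensional space) passing through $p$. Here this is applied in the $2$-dimensional affine space $T_p\partial K$, so it means that no two of the light sources lie on a common line through $p$ in $T_p\partial K$. An ellipsoid is the image of the closed unit Euclidean ball under an invertible affine map. *)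

theory Defs
  imports "HOL-Analysis.Analysis"
begin

definition convex_body :: "'a::euclidean_space set \<Rightarrow> bool" where
  "convex_body K \<longleftrightarrow> compact K \<and> convex K \<and> interior K \<noteq> {}"

text \<open>Class \<open>C\<^sup>k\<close>, intended for open \<open>U\<close>. Continuity of the derivative is expressed
  directionwise, which in finite dimension is the same as continuity in operator norm.\<close>

primrec Ck_on :: "nat \<Rightarrow> 'a::euclidean_space set \<Rightarrow> ('a \<Rightarrow> real) \<Rightarrow> bool" where
  "Ck_on 0 U f \<longleftrightarrow> continuous_on U f"
| "Ck_on (Suc k) U f \<longleftrightarrow>
     (\<forall>x\<in>U. f differentiable (at x)) \<and>
     (\<forall>v. Ck_on k U (\<lambda>x. frechet_derivative f (at x) v))"

text \<open>An embedded hypersurface of class \<open>C\<^sup>k\<close> (with \<open>k \<ge> 1\<close>), given locally as a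
  regular level set.\<close>

definition Ck_hypersurface :: "nat \<Rightarrow> 'a::euclidean_space set \<Rightarrow> bool" where
  "Ck_hypersurface k S \<longleftrightarrow>
     (\<forall>p\<in>S. \<exists>U F. open U \<and> p \<in> U \<and> Ck_on k U F \<and>
        (\<forall>x\<in>U. frechet_derivative F (at x) \<noteq> (\<lambda>v. 0)) \<and>
        S \<inter> U = {x \<in> U. F x = 0})"

text \<open>The affine tangent space \<open>T\<^sub>p S\<close>: the point \<open>p\<close> translated by all velocities of
  curves in \<open>S\<close> through \<open>p\<close>.\<close>

definition tangent_plane :: "'a::euclidean_space set \<Rightarrow> 'a \<Rightarrow> 'a set" where
  "tangent_plane S p =
     {p + v | v. \<exists>(\<gamma> :: real \<Rightarrow> 'a) \<epsilon>. \<epsilon> > 0 \<and> \<gamma> 0 = p \<and> \<gamma> ` {-\<epsilon><..<\<epsilon>} \<subseteq> S \<and>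
        (\<gamma> has_vector_derivative v) (at 0)}"

definition shadow_boundary :: "'a::euclidean_space set \<Rightarrow> 'a \<Rightarrow> 'a set" where
  "shadow_boundary K q = {x \<in> frontier K. affine hull {q, x} \<inter> interior K = {}}"

definition flat :: "(real ^ 3) set \<Rightarrow> bool" where
  "flat S \<longleftrightarrow> (\<exists>P. affine P \<and> aff_dim P = 2 \<and> S \<subseteq> P)"

text \<open>\<open>Q\<close> is a set of at least \<open>d\<close> points in the \<open>d\<close>-dimensional affine space \<open>A\<close>, and no
  \<open>d\<close> of them lie in a hyperplane of \<open>A\<close> through \<open>p\<close>.\<close>

definition general_linear_position ::
    "'a::euclidean_space set \<Rightarrow> 'a \<Rightarrow> 'a set \<Rightarrow> bool" where
  "general_linear_position A p Q \<longleftrightarrow>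
     Q \<subseteq> A \<and> (infinite Q \<or> aff_dim A \<le> int (card Q)) \<and>
     (\<forall>Y\<subseteq>Q. finite Y \<and> int (card Y) = aff_dim A \<longrightarrow>
        \<not> (\<exists>H. affine H \<and> H \<subseteq> A \<and> aff_dim H = aff_dim A - 1 \<and> p \<in> H \<and> Y \<subseteq> H))"

definition ellipsoid :: "(real ^ 3) set \<Rightarrow> bool" where
  "ellipsoid E \<longleftrightarrow>
     (\<exists>(M :: real ^ 3 ^ 3) c. invertible M \<and> E = (\<lambda>x. M *v x + c) ` cball 0 1)"

end

theory Submission
  imports Defs "HOL-Library.Landau_Symbols"
begin

text \<open>
  At a point with definite Hessian write the boundary as a graph and expand the shadow boundary of a light
  source in the tangent plane to fourth order. Flatness determines the curve by one constant \<open>c\<close>, and the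
  coefficients of orders two to four give three equations for \<open>c\<close> and the inverse distance \<open>\<mu>\<close> of the
  source. Eliminating both leaves a polynomial of degree at most 15 in the direction of the source. With
  more than 15 directions it vanishes identically, and at the complex null directions of the Hessian this
  says that the Hessian divides the cubic term of the graph.

  Vanishing of the trace-free cubic form implies, as in the theorem of Pick and Berwald, that the graph lies
  locally on a quadric. The set of boundary points near which the boundary lies on one fixed nondegenerate
  quadric is open, and it is closed since along it the Hessian cannot degenerate. It is nonempty because the
  Hessian is definite at a boundary point farthest from the origin. A quadric containing the boundary of a
  convex body is an ellipsoid.
\<close>

section \<open>Elimination of the position of the light source\<close>

text \<open>The plane of a shadow boundary through a point contains the direction conjugate to that
  of the source, which leaves one constant \<open>c\<close>; with the inverse distance
  \<open>\<mu>\<close> there are two unknowns, so three orders of the expansion give one condition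
  on the direction. In the shadow equation the gradient of the graph is multiplied by the distance
  of the source, so its fourth order involves fifth derivatives of the graph; this is where C^5
  enters. In the eliminant all derivatives of order four and five carry a factor \<open>N\<close>,
  half the value of the Hessian in the given direction, and therefore drop out at the null
  directions. There a direction is conjugate to itself, and what remains is a multiple of a power of
  the cubic. Convexity alone gives a semidefinite Hessian, and where it degenerates the expansion
  yields nothing. A single quadric is therefore continued along the boundary: contact of second
  order survives a passage to the limit, and contact with a nondegenerate quadric excludes a
  degenerate Hessian.\<close>

lemma shadow_elimination:
  fixes N :: "'a::field"
  assumes N: "N \<noteq> 0"
    and E0: "\<mu> * N = 2 * N * D * (c * N) + b"
    and E1: "- 2 * \<mu> * a + 2 * N * D * (c * a) + e1 + 2 * g * (c * N) = 0"
    and E2: "- \<mu> * (N * D * (c * N)^2 + 2 * b * (c * N) + 3 * e0)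
      + 2 * N * D * (c * (N * D * (c * N)^2 + b * (c * N) + e0))
      + 2 * g * (c * a) + 3 * d * (c * N)^2 + 2 * e2 * (c * N) + p = 0"
  shows "3 * (d - D * b) * (2 * a * b - N * e1)^2
      + 2 * (g - D * a) * (2 * a * b - N * e1) * (2 * a * g - 2 * b^2 + 2 * N * (e2 - 2 * D * e0))
      + 4 * N^2 * (g - D * a)^2 * p - 12 * N * (g - D * a)^2 * b * e0 = 0"
proof -
  \<comment> \<open>The first relation is solved for \<open>\<mu>\<close>, which becomes an affine
    function of \<open>c\<close>.\<close>
  define \<nu> where "\<nu> = b / N"
  have b: "b = \<nu> * N" using N by (simp add: \<nu>_def)
  have "\<mu> * N = (2 * N * D * c + \<nu>) * N" unfolding E0 b by algebra
  then have m: "\<mu> = 2 * N * D * c + \<nu>" using N by simp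
  \<comment> \<open>After this substitution the second relation is linear in \<open>c\<close>: it
    says 2 N^2 c (g - D a) = 2 a b - N e1.\<close>
  have e1: "e1 = 2 * \<nu> * a - 2 * c * N * (g - D * a)"
    using E1 unfolding m by algebra
  \<comment> \<open>The cubic terms in \<open>c\<close> cancel, so the third relation is quadratic
    in \<open>c\<close>. Multiplied by 4 N^2 (g - D a)^2 it contains \<open>c\<close> only through 2
    N^2 c (g - D a), so nothing is divided by g - D a, which may vanish.\<close>
  have p: "p = \<mu> * (N * D * (c * N)^2 + 2 * b * (c * N) + 3 * e0)
      - (2 * N * D * (c * (N * D * (c * N)^2 + b * (c * N) + e0))
      + 2 * g * (c * a) + 3 * d * (c * N)^2 + 2 * e2 * (c * N))"
    using E2 by algebra
  show ?thesis unfolding p m e1 b by algebra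
qed

text \<open>A positive determinant makes the root \<open>z\<close> of the quadratic non-real, so a
  real cubic vanishing at \<open>z\<close> vanishes at its conjugate too and is divisible by the
  quadratic. The quotient is l1 + l2 x.\<close>

lemma real_cubic_factor:
  fixes z :: complex and h11 h12 h22 a0 a1 a2 a3 :: real
  assumes D: "h11 * h22 - h12^2 > 0"
    and q: "complex_of_real h11 + 2 * of_real h12 * z + of_real h22 * z^2 = 0"
    and c: "complex_of_real a0 + of_real a1 * z + of_real a2 * z^2 + of_real a3 * z^3 = 0"
  shows "\<exists>l1 l2. a0 = l1 * h11 \<and> a1 = l2 * h11 + 2 * l1 * h12 \<and> a2 = l1 * h22 + 2 * l2 * h12 \<and> a3 = l2 * h22"
proof -
  have h: "h11 \<noteq> 0" "h22 \<noteq> 0" using D by (auto simp: algebra_simps)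
  have im: "Im z \<noteq> 0"
  proof
    assume "Im z = 0"
    then obtain x where z: "z = of_real x" by (metis complex_is_Real_iff Reals_cases)
    have "complex_of_real (h11 + 2 * h12 * x + h22 * x^2) = 0" using q unfolding z by simp
    then have "h11 + 2 * h12 * x + h22 * x^2 = 0" by (metis of_real_eq_0_iff)
    then have "(h22 * x + h12)^2 = - (h11 * h22 - h12^2)" by algebra
    then show False using D by (metis neg_0_le_iff_le not_less zero_le_power2)
  qed
  \<comment> \<open>The outer coefficients determine the only possible quotient. What is left over
    is \<open>z\<close> times a real linear polynomial in \<open>z\<close>, and such a polynomial
    has no non-real root unless it is zero.\<close>
  define l1 l2 where "l1 = a0 / h11" and "l2 = a3 / h22"
  have a: "a0 = l1 * h11" "a3 = l2 * h22" using h by (auto simp: l1_def l2_def)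
  define r1 r2 where "r1 = a1 - l2 * h11 - 2 * l1 * h12" and "r2 = a2 - l1 * h22 - 2 * l2 * h12"
  have a': "a1 = r1 + l2 * h11 + 2 * l1 * h12" "a2 = r2 + l1 * h22 + 2 * l2 * h12"
    by (auto simp: r1_def r2_def)
  have "z * (of_real r1 + of_real r2 * z) = 0"
    using q c unfolding a a' of_real_mult of_real_add of_real_numeral by algebra
  moreover have "z \<noteq> 0" using im by auto
  ultimately have r: "of_real r1 + of_real r2 * z = 0" by simp
  then have "Im (of_real r1 + of_real r2 * z) = 0" by simp
  then have "r2 = 0" using im by simp
  then have "r1 = 0" using r by simp
  then show ?thesis using a a' \<open>r2 = 0\<close> by auto
qed

text \<open>The eliminant of the three equations is a polynomial of degree at most 15 in the slope. At a root of
  the second fundamental form it reduces to a nonzero multiple of the fifth power of the cubic.\<close>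

lemma cubic_divisible_of_slopes:
  fixes h11 h12 h22 a0 a1 a2 a3 b0 b1 b2 b3 b4 c0 c1 c2 c3 c4 c5 :: real
  defines "D \<equiv> h11 * h22 - h12^2"
  assumes D: "D > 0" and X: "finite X" "15 < card X"
    and eqs: "\<And>x e f N a b g d e0 e1 e2 p. \<lbrakk>x \<in> X; e = - (h12 + h22 * x); f = h11 + h12 * x;
        N = (h11 + 2 * h12 * x + h22 * x^2) / 2;
        a = a0 + a1 * x + a2 * x^2 + a3 * x^3;
        b = e * (3 * a0 + 2 * a1 * x + a2 * x^2) + f * (a1 + 2 * a2 * x + 3 * a3 * x^2);
        g = e^2 * (3 * a0 + a1 * x) + e * f * (2 * a1 + 2 * a2 * x) + f^2 * (a2 + 3 * a3 * x);
        d = a0 * e^3 + a1 * e^2 * f + a2 * e * f^2 + a3 * f^3;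
        e0 = b0 + b1 * x + b2 * x^2 + b3 * x^3 + b4 * x^4;
        e1 = e * (4 * b0 + 3 * b1 * x + 2 * b2 * x^2 + b3 * x^3) + f * (b1 + 2 * b2 * x + 3 * b3 * x^2 + 4 * b4 * x^3);
        e2 = e^2 * (6 * b0 + 3 * b1 * x + b2 * x^2) + e * f * (3 * b1 + 4 * b2 * x + 3 * b3 * x^2)
            + f^2 * (b2 + 3 * b3 * x + 6 * b4 * x^2);
        p = e * (5 * c0 + 4 * c1 * x + 3 * c2 * x^2 + 2 * c3 * x^3 + c4 * x^4)
            + f * (c1 + 2 * c2 * x + 3 * c3 * x^2 + 4 * c4 * x^3 + 5 * c5 * x^4)\<rbrakk> \<Longrightarrow>
      \<exists>\<mu> c. \<mu> * N = 2 * N * D * (c * N) + b \<and>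
       - 2 * \<mu> * a + 2 * N * D * (c * a) + e1 + 2 * g * (c * N) = 0 \<and>
       - \<mu> * (N * D * (c * N)^2 + 2 * b * (c * N) + 3 * e0)
        + 2 * N * D * (c * (N * D * (c * N)^2 + b * (c * N) + e0))
        + 2 * g * (c * a) + 3 * d * (c * N)^2 + 2 * e2 * (c * N) + p = 0"
  shows "\<exists>l1 l2. a0 = l1 * h11 \<and> a1 = l2 * h11 + 2 * l1 * h12 \<and> a2 = l1 * h22 + 2 * l2 * h12 \<and> a3 = l2 * h22"
proof -
  define r where "r = complex_of_real"
  define e where "e = [:- r h12, - r h22:]"
  define f where "f = [:r h11, r h12:]"
  define N where "N = [:r h11 / 2, r h12, r h22 / 2:]"
  define a where "a = [:r a0, r a1, r a2, r a3:]"
  define b where "b = e * [:3 * r a0, 2 * r a1, r a2:] + f * [:r a1, 2 * r a2, 3 * r a3:]"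
  define g where "g = e^2 * [:3 * r a0, r a1:] + e * f * [:2 * r a1, 2 * r a2:] + f^2 * [:r a2, 3 * r a3:]"
  define d where "d = [:r a0:] * e^3 + [:r a1:] * e^2 * f + [:r a2:] * e * f^2 + [:r a3:] * f^3"
  define e0 where "e0 = [:r b0, r b1, r b2, r b3, r b4:]"
  define e1 where "e1 = e * [:4 * r b0, 3 * r b1, 2 * r b2, r b3:] + f * [:r b1, 2 * r b2, 3 * r b3, 4 * r b4:]"
  define e2 where "e2 = e^2 * [:6 * r b0, 3 * r b1, r b2:] + e * f * [:3 * r b1, 4 * r b2, 3 * r b3:]
            + f^2 * [:r b2, 3 * r b3, 6 * r b4:]"
  define p where "p = e * [:5 * r c0, 4 * r c1, 3 * r c2, 2 * r c3, r c4:]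
            + f * [:r c1, 2 * r c2, 3 * r c3, 4 * r c4, 5 * r c5:]"
  \<comment> \<open>In these names the second relation reads 2 N^2 c U = T. The bound 15 is attained
    by each of the four products in \<open>P\<close> when \<open>e\<close>, \<open>f\<close> count
    1, \<open>N\<close> counts 2, the coefficients \<open>a\<close>, \<open>b\<close>,
    \<open>g\<close>, \<open>d\<close> of the cubic 3, those of the quartic 4 and \<open>p\<close>
    5.\<close>
  define U where "U = g - [:r D:] * a"
  define T where "T = [:2:] * a * b - N * e1"
  define Y where "Y = [:2:] * a * g - [:2:] * b^2 + [:2:] * N * (e2 - [:2 * r D:] * e0)"
  define V where "V = [:3:] * (d - [:r D:] * b)"
  define P where "P = V * T^2 + [:2:] * U * T * Y + [:4:] * N^2 * U^2 * p - [:12:] * N * U^2 * b * e0"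
  note defs = e_def f_def N_def a_def b_def g_def d_def e0_def e1_def e2_def p_def
  have mul: "degree (u * v) \<le> n" if "degree u \<le> i" "degree v \<le> j" "i + j \<le> n" for u v :: "complex poly" and i j n
    using that by (meson add_mono degree_mult_le order_trans)
  have pw: "degree (u ^ k) \<le> n" if "degree u \<le> i" "i * k \<le> n" for u :: "complex poly" and i k n
    using degree_power_le[of u k] that by (meson mult_le_mono1 order_trans)
  have add: "degree (u + v) \<le> i" "degree (u - v) \<le> i" if "degree u \<le> i" "degree v \<le> i" for u v :: "complex poly" and i
    using that by (auto intro: degree_add_le degree_diff_le)
  have q: "degree [:x0:] \<le> 0" "degree [:x0, x1:] \<le> 1" "degree [:x0, x1, x2:] \<le> 2" "degree [:x0, x1, x2, x3:] \<le> 3"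
    "degree [:x0, x1, x2, x3, x4:] \<le> 4" for x0 x1 x2 x3 x4 :: complex
    by simp_all
  have de: "degree e \<le> 1" "degree f \<le> 1" "degree N \<le> 2" "degree a \<le> 3" "degree e0 \<le> 4"
    unfolding defs by simp_all
  have ef2: "degree (e^2) \<le> 2" "degree (f^2) \<le> 2" "degree (e * f) \<le> 2" "degree (e^3) \<le> 3" "degree (f^3) \<le> 3"
    by (rule pw mul, rule de, (rule de)?, simp)+
  have db: "degree b \<le> 3"
    unfolding b_def by (rule add; rule mul, rule de, rule q, simp)
  have dg: "degree g \<le> 3"
    unfolding g_def by (rule add, rule add; rule mul, rule ef2, rule q, simp)
  have dd: "degree d \<le> 3"
    unfolding d_def mult.assoc
    by (intro add; rule mul, rule q, (rule ef2 | rule mul, rule ef2 de, rule ef2 de, rule order_refl), simp)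
  have de1: "degree e1 \<le> 4"
    unfolding e1_def by (rule add; rule mul, rule de, rule q, simp)
  have de2: "degree e2 \<le> 4"
    unfolding e2_def by (rule add, rule add; rule mul, rule ef2, rule q, simp)
  have dp: "degree p \<le> 5"
    unfolding p_def by (rule add; rule mul, rule de, rule q, simp)
  have dU: "degree U \<le> 3" unfolding U_def by (intro add dg mul[OF q(1) de(4)]) simp
  have dT: "degree T \<le> 6" unfolding T_def mult.assoc
    by (intro add mul[OF q(1) mul[OF de(4) db order_refl]] mul[OF de(3) de1]) simp_all
  have dY: "degree Y \<le> 6" unfolding Y_def mult.assoc
    by (intro add mul[OF q(1) mul[OF de(4) dg order_refl]] mul[OF q(1) pw[OF db order_refl]]
        mul[OF q(1) mul[OF de(3) add(2)[OF de2 mul[OF q(1) de(5)]] order_refl]]) simp_all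
  have dV: "degree V \<le> 3" unfolding V_def
    by (intro mul[OF q(1) add(2)[OF dd mul[OF q(1) db]]]) simp_all
  have "degree P \<le> 15" unfolding P_def mult.assoc
    by (intro add mul[OF dV pw[OF dT order_refl]] mul[OF q(1) mul[OF dU mul[OF dT dY order_refl] order_refl]]
      mul[OF q(1) mul[OF pw[OF de(3) order_refl] mul[OF pw[OF dU order_refl] dp order_refl] order_refl]]
      mul[OF q(1) mul[OF de(3) mul[OF pw[OF dU order_refl] mul[OF db de(5) order_refl] order_refl] order_refl]]) simp_all
  have root: "poly P (r x) = 0" if "x \<in> X" for x
  proof -
    define e' f' where "e' = - (h12 + h22 * x)" and "f' = h11 + h12 * x"
    define N' where "N' = (h11 + 2 * h12 * x + h22 * x^2) / 2"
    define a' where "a' = a0 + a1 * x + a2 * x^2 + a3 * x^3"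
    define b' where "b' = e' * (3 * a0 + 2 * a1 * x + a2 * x^2) + f' * (a1 + 2 * a2 * x + 3 * a3 * x^2)"
    define g' where "g' = e'^2 * (3 * a0 + a1 * x) + e' * f' * (2 * a1 + 2 * a2 * x) + f'^2 * (a2 + 3 * a3 * x)"
    define d' where "d' = a0 * e'^3 + a1 * e'^2 * f' + a2 * e' * f'^2 + a3 * f'^3"
    define e0' where "e0' = b0 + b1 * x + b2 * x^2 + b3 * x^3 + b4 * x^4"
    define e1' where "e1' = e' * (4 * b0 + 3 * b1 * x + 2 * b2 * x^2 + b3 * x^3) + f' * (b1 + 2 * b2 * x + 3 * b3 * x^2 + 4 * b4 * x^3)"
    define e2' where "e2' = e'^2 * (6 * b0 + 3 * b1 * x + b2 * x^2) + e' * f' * (3 * b1 + 4 * b2 * x + 3 * b3 * x^2)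
            + f'^2 * (b2 + 3 * b3 * x + 6 * b4 * x^2)"
    define p' where "p' = e' * (5 * c0 + 4 * c1 * x + 3 * c2 * x^2 + 2 * c3 * x^3 + c4 * x^4)
            + f' * (c1 + 2 * c2 * x + 3 * c3 * x^2 + 4 * c4 * x^3 + 5 * c5 * x^4)"
    from eqs[OF that e'_def f'_def N'_def a'_def b'_def g'_def d'_def e0'_def e1'_def e2'_def p'_def]
    obtain \<mu> c where E: "\<mu> * N' = 2 * N' * D * (c * N') + b'"
       "- 2 * \<mu> * a' + 2 * N' * D * (c * a') + e1' + 2 * g' * (c * N') = 0"
       "- \<mu> * (N' * D * (c * N')^2 + 2 * b' * (c * N') + 3 * e0')
        + 2 * N' * D * (c * (N' * D * (c * N')^2 + b' * (c * N') + e0'))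
        + 2 * g' * (c * a') + 3 * d' * (c * N')^2 + 2 * e2' * (c * N') + p' = 0"
      by blast
    have "N' \<noteq> 0"
    proof
      assume "N' = 0"
      then have "h11 + 2 * h12 * x + h22 * x^2 = 0" by (simp add: N'_def)
      then have "(h22 * x + h12)^2 = - D" unfolding D_def by algebra
      then show False using D by (metis neg_0_le_iff_le not_less zero_le_power2)
    qed
    note el = shadow_elimination[OF this E]
    have tr: "poly e (r x) = r e'" "poly f (r x) = r f'" "poly N (r x) = r N'" "poly a (r x) = r a'"
       "poly e0 (r x) = r e0'"
      unfolding e_def f_def N_def a_def e0_def e'_def f'_def N'_def a'_def e0'_def r_def
      by (simp_all add: algebra_simps power2_eq_square power3_eq_cube power4_eq_xxxx)
    have tb: "poly b (r x) = r b'" unfolding b_def b'_def poly_add poly_mult tr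
      by (simp add: r_def algebra_simps power2_eq_square power3_eq_cube power4_eq_xxxx)
    have tg: "poly g (r x) = r g'" unfolding g_def g'_def poly_add poly_mult poly_power tr
      by (simp add: r_def algebra_simps power2_eq_square power3_eq_cube power4_eq_xxxx)
    have td: "poly d (r x) = r d'" unfolding d_def d'_def poly_add poly_mult poly_power tr
      by (simp add: r_def algebra_simps power2_eq_square power3_eq_cube power4_eq_xxxx)
    have te1: "poly e1 (r x) = r e1'" unfolding e1_def e1'_def poly_add poly_mult poly_power tr
      by (simp add: r_def algebra_simps power2_eq_square power3_eq_cube power4_eq_xxxx)
    have te2: "poly e2 (r x) = r e2'" unfolding e2_def e2'_def poly_add poly_mult poly_power tr
      by (simp add: r_def algebra_simps power2_eq_square power3_eq_cube power4_eq_xxxx)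
    have tp: "poly p (r x) = r p'" unfolding p_def p'_def poly_add poly_mult poly_power tr
      by (simp add: r_def algebra_simps power2_eq_square power3_eq_cube power4_eq_xxxx)
    have "poly P (r x) = r (3 * (d' - D * b') * (2 * a' * b' - N' * e1')^2
      + 2 * (g' - D * a') * (2 * a' * b' - N' * e1') * (2 * a' * g' - 2 * b'^2 + 2 * N' * (e2' - 2 * D * e0'))
      + 4 * N'^2 * (g' - D * a')^2 * p' - 12 * N' * (g' - D * a')^2 * b' * e0')"
      unfolding P_def V_def T_def U_def Y_def poly_add poly_diff poly_mult poly_power tr tb tg td te1 te2 tp
      by (simp add: r_def)
    then show ?thesis unfolding el by (simp add: r_def)
  qed
  have "P = 0"
  proof (rule ccontr)
    assume P: "P \<noteq> 0"
    have "r ` X \<subseteq> {z. poly P z = 0}" using root by auto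
    then have "card (r ` X) \<le> degree P"
      using card_poly_roots_bound[OF P] card_mono[OF poly_roots_finite[OF P]] by (meson order_trans)
    moreover have "card (r ` X) = card X" by (rule card_image) (simp add: r_def inj_on_def)
    ultimately show False using X \<open>degree P \<le> 15\<close> by simp
  qed
  \<comment> \<open>\<open>z\<close> is a root of \<open>N\<close> and \<open>\<iota>\<close> a
    square root of -D; at \<open>z\<close> the conjugate vector (e, f) equals \<open>\<iota>\<close>
    (1, z).\<close>
  define \<iota> where "\<iota> = \<i> * r (sqrt D)"
  have i2: "\<iota>^2 = - r D" using D by (simp add: \<iota>_def r_def power_mult_distrib flip: of_real_power)
  have h: "h22 \<noteq> 0" using D by (auto simp: D_def)
  define z where "z = - (r h12 + \<iota>) / r h22"
  have hz: "r h22 * z = - (r h12 + \<iota>)" using h by (simp add: z_def r_def)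
  have rD: "r D = r h11 * r h22 - (r h12)^2" by (simp add: D_def r_def)
  have "r h22 * (r h11 + 2 * r h12 * z + r h22 * z^2) = 0"
    using hz i2 unfolding rD by algebra
  then have Nz: "r h11 + 2 * r h12 * z + r h22 * z^2 = 0" using h by (simp add: r_def)
  have "poly e z = - r h12 - r h22 * z" "poly f z = r h11 + r h12 * z"
    by (simp_all add: e_def f_def mult.commute)
  then have ez: "poly e z = \<iota>" and fz: "poly f z = \<iota> * z"
    using hz Nz by algebra+
  have "2 * poly N z = r h11 + 2 * r h12 * z + r h22 * z^2"
    by (simp add: N_def algebra_simps power2_eq_square)
  then have N0: "poly N z = 0" using Nz by simp
  define k where "k = poly a z"
  have k: "k = r a0 + r a1 * z + r a2 * z^2 + r a3 * z^3"
    by (simp add: k_def a_def algebra_simps power2_eq_square power3_eq_cube)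
  \<comment> \<open>\<open>k\<close>, \<open>b\<close>, \<open>g\<close>, \<open>d\<close> are the
    coefficients of the cubic along (1, z) + s (e, f). Since this vector is (1 +
    \<open>\<iota>\<close> s) (1, z), the cubic there is k (1 + \<open>\<iota>\<close> s)^3.\<close>
  have bz: "poly b z = 3 * \<iota> * k"
    unfolding b_def poly_add poly_mult ez fz k by (simp add: algebra_simps power2_eq_square power3_eq_cube)
  have gz: "poly g z = 3 * \<iota>^2 * k"
    unfolding g_def poly_add poly_mult poly_power ez fz k by (simp add: algebra_simps power2_eq_square power3_eq_cube)
  have dz: "poly d z = \<iota>^3 * k"
    unfolding d_def poly_add poly_mult poly_power ez fz k by (simp add: algebra_simps power2_eq_square power3_eq_cube)
  have "poly P z = 3 * (poly d z - r D * poly b z) * (2 * k * poly b z)^2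
      + 2 * (poly g z - r D * k) * (2 * k * poly b z) * (2 * k * poly g z - 2 * (poly b z)^2)"
    unfolding P_def V_def T_def U_def Y_def poly_add poly_diff poly_mult poly_power N0
    by (simp add: k_def)
  \<comment> \<open>The two summands contribute 432 and -576 times D^2 \<open>\<iota>\<close> k^5,
    so they do not cancel.\<close>
  also have "\<dots> = - 144 * (r D)^2 * \<iota> * k^5"
    using i2 unfolding bz gz dz by algebra
  finally have "k = 0" using \<open>P = 0\<close> D i2 by (auto simp: r_def)
  then show ?thesis
    using real_cubic_factor[OF D[unfolded D_def], of z a0 a1 a2 a3] Nz k unfolding r_def by simp
qed

section \<open>Expansion of the shadow boundary\<close>

text \<open>No smoothness of \<open>s\<close> is available, so coefficients are compared through
  limits. \<open>A\<close> improves the limit of s / t^2 to an expansion with two further terms;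
  \<open>B\<close> is divided by t^2, t^3 and t^4 in turn, each division being possible by the
  relation obtained before it.\<close>

lemma curve_coefficients:
  fixes s :: "real \<Rightarrow> real" and N D a b g d e0 e1 e2 p c \<mu> :: real
  defines "F \<equiv> at_right 0"
  assumes s: "((\<lambda>t. s t / t^2) \<longlongrightarrow> c * N) F"
    and A: "(\<lambda>t. s t - c * (N * t^2 + a * t^3 + N * D * s t^2 + b * t^2 * s t + e0 * t^4)) \<in> o[F](\<lambda>t. t^4)"
    and B: "(\<lambda>t. - \<mu> * (N * t^2 + 2 * a * t^3 + N * D * s t^2 + 2 * b * t^2 * s t + 3 * e0 * t^4)
        + (2 * N * D * s t + b * t^2 + 2 * g * t * s t + e1 * t^3 + 3 * d * s t^2 + 2 * e2 * t^2 * s t + p * t^4))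
        \<in> o[F](\<lambda>t. t^4)"
  shows "\<mu> * N = 2 * N * D * (c * N) + b"
    and "- 2 * \<mu> * a + 2 * N * D * (c * a) + e1 + 2 * g * (c * N) = 0"
    and "- \<mu> * (N * D * (c * N)^2 + 2 * b * (c * N) + 3 * e0)
      + 2 * N * D * (c * (N * D * (c * N)^2 + b * (c * N) + e0))
      + 2 * g * (c * a) + 3 * d * (c * N)^2 + 2 * e2 * (c * N) + p = 0"
proof -
  have t0: "eventually (\<lambda>t. t > (0::real)) F" unfolding F_def by (simp add: eventually_at_right_less)
  have id: "((\<lambda>t. t) \<longlongrightarrow> (0::real)) F" unfolding F_def by (simp add: tendsto_ident_at)
  have nt: "F \<noteq> bot" unfolding F_def by simp
  define u where "u t = s t / t^2" for t
  have su: "s t = u t * t^2" if "t > 0" for t using that by (simp add: u_def)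
  have ulim: "(u \<longlongrightarrow> c * N) F" using s by (simp add: u_def[abs_def])
  define rA where "rA t = (s t - c * (N * t^2 + a * t^3 + N * D * s t^2 + b * t^2 * s t + e0 * t^4)) / t^4" for t
  have rA: "(rA \<longlongrightarrow> 0) F" using smalloD_tendsto[OF A] by (simp add: rA_def[abs_def])
  define rB where "rB t = (- \<mu> * (N * t^2 + 2 * a * t^3 + N * D * s t^2 + 2 * b * t^2 * s t + 3 * e0 * t^4)
        + (2 * N * D * s t + b * t^2 + 2 * g * t * s t + e1 * t^3 + 3 * d * s t^2 + 2 * e2 * t^2 * s t + p * t^4)) / t^4" for t
  have rB: "(rB \<longlongrightarrow> 0) F" using smalloD_tendsto[OF B] by (simp add: rB_def[abs_def])
  \<comment> \<open>\<open>c * Z\<close> stands for the second-order coefficient of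
    \<open>u\<close>. It still depends on \<open>t\<close>, but it converges, and its limit is all
    that the third relation sees.\<close>
  define Z where "Z t = N * D * (u t)^2 + b * u t + e0" for t
  have uA: "u t = c * N + c * a * t + c * Z t * t^2 + rA t * t^2" if "t > 0" for t
  proof -
    have "rA t * t^4 = s t - c * (N * t^2 + a * t^3 + N * D * s t^2 + b * t^2 * s t + e0 * t^4)"
      using that by (simp add: rA_def)
    then have "t^2 * u t = t^2 * (c * N + c * a * t + c * Z t * t^2 + rA t * t^2)"
      unfolding su[OF that] Z_def by algebra
    then show ?thesis using that by simp
  qed
  have uB: "rB t * t^2 = - \<mu> * (N + 2 * a * t + t^2 * (N * D * (u t)^2 + 2 * b * u t + 3 * e0))
      + (2 * N * D * u t + b + t * (2 * g * u t + e1) + t^2 * (3 * d * (u t)^2 + 2 * e2 * u t + p))" if "t > 0" for t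
  proof -
    have "rB t * t^4 = - \<mu> * (N * t^2 + 2 * a * t^3 + N * D * s t^2 + 2 * b * t^2 * s t + 3 * e0 * t^4)
        + (2 * N * D * s t + b * t^2 + 2 * g * t * s t + e1 * t^3 + 3 * d * s t^2 + 2 * e2 * t^2 * s t + p * t^4)"
      using that by (simp add: rB_def)
    then have "t^2 * (rB t * t^2) = t^2 * (- \<mu> * (N + 2 * a * t + t^2 * (N * D * (u t)^2 + 2 * b * u t + 3 * e0))
      + (2 * N * D * u t + b + t * (2 * g * u t + e1) + t^2 * (3 * d * (u t)^2 + 2 * e2 * u t + p)))"
      unfolding su[OF that] by algebra
    then show ?thesis using that by simp
  qed
  have Zlim: "(Z \<longlongrightarrow> N * D * (c * N)^2 + b * (c * N) + e0) F"
    unfolding Z_def by (intro tendsto_intros ulim)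
  let ?L = "\<lambda>t. - \<mu> * (N + 2 * a * t + t^2 * (N * D * (u t)^2 + 2 * b * u t + 3 * e0))
      + (2 * N * D * u t + b + t * (2 * g * u t + e1) + t^2 * (3 * d * (u t)^2 + 2 * e2 * u t + p))"
  have "(?L \<longlongrightarrow> - \<mu> * (N + 2 * a * 0 + 0^2 * (N * D * (c * N)^2 + 2 * b * (c * N) + 3 * e0))
      + (2 * N * D * (c * N) + b + 0 * (2 * g * (c * N) + e1) + 0^2 * (3 * d * (c * N)^2 + 2 * e2 * (c * N) + p))) F"
    by (intro tendsto_intros ulim id)
  moreover have "(?L \<longlongrightarrow> 0 * 0^2) F"
    by (rule Lim_transform_eventually[OF tendsto_mult[OF rB tendsto_power[OF id]]])
      (use t0 in eventually_elim, simp only: uB)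
  ultimately have E0: "\<mu> * N = 2 * N * D * (c * N) + b"
    using tendsto_unique[OF nt] by fastforce
  let ?L1 = "\<lambda>t. - \<mu> * (2 * a + t * (N * D * (u t)^2 + 2 * b * u t + 3 * e0))
      + (2 * N * D * (c * a + c * Z t * t + rA t * t) + (2 * g * u t + e1) + t * (3 * d * (u t)^2 + 2 * e2 * u t + p))"
  have L1: "rB t * t = ?L1 t" if "t > 0" for t
  proof -
    have "t * (rB t * t) = rB t * t^2" by (simp add: power2_eq_square)
    also have "\<dots> = t * ?L1 t" using uB[OF that] uA[OF that] E0 by algebra
    finally show ?thesis using that by (metis mult_cancel_left less_irrefl)
  qed
  have "(?L1 \<longlongrightarrow> - \<mu> * (2 * a + 0 * (N * D * (c * N)^2 + 2 * b * (c * N) + 3 * e0))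
      + (2 * N * D * (c * a + c * (N * D * (c * N)^2 + b * (c * N) + e0) * 0 + 0 * 0) + (2 * g * (c * N) + e1)
        + 0 * (3 * d * (c * N)^2 + 2 * e2 * (c * N) + p))) F"
    by (intro tendsto_intros ulim id Zlim rA)
  moreover have "(?L1 \<longlongrightarrow> 0 * 0) F"
    by (rule Lim_transform_eventually[OF tendsto_mult[OF rB id]])
      (use t0 in eventually_elim, simp only: L1)
  ultimately have "- \<mu> * (2 * a + 0 * (N * D * (c * N)^2 + 2 * b * (c * N) + 3 * e0))
      + (2 * N * D * (c * a + c * (N * D * (c * N)^2 + b * (c * N) + e0) * 0 + 0 * 0) + (2 * g * (c * N) + e1)
        + 0 * (3 * d * (c * N)^2 + 2 * e2 * (c * N) + p)) = 0 * 0"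
    using tendsto_unique[OF nt] by blast
  then have E1: "- 2 * \<mu> * a + 2 * N * D * (c * a) + e1 + 2 * g * (c * N) = 0" by simp
  let ?L2 = "\<lambda>t. - \<mu> * (N * D * (u t)^2 + 2 * b * u t + 3 * e0)
      + (2 * N * D * (c * Z t + rA t) + 2 * g * (c * a + c * Z t * t + rA t * t) + (3 * d * (u t)^2 + 2 * e2 * u t + p))"
  have L2: "rB t = ?L2 t" if "t > 0" for t
  proof -
    have "t * rB t = rB t * t" by simp
    also have "\<dots> = t * ?L2 t" using L1[OF that] uA[OF that] E1 by algebra
    finally show ?thesis using that by (metis mult_cancel_left less_irrefl)
  qed
  have "(?L2 \<longlongrightarrow> - \<mu> * (N * D * (c * N)^2 + 2 * b * (c * N) + 3 * e0)
      + (2 * N * D * (c * (N * D * (c * N)^2 + b * (c * N) + e0) + 0)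
      + 2 * g * (c * a + c * (N * D * (c * N)^2 + b * (c * N) + e0) * 0 + 0 * 0)
      + (3 * d * (c * N)^2 + 2 * e2 * (c * N) + p))) F"
    by (intro tendsto_intros ulim id Zlim rA)
  moreover have "(?L2 \<longlongrightarrow> 0) F"
    by (rule Lim_transform_eventually[OF rB])
      (use t0 in eventually_elim, simp only: L2)
  ultimately have "- \<mu> * (N * D * (c * N)^2 + 2 * b * (c * N) + 3 * e0)
      + (2 * N * D * (c * (N * D * (c * N)^2 + b * (c * N) + e0) + 0)
      + 2 * g * (c * a + c * (N * D * (c * N)^2 + b * (c * N) + e0) * 0 + 0 * 0)
      + (3 * d * (c * N)^2 + 2 * e2 * (c * N) + p)) = 0"
    using tendsto_unique[OF nt] by blast
  then have E2: "- \<mu> * (N * D * (c * N)^2 + 2 * b * (c * N) + 3 * e0)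
      + 2 * N * D * (c * (N * D * (c * N)^2 + b * (c * N) + e0))
      + 2 * g * (c * a) + 3 * d * (c * N)^2 + 2 * e2 * (c * N) + p = 0" by simp
  show "\<mu> * N = 2 * N * D * (c * N) + b"
    and "- 2 * \<mu> * a + 2 * N * D * (c * a) + e1 + 2 * g * (c * N) = 0"
    and "- \<mu> * (N * D * (c * N)^2 + 2 * b * (c * N) + 3 * e0)
      + 2 * N * D * (c * (N * D * (c * N)^2 + b * (c * N) + e0))
      + 2 * g * (c * a) + 3 * d * (c * N)^2 + 2 * e2 * (c * N) + p = 0"
    by (fact E0 E1 E2)+
qed

text \<open>The numbers \<open>N\<close>, \<open>a\<close>, \<open>b\<close>, \<open>g\<close>, \<open>d\<close>, \<open>e0\<close>, \<open>e1\<close>, \<open>e2\<close>, \<open>p\<close> are the relevant Taylor coefficients of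
  \<open>(t, s) \<mapsto> \<phi> (t (1, x) + s (e, f))\<close>, where \<open>(e, f)\<close> is conjugate to \<open>(1, x)\<close> and the light source is
  at \<open>lam (e, f)\<close>. Near the origin the shadow boundary is a curve \<open>s = O(t\<^sup>2)\<close>, and flatness forces
  \<open>s = c \<phi>\<close> along it.\<close>

lemma shadow_curve_relations:
  fixes \<phi> \<phi>1 \<phi>2 :: "real \<times> real \<Rightarrow> real"
    and h11 h12 h22 a0 a1 a2 a3 b0 b1 b2 b3 b4 c0 c1 c2 c3 c4 c5 x lam r l m k :: real
  assumes D: "D = h11 * h22 - h12^2" "D > 0" and r: "r > 0" and lam: "lam \<noteq> 0"
    and defs: "e = - (h12 + h22 * x)" "f = h11 + h12 * x"
        "N = (h11 + 2 * h12 * x + h22 * x^2) / 2"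
        "a = a0 + a1 * x + a2 * x^2 + a3 * x^3"
        "b = e * (3 * a0 + 2 * a1 * x + a2 * x^2) + f * (a1 + 2 * a2 * x + 3 * a3 * x^2)"
        "g = e^2 * (3 * a0 + a1 * x) + e * f * (2 * a1 + 2 * a2 * x) + f^2 * (a2 + 3 * a3 * x)"
        "d = a0 * e^3 + a1 * e^2 * f + a2 * e * f^2 + a3 * f^3"
        "e0 = b0 + b1 * x + b2 * x^2 + b3 * x^3 + b4 * x^4"
        "e1 = e * (4 * b0 + 3 * b1 * x + 2 * b2 * x^2 + b3 * x^3) + f * (b1 + 2 * b2 * x + 3 * b3 * x^2 + 4 * b4 * x^3)"
        "e2 = e^2 * (6 * b0 + 3 * b1 * x + b2 * x^2) + e * f * (3 * b1 + 4 * b2 * x + 3 * b3 * x^2)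
            + f^2 * (b2 + 3 * b3 * x + 6 * b4 * x^2)"
        "p = e * (5 * c0 + 4 * c1 * x + 3 * c2 * x^2 + 2 * c3 * x^3 + c4 * x^4)
            + f * (c1 + 2 * c2 * x + 3 * c3 * x^2 + 4 * c4 * x^3 + 5 * c5 * x^4)"
    and cont: "continuous_on (ball 0 r) \<phi>" "continuous_on (ball 0 r) \<phi>1" "continuous_on (ball 0 r) \<phi>2"
    and low: "\<phi> \<in> o[nhds 0](norm)"
      "(\<lambda>v. \<phi>1 v - (h11 * fst v + h12 * snd v)) \<in> o[nhds 0](norm)"
      "(\<lambda>v. \<phi>2 v - (h12 * fst v + h22 * snd v)) \<in> o[nhds 0](norm)"
    and mid: "(\<lambda>v. \<phi> v - (h11 * fst v^2 + 2 * h12 * fst v * snd v + h22 * snd v^2) / 2) \<in> o[nhds 0](\<lambda>v. norm v^2)"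
    and high: "(\<lambda>(v,w). \<phi> (v,w) - ((h11 * v^2 + 2 * h12 * v * w + h22 * w^2) / 2
        + (a0 * v^3 + a1 * v^2 * w + a2 * v * w^2 + a3 * w^3)
        + (b0 * v^4 + b1 * v^3 * w + b2 * v^2 * w^2 + b3 * v * w^3 + b4 * w^4))) \<in> o[nhds 0](\<lambda>v. norm v^4)"
      "(\<lambda>(v,w). \<phi>1 (v,w) - ((h11 * v + h12 * w) + (3 * a0 * v^2 + 2 * a1 * v * w + a2 * w^2)
        + (4 * b0 * v^3 + 3 * b1 * v^2 * w + 2 * b2 * v * w^2 + b3 * w^3)
        + (5 * c0 * v^4 + 4 * c1 * v^3 * w + 3 * c2 * v^2 * w^2 + 2 * c3 * v * w^3 + c4 * w^4))) \<in> o[nhds 0](\<lambda>v. norm v^4)"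
      "(\<lambda>(v,w). \<phi>2 (v,w) - ((h12 * v + h22 * w) + (a1 * v^2 + 2 * a2 * v * w + 3 * a3 * w^2)
        + (b1 * v^3 + 2 * b2 * v^2 * w + 3 * b3 * v * w^2 + 4 * b4 * w^3)
        + (c1 * v^4 + 2 * c2 * v^3 * w + 3 * c3 * v^2 * w^2 + 4 * c4 * v * w^3 + 5 * c5 * w^4))) \<in> o[nhds 0](\<lambda>v. norm v^4)"
    and nz: "(l, m, k) \<noteq> (0, 0, 0)"
    and flat: "\<And>v w. \<lbrakk>(v, w) \<in> ball 0 r; \<phi> (v,w) + \<phi>1 (v,w) * (lam * e - v) + \<phi>2 (v,w) * (lam * f - w) = 0\<rbrakk>
      \<Longrightarrow> l * v + m * w + k * \<phi> (v,w) = 0"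
  shows "\<exists>\<mu> c. \<mu> * N = 2 * N * D * (c * N) + b \<and>
       - 2 * \<mu> * a + 2 * N * D * (c * a) + e1 + 2 * g * (c * N) = 0 \<and>
       - \<mu> * (N * D * (c * N)^2 + 2 * b * (c * N) + 3 * e0)
        + 2 * N * D * (c * (N * D * (c * N)^2 + b * (c * N) + e0))
        + 2 * g * (c * a) + 3 * d * (c * N)^2 + 2 * e2 * (c * N) + p = 0"
proof -
  define F where "F = at_right (0::real)"
  have t0: "eventually (\<lambda>t. t > 0) F" unfolding F_def by (simp add: eventually_at_right_less)
  have id: "((\<lambda>t. t) \<longlongrightarrow> 0) F" unfolding F_def by (simp add: tendsto_ident_at)
  have nt: "F \<noteq> bot" unfolding F_def by simp
  have N0: "N \<noteq> 0"
  proof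
    assume "N = 0"
    then have "h11 + 2 * h12 * x + h22 * x^2 = 0" by (simp add: defs)
    then have "(h22 * x + h12)^2 = - D" unfolding D by algebra
    then show False using D(2) by (metis neg_0_le_iff_le not_less zero_le_power2)
  qed
  have N2: "2 * N = h11 + 2 * h12 * x + h22 * x^2" by (simp add: defs)
  \<comment> \<open>\<open>G v = 0\<close> says that the tangent plane of the graph at the point
    over \<open>v\<close> contains the source, which has height 0. \<open>Lin\<close> is the linear
    part of \<open>G\<close>, namely \<open>lam\<close> times the Hessian paired with (e, f); by
    conjugacy it depends on the coordinate \<open>s\<close> alone, see \<open>LV\<close>.\<close>
  define G where "G v = \<phi> v + \<phi>1 v * (lam * e - fst v) + \<phi>2 v * (lam * f - snd v)" for v
  define Lin where "Lin v = lam * (e * (h11 * fst v + h12 * snd v) + f * (h12 * fst v + h22 * snd v))" for v :: "real \<times> real"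
  have fs: "fst \<in> O[nhds 0](norm :: real \<times> real \<Rightarrow> real)" "snd \<in> O[nhds 0](norm :: real \<times> real \<Rightarrow> real)"
    by (auto intro!: landau_o.bigI[of 1] always_eventually simp: real_sqrt_sum_squares_ge1 real_sqrt_sum_squares_ge2 norm_Pair)
  have n1: "(norm :: real \<times> real \<Rightarrow> real) \<in> o[nhds 0](\<lambda>_. 1)"
    by (rule smalloI_tendsto) (auto intro!: tendsto_eq_intros filterlim_ident)
  have p1: "\<phi>1 \<in> o[nhds 0](\<lambda>_. 1)" and p2: "\<phi>2 \<in> o[nhds 0](\<lambda>_. 1)"
  proof -
    have lin: "(\<lambda>v. A * fst v + B * snd v) \<in> O[nhds 0](norm :: real \<times> real \<Rightarrow> real)" for A B
      using fs by (intro sum_in_bigo) auto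
    have "\<phi>1 \<in> O[nhds 0](norm)"
      using sum_in_bigo(1)[OF landau_o.small_imp_big[OF low(2)] lin[of h11 h12]] by simp
    then show "\<phi>1 \<in> o[nhds 0](\<lambda>_. 1)" using n1 by (rule landau_o.big_small_trans)
    have "\<phi>2 \<in> O[nhds 0](norm)"
      using sum_in_bigo(1)[OF landau_o.small_imp_big[OF low(3)] lin[of h12 h22]] by simp
    then show "\<phi>2 \<in> o[nhds 0](\<lambda>_. 1)" using n1 by (rule landau_o.big_small_trans)
  qed
  have GL: "(\<lambda>v. G v - Lin v) \<in> o[nhds 0](norm)"
  proof -
    have "(\<lambda>v. \<phi> v + lam * e * (\<phi>1 v - (h11 * fst v + h12 * snd v)) + lam * f * (\<phi>2 v - (h12 * fst v + h22 * snd v))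
        - \<phi>1 v * fst v - \<phi>2 v * snd v) \<in> o[nhds 0](norm)"
      using low landau_o.small_big_mult[OF p1 fs(1)] landau_o.small_big_mult[OF p2 fs(2)]
      by (intro sum_in_smallo) auto
    moreover have "G v - Lin v = \<phi> v + lam * e * (\<phi>1 v - (h11 * fst v + h12 * snd v)) + lam * f * (\<phi>2 v - (h12 * fst v + h22 * snd v))
        - \<phi>1 v * fst v - \<phi>2 v * snd v" for v
      unfolding G_def Lin_def by algebra
    ultimately show ?thesis by simp
  qed
  define V where "V t s = (t + s * e, t * x + s * f)" for t s
  have LV: "Lin (V t s) = 2 * (lam * N * D) * s" for t s
    using N2 unfolding Lin_def V_def fst_conv snd_conv D(1) defs(1,2) by algebra
  define C where "C = 1 + \<bar>e\<bar> + \<bar>x\<bar> + \<bar>f\<bar>"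
  have C: "C > 0" by (simp add: C_def)
  have VC: "norm (V t s) \<le> C * t" if "\<bar>s\<bar> \<le> t" for t s
  proof -
    have "norm (V t s) \<le> \<bar>t + s * e\<bar> + \<bar>t * x + s * f\<bar>" unfolding V_def by (rule order.trans[OF norm_Pair_le]) simp
    also have "\<dots> \<le> \<bar>t\<bar> + \<bar>s\<bar> * \<bar>e\<bar> + (\<bar>t\<bar> * \<bar>x\<bar> + \<bar>s\<bar> * \<bar>f\<bar>)"
      by (intro add_mono order.trans[OF abs_triangle_ineq]) (simp_all add: abs_mult)
    also have "\<dots> \<le> t + t * \<bar>e\<bar> + (t * \<bar>x\<bar> + t * \<bar>f\<bar>)"
      using that by (intro add_mono mult_right_mono) auto
    finally show ?thesis by (simp add: C_def algebra_simps)
  qed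
  define \<kappa> where "\<kappa> = \<bar>lam * N * D\<bar>"
  have \<kappa>: "\<kappa> > 0" using lam N0 D(2) by (simp add: \<kappa>_def)
  have "eventually (\<lambda>v. norm (G v - Lin v) \<le> \<kappa> / C * norm (norm v)) (nhds 0)"
    using GL \<kappa> C by (intro landau_o.smallD) auto
  then obtain \<delta> where \<delta>: "\<delta> > 0" and GLd: "\<And>v. norm v < \<delta> \<Longrightarrow> \<bar>G v - Lin v\<bar> \<le> \<kappa> / C * norm v"
    unfolding eventually_nhds_metric by (auto simp: dist_norm)
  \<comment> \<open>For |s| up to \<open>t\<close> the error of the linear part is at most half of
    its size at s = t and s = -t, so \<open>G\<close> changes sign in between. The factor lam N D in
    \<open>\<psi>\<close> fixes which sign occurs at which end.\<close>
  have ex: "\<exists>s. \<bar>s\<bar> \<le> t \<and> G (V t s) = 0" if t: "0 < t" "C * t < \<delta>" "C * t < r" for t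
  proof -
    define \<psi> where "\<psi> s = G (V t s) * (lam * N * D)" for s
    have est: "\<bar>\<psi> s - 2 * \<kappa>^2 * s\<bar> \<le> \<kappa>^2 * t" if "\<bar>s\<bar> \<le> t" for s
    proof -
      have "\<bar>G (V t s) - Lin (V t s)\<bar> \<le> \<kappa> / C * (C * t)"
        using GLd[of "V t s"] VC[OF that] t \<kappa> C by (smt (verit) divide_pos_pos mult_left_mono)
      then have "\<bar>G (V t s) - Lin (V t s)\<bar> * \<kappa> \<le> \<kappa> * t * \<kappa>" using C \<kappa> by (simp add: mult.commute)
      moreover have "\<psi> s - 2 * \<kappa>^2 * s = (G (V t s) - Lin (V t s)) * (lam * N * D)"
        unfolding \<psi>_def LV \<kappa>_def power2_abs by algebra
      ultimately show ?thesis by (simp add: abs_mult \<kappa>_def power2_eq_square mult.commute mult.left_commute)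
    qed
    have kt: "\<kappa>^2 * t > 0" using \<kappa> t by simp
    have "\<psi> (-t) \<le> 0" "0 \<le> \<psi> t" using est[of t] est[of "-t"] t kt by auto
    moreover have "continuous_on {-t..t} \<psi>"
    proof -
      have "(\<lambda>s. V t s) ` {-t..t} \<subseteq> ball 0 r" using VC t by (force simp: abs_le_iff)
      moreover have "continuous_on {-t..t} (V t)" unfolding V_def by (intro continuous_intros)
      ultimately show ?thesis unfolding \<psi>_def G_def
        by (intro continuous_intros continuous_on_compose2[OF cont(1)] continuous_on_compose2[OF cont(2)]
            continuous_on_compose2[OF cont(3)]) auto
    qed
    ultimately obtain s where "-t \<le> s" "s \<le> t" "\<psi> s = 0"
      using IVT'[of \<psi> "-t" 0 t] t by auto
    then show ?thesis using \<kappa> by (intro exI[of _ s]) (auto simp: \<psi>_def \<kappa>_def)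
  qed
  \<comment> \<open>An arbitrary zero is chosen for each \<open>t\<close>. All further information
    on \<open>s\<close> comes from |s| <= t, the shadow equation and flatness.\<close>
  define s where "s t = (SOME s. \<bar>s\<bar> \<le> t \<and> G (V t s) = 0)" for t
  have tsm: "eventually (\<lambda>t. C * t < \<epsilon>) F" if "\<epsilon> > 0" for \<epsilon>
    using order_tendstoD(2)[OF tendsto_mult_right_zero[OF id, of C] that] .
  have sev: "eventually (\<lambda>t. 0 < t \<and> \<bar>s t\<bar> \<le> t \<and> G (V t (s t)) = 0 \<and> C * t < r) F"
    using t0 tsm[OF \<delta>] tsm[OF r]
  proof eventually_elim
    case (elim t)
    then show ?case using someI_ex[OF ex[of t]] by (simp add: s_def)
  qed
  define v where "v t = V t (s t)" for t
  define v1 v2 where "v1 t = t + s t * e" and "v2 t = t * x + s t * f" for t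
  have v: "v t = (v1 t, v2 t)" for t by (simp add: v_def V_def v1_def v2_def)
  have vO: "(\<lambda>t. norm (v t)) \<in> O[F](\<lambda>t. t)"
    by (rule landau_o.bigI[OF C], rule eventually_mono[OF sev]) (use VC in \<open>auto simp: v_def\<close>)
  have vlim: "filterlim v (nhds 0) F"
  proof -
    have "(\<lambda>t. norm (v t)) \<in> o[F](\<lambda>_. 1)"
      using vO by (rule landau_o.big_small_trans) (use id in \<open>auto intro!: smalloI_tendsto\<close>)
    from smalloD_tendsto[OF this] show ?thesis by (simp add: tendsto_norm_zero_iff)
  qed
  have comp: "(\<lambda>t. R (v t)) \<in> o[F](\<lambda>t. t^n)" if "R \<in> o[nhds 0](\<lambda>v. norm v^n)" for R :: "real \<times> real \<Rightarrow> real" and n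
    by (rule landau_o.small_big_trans[OF landau_o.small.compose[OF that vlim]]) (rule landau_o.big_power[OF vO])
  \<comment> \<open>On the zero set of \<open>G\<close> the linear part equals the error term, so it
    is o(t), and it is a nonzero multiple of \<open>s\<close>.\<close>
  have so: "s \<in> o[F](\<lambda>t. t)"
  proof -
    have "(\<lambda>t. G (v t) - Lin (v t)) \<in> o[F](\<lambda>t. t)"
      using comp[of "\<lambda>v. G v - Lin v" 1] GL by simp
    then have "(\<lambda>t. - 2 * (lam * N * D) * s t) \<in> o[F](\<lambda>t. t)"
      by (rule landau_o.small.in_cong[THEN iffD1, rotated]) (use sev in \<open>eventually_elim, simp add: v_def LV\<close>)
    then show ?thesis using lam N0 D(2) by simp
  qed
  then have st: "((\<lambda>t. s t / t) \<longlongrightarrow> 0) F" by (rule smalloD_tendsto)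
  have pl: "eventually (\<lambda>t. (l + m * x) * t + (l * e + m * f) * s t + k * \<phi> (v t) = 0) F"
    using sev
  proof eventually_elim
    case (elim t)
    have "norm (v t) < r" using VC[of "s t" t] elim by (simp add: v_def)
    then have "l * v1 t + m * v2 t + k * \<phi> (v1 t, v2 t) = 0"
      using flat[of "v1 t" "v2 t"] elim unfolding v[symmetric] by (simp add: G_def v_def[symmetric]) (simp add: v)
    then show ?case unfolding v v1_def v2_def by algebra
  qed
  have ft: "(\<lambda>t. \<phi> (v t)) \<in> o[F](\<lambda>t. t)" using comp[of \<phi> 1] low(1) by simp
  \<comment> \<open>In the equation of the plane the term linear in \<open>t\<close> must vanish,
    because \<open>s\<close> and the height are both o(t).\<close>
  have "l + m * x = 0"
  proof (rule ccontr)
    assume "l + m * x \<noteq> 0"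
    have "(\<lambda>t. - (l * e + m * f) * s t - k * \<phi> (v t)) \<in> o[F](\<lambda>t. t)"
      using so ft by (intro sum_in_smallo) auto
    then have "(\<lambda>t. (l + m * x) * t) \<in> o[F](\<lambda>t. t)"
      by (rule landau_o.small.in_cong[THEN iffD1, rotated]) (use pl in \<open>eventually_elim, algebra\<close>)
    then have "(\<lambda>t. t) \<in> o[F](\<lambda>t::real. t)" using \<open>l + m * x \<noteq> 0\<close> by simp
    then have "eventually (\<lambda>t. t = (0::real)) F" by (simp add: landau_o.small_refl_iff)
    with t0 have "eventually (\<lambda>t. False) F" by eventually_elim simp
    then show False using nt by simp
  qed
  then have pl2: "eventually (\<lambda>t. (l * e + m * f) * s t + k * \<phi> (v t) = 0) F"
    using pl by simp
  have st2: "((\<lambda>t. (s t)^2 / t^2) \<longlongrightarrow> 0) F" using tendsto_power[OF st, of 2] by (simp add: power_divide)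
  have QV: "(h11 * v1 t^2 + 2 * h12 * v1 t * v2 t + h22 * v2 t^2) / 2 = N * t^2 + N * D * (s t)^2" for t
  proof -
    have "h11 * v1 t^2 + 2 * h12 * v1 t * v2 t + h22 * v2 t^2 = (2 * N) * t^2 + (2 * N) * D * (s t)^2"
      unfolding v1_def v2_def defs(1,2) D(1) N2 by algebra
    then show ?thesis by simp
  qed
  have phi2: "((\<lambda>t. \<phi> (v t) / t^2) \<longlongrightarrow> N) F"
  proof -
    have 1: "((\<lambda>t. (\<phi> (v t) - (N * t^2 + N * D * (s t)^2)) / t^2) \<longlongrightarrow> 0) F"
      using smalloD_tendsto[OF comp[OF mid]] unfolding v fst_conv snd_conv QV .
    have "((\<lambda>t. (\<phi> (v t) - (N * t^2 + N * D * (s t)^2)) / t^2 + (N + N * D * ((s t)^2 / t^2))) \<longlongrightarrow> 0 + (N + N * D * 0)) F"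
      by (intro tendsto_intros 1 st2)
    then have 2: "((\<lambda>t. (\<phi> (v t) - (N * t^2 + N * D * (s t)^2)) / t^2 + (N + N * D * ((s t)^2 / t^2))) \<longlongrightarrow> N) F"
      by simp
    show ?thesis
      by (rule Lim_transform_eventually[OF 2]) (use t0 in \<open>eventually_elim, simp add: field_simps\<close>)
  qed
  \<comment> \<open>Otherwise only k times the height remains, and the height behaves like N t^2, so
    k = 0. Then (l, m) annihilates both (1, x) and (e, f), whose determinant is 2 N.\<close>
  have A0: "l * e + m * f \<noteq> 0"
  proof
    assume A0: "l * e + m * f = 0"
    have "k = 0"
    proof (rule ccontr)
      assume "k \<noteq> 0"
      then have "eventually (\<lambda>t. 0 = \<phi> (v t) / t^2) F" using pl2 A0 by (auto elim!: eventually_mono)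
      then have "((\<lambda>t. 0) \<longlongrightarrow> N) F" using phi2 by (simp add: tendsto_cong[of "\<lambda>t. 0" "\<lambda>t. \<phi> (v t) / t^2"])
      then show False using N0 nt by (simp add: tendsto_const_iff)
    qed
    moreover have "2 * N * m = 0" using A0 \<open>l + m * x = 0\<close> unfolding N2 defs(1,2) by algebra
    ultimately show False using N0 nz \<open>l + m * x = 0\<close> by auto
  qed
  define c where "c = - k / (l * e + m * f)"
  have sc: "eventually (\<lambda>t. s t = c * \<phi> (v t)) F"
    using pl2 by eventually_elim (use A0 in \<open>simp add: c_def field_simps eq_neg_iff_add_eq_0\<close>)
  have slim: "((\<lambda>t. s t / t^2) \<longlongrightarrow> c * N) F"
    by (rule Lim_transform_eventually[OF tendsto_mult_left[OF phi2, of c]]) (use sc in \<open>eventually_elim, simp\<close>)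
  have sO: "s \<in> O[F](\<lambda>t. t^2)"
    by (rule bigoI_tendsto[OF slim]) (use t0 in \<open>eventually_elim, simp\<close>)
  have tn: "(\<lambda>t. t^n) \<in> o[F](\<lambda>t. t^4)" if n: "n > 4" for n
  proof (rule smalloI_tendsto)
    have "((\<lambda>t. t^(n - 4)) \<longlongrightarrow> 0^(n - 4)) F" by (intro tendsto_intros id)
    then have *: "((\<lambda>t. t^(n - 4)) \<longlongrightarrow> 0) F" using n by (simp add: power_0_left)
    show "((\<lambda>t. t^n / t^4) \<longlongrightarrow> 0) F"
      by (rule Lim_transform_eventually[OF *]) (use t0 in \<open>eventually_elim, use n in \<open>simp add: power_diff\<close>\<close>)
  qed (use t0 in \<open>eventually_elim, simp\<close>)
  \<comment> \<open>Along the curve \<open>s\<close> has weight 2 because it is a constant multiple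
    of the height.\<close>
  have ts: "(\<lambda>t. t^i * s t^j) \<in> o[F](\<lambda>t. t^4)" if "i + 2 * j > 4" for i j
  proof -
    have "(\<lambda>t. t^i * s t^j) \<in> O[F](\<lambda>t. t^i * (t^2)^j)"
      by (intro landau_o.big_mult landau_o.big_power sO) simp
    also have "(\<lambda>t::real. t^i * (t^2)^j) = (\<lambda>t. t^(i + 2 * j))" by (simp add: power_add power_mult)
    finally show ?thesis using tn[OF that] by (rule landau_o.big_small_trans)
  qed
  have v1l: "((\<lambda>t. v1 t / t) \<longlongrightarrow> 1) F" and v2l: "((\<lambda>t. v2 t / t) \<longlongrightarrow> x) F"
  proof -
    have "((\<lambda>t. 1 + s t / t * e) \<longlongrightarrow> 1 + 0 * e) F" "((\<lambda>t. x + s t / t * f) \<longlongrightarrow> x + 0 * f) F"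
      by (intro tendsto_intros st)+
    then have *: "((\<lambda>t. 1 + s t / t * e) \<longlongrightarrow> 1) F" "((\<lambda>t. x + s t / t * f) \<longlongrightarrow> x) F" by simp_all
    show "((\<lambda>t. v1 t / t) \<longlongrightarrow> 1) F" "((\<lambda>t. v2 t / t) \<longlongrightarrow> x) F"
      by (rule Lim_transform_eventually[OF *(1)] Lim_transform_eventually[OF *(2)],
          use t0 in \<open>eventually_elim, simp add: v1_def v2_def field_simps\<close>)+
  qed
  have vm: "(\<lambda>t. v1 t^i * v2 t^j - x^j * t^(i + j)) \<in> o[F](\<lambda>t. t^(i + j))" for i j
  proof (rule smalloI_tendsto)
    have "((\<lambda>t. (v1 t / t)^i * (v2 t / t)^j - x^j) \<longlongrightarrow> 1^i * x^j - x^j) F"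
      by (intro tendsto_intros v1l v2l)
    then have *: "((\<lambda>t. (v1 t / t)^i * (v2 t / t)^j - x^j) \<longlongrightarrow> 0) F" by simp
    show "((\<lambda>t. (v1 t^i * v2 t^j - x^j * t^(i + j)) / t^(i + j)) \<longlongrightarrow> 0) F"
      by (rule Lim_transform_eventually[OF *])
        (use t0 in \<open>eventually_elim, simp add: power_divide power_add diff_divide_distrib\<close>)
  qed (use t0 in \<open>eventually_elim, simp\<close>)
  \<comment> \<open>For terms of degree four the curve may be replaced by its tangent ray (1,
    x).\<close>
  have q4: "(\<lambda>t. (d0 * v1 t^4 + d1 * v1 t^3 * v2 t + d2 * v1 t^2 * v2 t^2 + d3 * v1 t * v2 t^3 + d4 * v2 t^4)
      - (d0 + d1 * x + d2 * x^2 + d3 * x^3 + d4 * x^4) * t^4) \<in> o[F](\<lambda>t. t^4)" for d0 d1 d2 d3 d4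
  proof -
    have "(\<lambda>t. d0 * (v1 t^4 * v2 t^0 - x^0 * t^(4 + 0)) + d1 * (v1 t^3 * v2 t^1 - x^1 * t^(3 + 1))
        + d2 * (v1 t^2 * v2 t^2 - x^2 * t^(2 + 2)) + d3 * (v1 t^1 * v2 t^3 - x^3 * t^(1 + 3))
        + d4 * (v1 t^0 * v2 t^4 - x^4 * t^(0 + 4))) \<in> o[F](\<lambda>t. t^4)"
      using vm[of 4 0] vm[of 3 1] vm[of 2 2] vm[of 1 3] vm[of 0 4] by (intro sum_in_smallo) auto
    moreover have "(d0 * v1 t^4 + d1 * v1 t^3 * v2 t + d2 * v1 t^2 * v2 t^2 + d3 * v1 t * v2 t^3 + d4 * v2 t^4)
      - (d0 + d1 * x + d2 * x^2 + d3 * x^3 + d4 * x^4) * t^4 = d0 * (v1 t^4 * v2 t^0 - x^0 * t^(4 + 0)) + d1 * (v1 t^3 * v2 t^1 - x^1 * t^(3 + 1))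
        + d2 * (v1 t^2 * v2 t^2 - x^2 * t^(2 + 2)) + d3 * (v1 t^1 * v2 t^3 - x^3 * t^(1 + 3))
        + d4 * (v1 t^0 * v2 t^4 - x^4 * t^(0 + 4))" for t
      by (simp add: algebra_simps)
    ultimately show ?thesis by simp
  qed
  have v1O: "v1 \<in> O[F](\<lambda>t. t)" and v2O: "v2 \<in> O[F](\<lambda>t. t)"
    by (rule bigoI_tendsto[OF v1l] bigoI_tendsto[OF v2l], use t0 in \<open>eventually_elim, simp\<close>)+
  have id1: "(\<lambda>t. t) \<in> o[F](\<lambda>_. 1::real)" by (rule smalloI_tendsto) (use id in auto)
  have vR: "(\<lambda>t. v1 t * R t) \<in> o[F](\<lambda>t. t^4)" "(\<lambda>t. v2 t * R t) \<in> o[F](\<lambda>t. t^4)"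
    if "R \<in> O[F](\<lambda>t. t^4)" for R
    using landau_o.small_big_mult[OF landau_o.big_small_trans[OF v1O id1] that]
      landau_o.small_big_mult[OF landau_o.big_small_trans[OF v2O id1] that] by simp_all
  define P3 where "P3 t = a0 * v1 t^3 + a1 * v1 t^2 * v2 t + a2 * v1 t * v2 t^2 + a3 * v2 t^3" for t
  define P4 where "P4 t = b0 * v1 t^4 + b1 * v1 t^3 * v2 t + b2 * v1 t^2 * v2 t^2 + b3 * v1 t * v2 t^3 + b4 * v2 t^4" for t
  define X4 where "X4 t = 5 * c0 * v1 t^4 + 4 * c1 * v1 t^3 * v2 t + 3 * c2 * v1 t^2 * v2 t^2 + 2 * c3 * v1 t * v2 t^3 + c4 * v2 t^4" for t
  define Y4 where "Y4 t = c1 * v1 t^4 + 2 * c2 * v1 t^3 * v2 t + 3 * c3 * v1 t^2 * v2 t^2 + 4 * c4 * v1 t * v2 t^3 + 5 * c5 * v2 t^4" for t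
  define R0 where "R0 t = \<phi> (v t) - ((h11 * v1 t^2 + 2 * h12 * v1 t * v2 t + h22 * v2 t^2) / 2 + P3 t + P4 t)" for t
  define R1 where "R1 t = \<phi>1 (v t) - ((h11 * v1 t + h12 * v2 t) + (3 * a0 * v1 t^2 + 2 * a1 * v1 t * v2 t + a2 * v2 t^2)
        + (4 * b0 * v1 t^3 + 3 * b1 * v1 t^2 * v2 t + 2 * b2 * v1 t * v2 t^2 + b3 * v2 t^3) + X4 t)" for t
  define R2 where "R2 t = \<phi>2 (v t) - ((h12 * v1 t + h22 * v2 t) + (a1 * v1 t^2 + 2 * a2 * v1 t * v2 t + 3 * a3 * v2 t^2)
        + (b1 * v1 t^3 + 2 * b2 * v1 t^2 * v2 t + 3 * b3 * v1 t * v2 t^2 + 4 * b4 * v2 t^3) + Y4 t)" for t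
  have R: "R0 \<in> o[F](\<lambda>t. t^4)" "R1 \<in> o[F](\<lambda>t. t^4)" "R2 \<in> o[F](\<lambda>t. t^4)"
    using comp[OF high(1)] comp[OF high(2)] comp[OF high(3)]
    by (simp_all add: v R0_def[abs_def] R1_def[abs_def] R2_def[abs_def] P3_def P4_def X4_def Y4_def)
  have P4o: "(\<lambda>t. P4 t - e0 * t^4) \<in> o[F](\<lambda>t. t^4)"
    using q4[of b0 b1 b2 b3 b4] unfolding P4_def defs(8) by simp
  have P5o: "(\<lambda>t. (e * X4 t + f * Y4 t) - p * t^4) \<in> o[F](\<lambda>t. t^4)"
  proof -
    have "(\<lambda>t. e * (X4 t - (5 * c0 + 4 * c1 * x + 3 * c2 * x^2 + 2 * c3 * x^3 + c4 * x^4) * t^4)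
       + f * (Y4 t - (c1 + 2 * c2 * x + 3 * c3 * x^2 + 4 * c4 * x^3 + 5 * c5 * x^4) * t^4)) \<in> o[F](\<lambda>t. t^4)"
      using q4[of "5 * c0" "4 * c1" "3 * c2" "2 * c3" c4] q4[of c1 "2 * c2" "3 * c3" "4 * c4" "5 * c5"]
      unfolding X4_def Y4_def by (intro sum_in_smallo) auto
    then show ?thesis unfolding defs(11) by (simp add: algebra_simps)
  qed
  have q4O: "(\<lambda>t. d0 * v1 t^4 + d1 * v1 t^3 * v2 t + d2 * v1 t^2 * v2 t^2 + d3 * v1 t * v2 t^3 + d4 * v2 t^4)
      \<in> O[F](\<lambda>t. t^4)" for d0 d1 d2 d3 d4
  proof -
    have "(\<lambda>t. (d0 + d1 * x + d2 * x^2 + d3 * x^3 + d4 * x^4) * t^4) \<in> O[F](\<lambda>t. t^4)" by simp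
    from sum_in_bigo(1)[OF landau_o.small_imp_big[OF q4[of d0 d1 d2 d3 d4]] this] show ?thesis by simp
  qed
  have XYO: "X4 \<in> O[F](\<lambda>t. t^4)" "Y4 \<in> O[F](\<lambda>t. t^4)"
    unfolding X4_def Y4_def by (rule q4O)+
  have P3: "P3 t = a * t^3 + b * t^2 * s t + g * t * s t^2 + d * s t^3" for t
    unfolding P3_def v1_def v2_def defs(4-7) by algebra
  \<comment> \<open>The coefficients of t s^3 and s^4 in the quartic. Their terms are o(t^4) in the
    end and occur only to make the expansion of the derivative along (e, f) an exact
    identity.\<close>
  define e3 where "e3 = e^3 * (4 * b0 + b1 * x) + e^2 * f * (3 * b1 + 2 * b2 * x) + e * f^2 * (2 * b2 + 3 * b3 * x) + f^3 * (b3 + 4 * b4 * x)"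
  define e4 where "e4 = b0 * e^4 + b1 * e^3 * f + b2 * e^2 * f^2 + b3 * e * f^3 + b4 * f^4"
  have phi: "\<phi> (v t) = N * t^2 + N * D * s t^2 + P3 t + P4 t + R0 t" for t
    unfolding R0_def QV by simp
  have d3: "e * (3 * a0 * v1 t^2 + 2 * a1 * v1 t * v2 t + a2 * v2 t^2) + f * (a1 * v1 t^2 + 2 * a2 * v1 t * v2 t + 3 * a3 * v2 t^2)
      = b * t^2 + 2 * g * t * s t + 3 * d * s t^2" for t
    unfolding v1_def v2_def defs(5-7) by algebra
  have d4: "e * (4 * b0 * v1 t^3 + 3 * b1 * v1 t^2 * v2 t + 2 * b2 * v1 t * v2 t^2 + b3 * v2 t^3)
     + f * (b1 * v1 t^3 + 2 * b2 * v1 t^2 * v2 t + 3 * b3 * v1 t * v2 t^2 + 4 * b4 * v2 t^3)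
      = e1 * t^3 + 2 * e2 * t^2 * s t + 3 * e3 * t * s t^2 + 4 * e4 * s t^3" for t
    unfolding v1_def v2_def defs(9,10) e3_def e4_def by algebra
  have d2: "e * (h11 * v1 t + h12 * v2 t) + f * (h12 * v1 t + h22 * v2 t) = 2 * N * D * s t" for t
    unfolding v1_def v2_def N2 D(1) defs(1,2) by algebra
  have et: "e * \<phi>1 (v t) + f * \<phi>2 (v t) = 2 * N * D * s t + (b * t^2 + 2 * g * t * s t + 3 * d * s t^2)
      + (e1 * t^3 + 2 * e2 * t^2 * s t + 3 * e3 * t * s t^2 + 4 * e4 * s t^3) + (e * X4 t + f * Y4 t)
      + (e * R1 t + f * R2 t)" for t
    unfolding R1_def R2_def d2[symmetric] d3[symmetric] d4[symmetric] by algebra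
  \<comment> \<open>Euler's identity, degree by degree. Together with the expansion of the height it
    produces the factors -1, -2, -3 on the quadratic, cubic and quartic parts in the shadow
    equation.\<close>
  have vv: "v1 t * \<phi>1 (v t) + v2 t * \<phi>2 (v t) = 2 * (N * t^2 + N * D * s t^2) + 3 * P3 t + 4 * P4 t
      + (v1 t * X4 t + v2 t * Y4 t) + (v1 t * R1 t + v2 t * R2 t)" for t
    unfolding R1_def R2_def QV[symmetric] P3_def P4_def by (simp add: field_simps eval_nat_numeral)
  show ?thesis
  proof (intro exI conjI)
    \<comment> \<open>The shadow equation is divided by \<open>lam\<close>, so that the unknown
      position enters linearly.\<close>
    let ?\<mu> = "1 / lam"
    have cm: "(\<lambda>t. C * R t) \<in> o[F](\<lambda>t. t^4)" if "R \<in> o[F](\<lambda>t. t^4)" for C and R :: "real \<Rightarrow> real"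
      using that by (cases "C = 0") auto
    have tsc: "(\<lambda>t. t * s t^2) \<in> o[F](\<lambda>t. t^4)" "(\<lambda>t. s t^3) \<in> o[F](\<lambda>t. t^4)"
      using ts[of 1 2] ts[of 0 3] by simp_all
    have "(\<lambda>t. c * (g * (t * s t^2) + d * s t^3 + (P4 t - e0 * t^4) + R0 t)) \<in> o[F](\<lambda>t. t^4)"
      using tsc P4o R by (cases "c = 0") (auto intro!: sum_in_smallo)
    then have A: "(\<lambda>t. s t - c * (N * t^2 + a * t^3 + N * D * s t^2 + b * t^2 * s t + e0 * t^4)) \<in> o[F](\<lambda>t. t^4)"
    proof (rule landau_o.small.in_cong[THEN iffD1, rotated])
      show "eventually (\<lambda>t. c * (g * (t * s t^2) + d * s t^3 + (P4 t - e0 * t^4) + R0 t)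
        = s t - c * (N * t^2 + a * t^3 + N * D * s t^2 + b * t^2 * s t + e0 * t^4)) F"
        using sc
      proof eventually_elim
        case (elim t)
        have "s t - c * (N * t^2 + a * t^3 + N * D * s t^2 + b * t^2 * s t + e0 * t^4)
          = c * \<phi> (v t) - c * (N * t^2 + a * t^3 + N * D * s t^2 + b * t^2 * s t + e0 * t^4)" using elim by simp
        then show ?case unfolding phi P3 by (simp add: algebra_simps)
      qed
    qed
    have "(\<lambda>t. - ?\<mu> * (- 2 * g * (t * s t^2) - 2 * d * s t^3 - 3 * (P4 t - e0 * t^4) - v1 t * X4 t - v2 t * Y4 t
          + R0 t - v1 t * R1 t - v2 t * R2 t)
        + (- 3 * e3 * (t * s t^2) - 4 * e4 * s t^3 - ((e * X4 t + f * Y4 t) - p * t^4) - e * R1 t - f * R2 t))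
       \<in> o[F](\<lambda>t. t^4)"
      by (intro P4o P5o tsc vR[OF XYO(1)] vR[OF XYO(2)] vR[OF landau_o.small_imp_big[OF R(2)]]
          vR[OF landau_o.small_imp_big[OF R(3)]] cm[OF P4o] cm[OF tsc(1)] cm[OF tsc(2)] R sum_in_smallo(1)
          sum_in_smallo(2)[OF _ P5o] sum_in_smallo(2) cm)
    then have B: "(\<lambda>t. - ?\<mu> * (N * t^2 + 2 * a * t^3 + N * D * s t^2 + 2 * b * t^2 * s t + 3 * e0 * t^4)
        + (2 * N * D * s t + b * t^2 + 2 * g * t * s t + e1 * t^3 + 3 * d * s t^2 + 2 * e2 * t^2 * s t + p * t^4))
        \<in> o[F](\<lambda>t. t^4)"
    proof (rule landau_o.small.in_cong[THEN iffD1, rotated], intro eventually_mono[OF sev])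
      fix t assume *: "0 < t \<and> \<bar>s t\<bar> \<le> t \<and> G (V t (s t)) = 0 \<and> C * t < r"
      then have "G (v t) = 0" by (simp add: v_def)
      then have "\<phi> (v t) - (v1 t * \<phi>1 (v t) + v2 t * \<phi>2 (v t)) + lam * (e * \<phi>1 (v t) + f * \<phi>2 (v t)) = 0"
        unfolding G_def v fst_conv snd_conv by algebra
      then have "?\<mu> * (\<phi> (v t) - (v1 t * \<phi>1 (v t) + v2 t * \<phi>2 (v t))) + (e * \<phi>1 (v t) + f * \<phi>2 (v t)) = 0"
        using lam by (simp add: field_simps)
      then show "- ?\<mu> * (- 2 * g * (t * s t^2) - 2 * d * s t^3 - 3 * (P4 t - e0 * t^4) - v1 t * X4 t - v2 t * Y4 t
          + R0 t - v1 t * R1 t - v2 t * R2 t)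
        + (- 3 * e3 * (t * s t^2) - 4 * e4 * s t^3 - ((e * X4 t + f * Y4 t) - p * t^4) - e * R1 t - f * R2 t)
        = - ?\<mu> * (N * t^2 + 2 * a * t^3 + N * D * s t^2 + 2 * b * t^2 * s t + 3 * e0 * t^4)
        + (2 * N * D * s t + b * t^2 + 2 * g * t * s t + e1 * t^3 + 3 * d * s t^2 + 2 * e2 * t^2 * s t + p * t^4)"
        unfolding vv et phi P3 by algebra
    qed
    show "?\<mu> * N = 2 * N * D * (c * N) + b"
      "- 2 * ?\<mu> * a + 2 * N * D * (c * a) + e1 + 2 * g * (c * N) = 0"
      "- ?\<mu> * (N * D * (c * N)^2 + 2 * b * (c * N) + 3 * e0)
        + 2 * N * D * (c * (N * D * (c * N)^2 + b * (c * N) + e0))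
        + 2 * g * (c * a) + 3 * d * (c * N)^2 + 2 * e2 * (c * N) + p = 0"
      using curve_coefficients[OF slim[unfolded F_def] A[unfolded F_def] B[unfolded F_def]] by blast+
  qed
qed

section \<open>Functions of class \<open>C\<^sup>k\<close>\<close>

lemma Ck_on_continuous: "Ck_on k U f \<Longrightarrow> continuous_on U f"
  by (cases k) (auto intro!: continuous_at_imp_continuous_on differentiable_imp_continuous_within)

lemma Ck_on_cong: "open U \<Longrightarrow> (\<And>x. x \<in> U \<Longrightarrow> f x = g x) \<Longrightarrow> Ck_on k U f \<longleftrightarrow> Ck_on k U g"
proof (induction k arbitrary: f g)
  case 0
  then show ?case by (simp cong: continuous_on_cong)
next
  case (Suc k)
  have tr: "h' differentiable (at x)" if "x \<in> U" "h differentiable (at x)" "\<And>x. x \<in> U \<Longrightarrow> h x = h' x"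
    for h h' :: "'a \<Rightarrow> real" and x
  proof -
    from that(2) obtain D where "(h has_derivative D) (at x)" by (auto simp: differentiable_def)
    from has_derivative_transform_within_open[OF this Suc.prems(1) that(1,3)] show ?thesis
      by (rule differentiableI)
  qed
  have d: "f differentiable (at x) \<longleftrightarrow> g differentiable (at x)" if "x \<in> U" for x
    using tr[OF that, of f g] tr[OF that, of g f] Suc.prems(2) by auto
  have "frechet_derivative f (at x) = frechet_derivative g (at x)" if "x \<in> U" "g differentiable (at x)" for x
    by (rule frechet_derivative_transform_within_open[OF _ Suc.prems(1) that(1) Suc.prems(2)])
      (use d[OF that(1)] that(2) in blast)+
  then have "Ck_on k U (\<lambda>x. frechet_derivative f (at x) v) \<longleftrightarrow> Ck_on k U (\<lambda>x. frechet_derivative g (at x) v)"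
    if "\<forall>x\<in>U. g differentiable (at x)" for v
    using Suc.prems that by (intro Suc.IH) auto
  then show ?case using d by auto
qed

lemma Ck_on_SucI:
  assumes "open U" "\<And>x. x \<in> U \<Longrightarrow> (f has_derivative f' x) (at x)" "\<And>v. Ck_on k U (\<lambda>x. f' x v)"
  shows "Ck_on (Suc k) U f"
proof -
  have "frechet_derivative f (at x) = f' x" if "x \<in> U" for x
    using assms(2)[OF that] by (metis frechet_derivative_at)
  then have "Ck_on k U (\<lambda>x. frechet_derivative f (at x) v)" for v
    using Ck_on_cong[OF assms(1), of "\<lambda>x. frechet_derivative f (at x) v" "\<lambda>x. f' x v" k] assms(3) by simp
  then show ?thesis using assms(2) by (auto simp: differentiable_def)
qed

lemma Ck_on_SucD:
  assumes "Ck_on (Suc k) U f"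
  shows "x \<in> U \<Longrightarrow> (f has_derivative frechet_derivative f (at x)) (at x)"
    and "Ck_on k U (\<lambda>x. frechet_derivative f (at x) v)"
  using assms by (auto simp: frechet_derivative_works)

lemma Ck_on_Suc_imp: "Ck_on (Suc k) U f \<Longrightarrow> Ck_on k U f"
proof (induction k arbitrary: f)
  case 0
  then show ?case using Ck_on_continuous by fastforce
next
  case (Suc k)
  then have "Ck_on k U (\<lambda>x. frechet_derivative f (at x) v)" for v
    using Ck_on_SucD(2) by blast
  then show ?case using Suc.prems by simp
qed

lemma Ck_on_le: "Ck_on k U f \<Longrightarrow> j \<le> k \<Longrightarrow> Ck_on j U f"
  by (induction k) (auto simp: le_Suc_eq dest: Ck_on_Suc_imp simp del: Ck_on.simps(2))

lemma Ck_on_subset: "Ck_on k U f \<Longrightarrow> V \<subseteq> U \<Longrightarrow> Ck_on k V f"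
  by (induction k arbitrary: f) (auto intro: continuous_on_subset)

lemma Ck_on_const: "open U \<Longrightarrow> Ck_on k U (\<lambda>x. c)"
proof (induction k arbitrary: c)
  case (Suc k)
  then show ?case by (intro Ck_on_SucI[where f' = "\<lambda>_ _. 0"]) auto
qed simp

lemma Ck_on_linear: "open U \<Longrightarrow> bounded_linear f \<Longrightarrow> Ck_on k U f"
proof (cases k)
  case 0
  then show "bounded_linear f \<Longrightarrow> ?thesis" by (simp add: linear_continuous_on)
next
  case (Suc j)
  then show "open U \<Longrightarrow> bounded_linear f \<Longrightarrow> ?thesis"
    by (auto intro!: Ck_on_SucI[where f' = "\<lambda>_. f"] Ck_on_const bounded_linear_imp_has_derivative simp del: Ck_on.simps)
qed

lemma Ck_on_add: "open U \<Longrightarrow> Ck_on k U f \<Longrightarrow> Ck_on k U g \<Longrightarrow> Ck_on k U (\<lambda>x. f x + g x)"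
proof (induction k arbitrary: f g)
  case (Suc k)
  show ?case
    by (rule Ck_on_SucI[OF Suc.prems(1) has_derivative_add[OF Ck_on_SucD(1)[OF Suc.prems(2)] Ck_on_SucD(1)[OF Suc.prems(3)]]])
      (auto intro: Suc.IH[OF Suc.prems(1) Ck_on_SucD(2)[OF Suc.prems(2)] Ck_on_SucD(2)[OF Suc.prems(3)]])
qed (simp add: continuous_on_add)

lemma Ck_on_mult: "open U \<Longrightarrow> Ck_on k U f \<Longrightarrow> Ck_on k U g \<Longrightarrow> Ck_on k U (\<lambda>x. f x * g x)"
proof (induction k arbitrary: f g)
  case (Suc k)
  note IH = Suc.IH[OF Suc.prems(1)]
  show ?case
    by (rule Ck_on_SucI[OF Suc.prems(1) has_derivative_mult[OF Ck_on_SucD(1)[OF Suc.prems(2)] Ck_on_SucD(1)[OF Suc.prems(3)]]])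
      (auto intro!: Ck_on_add Suc.prems(1) IH
        Ck_on_SucD(2)[OF Suc.prems(2)] Ck_on_SucD(2)[OF Suc.prems(3)] Ck_on_Suc_imp[OF Suc.prems(2)]
        Ck_on_Suc_imp[OF Suc.prems(3)] simp del: Ck_on.simps)
qed (simp add: continuous_on_mult)

lemma Ck_on_cmult: "open U \<Longrightarrow> Ck_on k U f \<Longrightarrow> Ck_on k U (\<lambda>x. c * f x)"
  by (intro Ck_on_mult Ck_on_const)

lemma Ck_on_minus: "open U \<Longrightarrow> Ck_on k U f \<Longrightarrow> Ck_on k U (\<lambda>x. - f x)"
  using Ck_on_cmult[of U k f "-1"] by simp

lemma Ck_on_diff: "open U \<Longrightarrow> Ck_on k U f \<Longrightarrow> Ck_on k U g \<Longrightarrow> Ck_on k U (\<lambda>x. f x - g x)"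
  using Ck_on_add[of U k f "\<lambda>x. - g x"] Ck_on_minus[of U k g] by simp

lemma Ck_on_sum: "open U \<Longrightarrow> (\<And>i. i \<in> I \<Longrightarrow> Ck_on k U (f i)) \<Longrightarrow> Ck_on k U (\<lambda>x. \<Sum>i\<in>I. f i x)"
  by (induction I rule: infinite_finite_induct) (auto intro: Ck_on_add Ck_on_const)

lemma Ck_on_inverse:
  "open U \<Longrightarrow> (\<And>x. x \<in> U \<Longrightarrow> f x \<noteq> 0) \<Longrightarrow> Ck_on k U f \<Longrightarrow> Ck_on k U (\<lambda>x. inverse (f x))"
proof (induction k)
  case (Suc k)
  have IH: "Ck_on k U (\<lambda>x. inverse (f x))"
    using Suc.IH Suc.prems Ck_on_Suc_imp by blast
  show ?case
  proof (rule Ck_on_SucI[OF Suc.prems(1)])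
    show "((\<lambda>x. inverse (f x)) has_derivative (\<lambda>v. - (inverse (f x) * frechet_derivative f (at x) v * inverse (f x)))) (at x)"
      if "x \<in> U" for x
      by (rule Deriv.has_derivative_inverse[OF Suc.prems(2)[OF that] Ck_on_SucD(1)[OF Suc.prems(3) that]])
    show "Ck_on k U (\<lambda>x. - (inverse (f x) * frechet_derivative f (at x) v * inverse (f x)))" for v
      by (intro Ck_on_minus Ck_on_mult Suc.prems(1) IH Ck_on_SucD(2)[OF Suc.prems(3)])
  qed
qed (simp add: continuous_on_inverse)

lemma Ck_on_divide:
  "open U \<Longrightarrow> (\<And>x. x \<in> U \<Longrightarrow> g x \<noteq> 0) \<Longrightarrow> Ck_on k U f \<Longrightarrow> Ck_on k U g \<Longrightarrow> Ck_on k U (\<lambda>x. f x / g x)"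
  unfolding divide_inverse by (intro Ck_on_mult Ck_on_inverse)

text \<open>Induction on the order with \<open>G\<close> arbitrary: by the chain rule each
  directional derivative of the composition is a sum of products of derivatives of the components of
  \<open>\<phi>\<close> with directional derivatives of \<open>G\<close> at \<open>\<phi> x\<close>,
  to which the hypothesis of one order less applies.\<close>

lemma Ck_on_compose:
  fixes \<phi> :: "'a::euclidean_space \<Rightarrow> 'b::euclidean_space"
  assumes "open U" "open V" "\<phi> ` V \<subseteq> U"
  shows "(\<And>i. i \<in> Basis \<Longrightarrow> Ck_on k V (\<lambda>x. \<phi> x \<bullet> i)) \<Longrightarrow> Ck_on k U G \<Longrightarrow> Ck_on k V (\<lambda>x. G (\<phi> x))"
proof (induction k arbitrary: G)
  case 0
  then have "continuous_on V \<phi>" by (subst continuous_on_componentwise) auto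
  then show ?case using 0 assms(3) by (auto intro: continuous_on_compose2)
next
  case (Suc k)
  define d where "d x v = (\<Sum>i\<in>Basis. frechet_derivative (\<lambda>x. \<phi> x \<bullet> i) (at x) v *\<^sub>R i)" for x v
  have phi: "(\<phi> has_derivative d x) (at x)" if "x \<in> V" for x
    using Ck_on_SucD(1)[OF Suc.prems(1) that] unfolding has_derivative_componentwise_within[of \<phi>]
    by (auto simp: d_def inner_sum_left inner_Basis if_distrib sum.delta cong: if_cong)
  show ?case
  proof (rule Ck_on_SucI[OF assms(2)])
    fix x assume x: "x \<in> V"
    then have *: "(G has_derivative frechet_derivative G (at (\<phi> x))) (at (\<phi> x))"
      using Ck_on_SucD(1)[OF Suc.prems(2)] assms(3) by blast
    have lin: "frechet_derivative G (at (\<phi> x)) (d x v)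
       = (\<Sum>i\<in>Basis. frechet_derivative (\<lambda>x. \<phi> x \<bullet> i) (at x) v * frechet_derivative G (at (\<phi> x)) i)" for v
      unfolding d_def linear_sum[OF has_derivative_linear[OF *]] linear_scale[OF has_derivative_linear[OF *]] real_scaleR_def ..
    show "((\<lambda>x. G (\<phi> x)) has_derivative (\<lambda>v. \<Sum>i\<in>Basis. frechet_derivative (\<lambda>x. \<phi> x \<bullet> i) (at x) v * frechet_derivative G (at (\<phi> x)) i)) (at x)"
      using has_derivative_compose[OF phi[OF x] *] unfolding lin .
  next
    fix v
    have "Ck_on k V (\<lambda>x. frechet_derivative G (at (\<phi> x)) i)" for i
      by (rule Suc.IH[of "\<lambda>y. frechet_derivative G (at y) i"])
        (use Suc.prems Ck_on_Suc_imp Ck_on_SucD(2) in blast)+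
    then show "Ck_on k V (\<lambda>x. \<Sum>i\<in>Basis. frechet_derivative (\<lambda>x. \<phi> x \<bullet> i) (at x) v * frechet_derivative G (at (\<phi> x)) i)"
      by (intro Ck_on_sum Ck_on_mult assms Ck_on_SucD(2)[OF Suc.prems(1)])
  qed
qed

text \<open>Both mixed partial derivatives are limits of the same second difference quotient.\<close>

lemma second_difference_mean_value:
  fixes f :: "'a::euclidean_space \<Rightarrow> real"
  assumes f: "Ck_on 2 (ball y r) f" and h: "h > 0" "h * (norm u + norm v) < r"
  shows "\<exists>\<xi> \<eta>. 0 < \<xi> \<and> \<xi> < h \<and> 0 < \<eta> \<and> \<eta> < h \<and>
    f (y + h *\<^sub>R u + h *\<^sub>R v) - f (y + h *\<^sub>R u) - f (y + h *\<^sub>R v) + f y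
    = h^2 * frechet_derivative (\<lambda>x. frechet_derivative f (at x) u) (at (y + \<xi> *\<^sub>R u + \<eta> *\<^sub>R v)) v"
proof -
  have in_ball: "y + s *\<^sub>R u + t *\<^sub>R v \<in> ball y r" if "0 \<le> s" "s \<le> h" "0 \<le> t" "t \<le> h" for s t
  proof -
    have "norm (s *\<^sub>R u + t *\<^sub>R v) \<le> s * norm u + t * norm v"
      using norm_triangle_ineq[of "s *\<^sub>R u" "t *\<^sub>R v"] that by simp
    also have "\<dots> \<le> h * norm u + h * norm v" using that by (intro add_mono mult_right_mono) auto
    finally have "norm (s *\<^sub>R u + t *\<^sub>R v) < r" using h by (simp add: algebra_simps)
    then show ?thesis using norm_minus_cancel[of "s *\<^sub>R u + t *\<^sub>R v"] by (simp add: dist_norm)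
  qed
  have f2: "Ck_on (Suc 1) (ball y r) f" using f by (simp add: numeral_2_eq_2)
  define fu where "fu x = frechet_derivative f (at x) u" for x
  have fu: "Ck_on (Suc 0) (ball y r) fu" using Ck_on_SucD(2)[OF f2] unfolding fu_def by simp
  define \<phi> where "\<phi> s = f (y + s *\<^sub>R u + h *\<^sub>R v) - f (y + s *\<^sub>R u + 0 *\<^sub>R v)" for s
  have d1: "((\<lambda>s. f (y + s *\<^sub>R u + t *\<^sub>R v)) has_real_derivative fu (y + s *\<^sub>R u + t *\<^sub>R v)) (at s)"
    if "0 \<le> s" "s \<le> h" "0 \<le> t" "t \<le> h" for s t
  proof -
    have g: "((\<lambda>s. y + s *\<^sub>R u + t *\<^sub>R v) has_derivative (\<lambda>s. s *\<^sub>R u)) (at s)"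
      by (auto intro!: derivative_eq_intros)
    note D = Ck_on_SucD(1)[OF f2 in_ball[OF that]]
    show ?thesis
      using has_derivative_compose[OF g D] linear_scale[OF has_derivative_linear[OF D]]
      by (simp add: has_field_derivative_def fu_def mult.commute[of _ "frechet_derivative f _ u"] fun_eq_iff)
  qed
  have "\<exists>\<xi>. 0 < \<xi> \<and> \<xi> < h \<and> \<phi> h - \<phi> 0 = (h - 0) * (fu (y + \<xi> *\<^sub>R u + h *\<^sub>R v) - fu (y + \<xi> *\<^sub>R u + 0 *\<^sub>R v))"
    unfolding \<phi>_def by (rule MVT2[OF h(1)]) (intro DERIV_diff d1; use h in simp)
  then obtain \<xi> where \<xi>: "0 < \<xi>" "\<xi> < h"
    and 1: "\<phi> h - \<phi> 0 = h * (fu (y + \<xi> *\<^sub>R u + h *\<^sub>R v) - fu (y + \<xi> *\<^sub>R u + 0 *\<^sub>R v))" by auto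
  have "((\<lambda>t. fu (y + \<xi> *\<^sub>R u + t *\<^sub>R v)) has_real_derivative frechet_derivative fu (at (y + \<xi> *\<^sub>R u + t *\<^sub>R v)) v) (at t)"
    if "0 \<le> t" "t \<le> h" for t
  proof -
    have g: "((\<lambda>t. y + \<xi> *\<^sub>R u + t *\<^sub>R v) has_derivative (\<lambda>t. t *\<^sub>R v)) (at t)"
      by (auto intro!: derivative_eq_intros)
    have "y + \<xi> *\<^sub>R u + t *\<^sub>R v \<in> ball y r" using \<xi> that by (intro in_ball) auto
    note D = Ck_on_SucD(1)[OF fu this]
    show ?thesis
      using has_derivative_compose[OF g D] linear_scale[OF has_derivative_linear[OF D]]
      by (simp add: has_field_derivative_def mult.commute[of _ "frechet_derivative fu _ v"] fun_eq_iff)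
  qed
  then have "\<exists>\<eta>. 0 < \<eta> \<and> \<eta> < h \<and> fu (y + \<xi> *\<^sub>R u + h *\<^sub>R v) - fu (y + \<xi> *\<^sub>R u + 0 *\<^sub>R v)
     = (h - 0) * frechet_derivative fu (at (y + \<xi> *\<^sub>R u + \<eta> *\<^sub>R v)) v"
    by (intro MVT2[OF h(1)])
  then obtain \<eta> where "0 < \<eta>" "\<eta> < h" and
    2: "fu (y + \<xi> *\<^sub>R u + h *\<^sub>R v) - fu (y + \<xi> *\<^sub>R u + 0 *\<^sub>R v) = h * frechet_derivative fu (at (y + \<xi> *\<^sub>R u + \<eta> *\<^sub>R v)) v"
    by auto
  have "\<phi> h - \<phi> 0 = f (y + h *\<^sub>R u + h *\<^sub>R v) - f (y + h *\<^sub>R u) - f (y + h *\<^sub>R v) + f y" by (simp add: \<phi>_def)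
  then show ?thesis using \<xi> \<open>0 < \<eta>\<close> \<open>\<eta> < h\<close> 1 2
    by (intro exI[of _ \<xi>] exI[of _ \<eta>]) (simp add: fu_def[abs_def] power2_eq_square)
qed

lemma mixed_derivatives_commute:
  fixes f :: "'a::euclidean_space \<Rightarrow> real"
  assumes "open U" "y \<in> U" "Ck_on 2 U f"
  shows "frechet_derivative (\<lambda>x. frechet_derivative f (at x) u) (at y) v
    = frechet_derivative (\<lambda>x. frechet_derivative f (at x) v) (at y) u" (is "?A y = ?B y")
proof (rule ccontr)
  assume ne: "?A y \<noteq> ?B y"
  \<comment> \<open>Half of the supposed gap. The second difference makes one mixed derivative at
    some point near \<open>y\<close> equal to the other at another such point, which continuity then
    forbids.\<close>
  define \<epsilon> where "\<epsilon> = \<bar>?A y - ?B y\<bar> / 2"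
  have \<epsilon>: "\<epsilon> > 0" using ne by (simp add: \<epsilon>_def)
  have f2: "Ck_on (Suc (Suc 0)) U f" using assms(3) by (simp add: numeral_2_eq_2)
  have "continuous_on U ?A" "continuous_on U ?B"
    using Ck_on_SucD(2)[OF Ck_on_SucD(2)[OF f2]] by auto
  then have "isCont ?A y" "isCont ?B y" using assms by (auto simp: continuous_on_eq_continuous_at)
  then have "\<exists>d>0. \<forall>x. dist x y < d \<longrightarrow> dist (?A x) (?A y) < \<epsilon>" "\<exists>d>0. \<forall>x. dist x y < d \<longrightarrow> dist (?B x) (?B y) < \<epsilon>"
    using \<epsilon> unfolding continuous_at_eps_delta by blast+
  then obtain dA dB where "dA > 0" "dB > 0" and dAB: "\<forall>x. dist x y < dA \<longrightarrow> dist (?A x) (?A y) < \<epsilon>"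
     "\<forall>x. dist x y < dB \<longrightarrow> dist (?B x) (?B y) < \<epsilon>" by blast
  define d where "d = min dA dB"
  have d: "d > 0" "\<And>x. dist x y < d \<Longrightarrow> \<bar>?A x - ?A y\<bar> < \<epsilon>" "\<And>x. dist x y < d \<Longrightarrow> \<bar>?B x - ?B y\<bar> < \<epsilon>"
    using \<open>dA > 0\<close> \<open>dB > 0\<close> dAB unfolding dist_real_def d_def by simp_all
  obtain e where e: "e > 0" "ball y e \<subseteq> U" using assms openE by blast
  define r where "r = min d e"
  have r: "r > 0" "ball y r \<subseteq> U" "r \<le> d" using d e by (auto simp: r_def)
  define h where "h = r / (norm u + norm v + 1)"
  have n: "norm u + norm v \<ge> 0" by simp
  have h: "h > 0" "h * (norm u + norm v) < r"
  proof -
    have p: "norm u + norm v + 1 > 0" using n by linarith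
    show "h > 0" using r p by (simp add: h_def)
    have "h * (norm u + norm v + 1) = r" using p by (simp add: h_def)
    then show "h * (norm u + norm v) < r" using \<open>h > 0\<close> by (simp add: algebra_simps)
  qed
  have fr: "Ck_on 2 (ball y r) f" using assms(3) r Ck_on_subset by blast
  have near: "dist (y + s *\<^sub>R w + t *\<^sub>R z) y < d" if "0 < s" "s < h" "0 < t" "t < h" "{w, z} = {u, v}" for s t w z
  proof -
    have "norm (s *\<^sub>R w + t *\<^sub>R z) \<le> s * norm w + t * norm z"
      using norm_triangle_ineq[of "s *\<^sub>R w" "t *\<^sub>R z"] that by simp
    also have "\<dots> \<le> h * norm w + h * norm z" using that by (intro add_mono mult_right_mono) auto
    also have "\<dots> = h * (norm u + norm v)" using that(5) by (auto simp: doubleton_eq_iff algebra_simps)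
    finally show ?thesis using h r by (simp add: dist_norm algebra_simps)
  qed
  obtain \<xi> \<eta> where 1: "0 < \<xi>" "\<xi> < h" "0 < \<eta>" "\<eta> < h"
    "f (y + h *\<^sub>R u + h *\<^sub>R v) - f (y + h *\<^sub>R u) - f (y + h *\<^sub>R v) + f y = h^2 * ?A (y + \<xi> *\<^sub>R u + \<eta> *\<^sub>R v)"
    using second_difference_mean_value[OF fr h] by blast
  obtain \<xi>' \<eta>' where 2: "0 < \<xi>'" "\<xi>' < h" "0 < \<eta>'" "\<eta>' < h"
    "f (y + h *\<^sub>R v + h *\<^sub>R u) - f (y + h *\<^sub>R v) - f (y + h *\<^sub>R u) + f y = h^2 * ?B (y + \<xi>' *\<^sub>R v + \<eta>' *\<^sub>R u)"
    using second_difference_mean_value[OF fr h(1), of v u] h(2) by (auto simp: add.commute)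
  have "h^2 * ?A (y + \<xi> *\<^sub>R u + \<eta> *\<^sub>R v) = h^2 * ?B (y + \<xi>' *\<^sub>R v + \<eta>' *\<^sub>R u)"
    using 1(5) 2(5) by (simp add: algebra_simps)
  then have "?A (y + \<xi> *\<^sub>R u + \<eta> *\<^sub>R v) = ?B (y + \<xi>' *\<^sub>R v + \<eta>' *\<^sub>R u)" using h by simp
  moreover have "\<bar>?A (y + \<xi> *\<^sub>R u + \<eta> *\<^sub>R v) - ?A y\<bar> < \<epsilon>" using 1 by (intro d near) auto
  moreover have "\<bar>?B (y + \<xi>' *\<^sub>R v + \<eta>' *\<^sub>R u) - ?B y\<bar> < \<epsilon>" using 2 by (intro d near) auto
  ultimately show False unfolding \<epsilon>_def by argo
qed

declare Ck_on.simps(2) [simp del]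

section \<open>Partial derivatives and Taylor expansion in the plane\<close>

text \<open>Total differentiability with named partial derivatives, not mere existence of the
  latter. In this form sum, product and chain rule compute both partial derivatives at once.\<close>

definition has_partials :: "(real \<times> real \<Rightarrow> real) \<Rightarrow> real \<Rightarrow> real \<Rightarrow> real \<times> real \<Rightarrow> bool" where
  "has_partials f a b y \<longleftrightarrow> (f has_derivative (\<lambda>v. fst v * a + snd v * b)) (at y)"

definition pd1 :: "(real \<times> real \<Rightarrow> real) \<Rightarrow> real \<times> real \<Rightarrow> real" where
  "pd1 f y = frechet_derivative f (at y) (1, 0)"

definition pd2 :: "(real \<times> real \<Rightarrow> real) \<Rightarrow> real \<times> real \<Rightarrow> real" where
  "pd2 f y = frechet_derivative f (at y) (0, 1)"

text \<open>The derivatives in the second variable are taken first. One more derivative in the first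
  variable is then immediate (\<open>pd_Suc\<close>), whereas one in the second variable rests on
  the symmetry of mixed derivatives (\<open>pd2_pd\<close>).\<close>

definition pd :: "(real \<times> real \<Rightarrow> real) \<Rightarrow> nat \<Rightarrow> nat \<Rightarrow> real \<times> real \<Rightarrow> real" where
  "pd f i j = (pd1 ^^ i) ((pd2 ^^ j) f)"

lemma has_partials_eq: "has_partials f a b y \<Longrightarrow> a = a' \<Longrightarrow> b = b' \<Longrightarrow> has_partials f a' b' y"
  by simp

lemma has_partials_unique:
  assumes "has_partials f a b y" shows "pd1 f y = a" "pd2 f y = b"
  using frechet_derivative_at[OF assms[unfolded has_partials_def]]
  by (auto simp: pd1_def pd2_def dest: fun_cong[of _ _ "(1, 0)"] fun_cong[of _ _ "(0, 1)"])

lemma has_partials_const: "has_partials (\<lambda>y. c) 0 0 y"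
  and has_partials_fst: "has_partials (\<lambda>y. fst y) 1 0 y"
  and has_partials_snd: "has_partials (\<lambda>y. snd y) 0 1 y"
  unfolding has_partials_def
  by (rule has_derivative_eq_rhs[OF has_derivative_const] has_derivative_eq_rhs[OF has_derivative_fst[OF has_derivative_ident]]
      has_derivative_eq_rhs[OF has_derivative_snd[OF has_derivative_ident]], simp)+

lemma has_partials_add:
  "has_partials f a b y \<Longrightarrow> has_partials g c d y \<Longrightarrow> has_partials (\<lambda>y. f y + g y) (a + c) (b + d) y"
  unfolding has_partials_def by (rule has_derivative_eq_rhs, rule has_derivative_add, assumption, assumption) (simp add: fun_eq_iff algebra_simps)

lemma has_partials_diff:
  "has_partials f a b y \<Longrightarrow> has_partials g c d y \<Longrightarrow> has_partials (\<lambda>y. f y - g y) (a - c) (b - d) y"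
  unfolding has_partials_def by (rule has_derivative_eq_rhs, rule has_derivative_diff, assumption, assumption) (simp add: fun_eq_iff algebra_simps)

lemma has_partials_mult:
  "has_partials f a b y \<Longrightarrow> has_partials g c d y \<Longrightarrow>
    has_partials (\<lambda>y. f y * g y) (f y * c + a * g y) (f y * d + b * g y) y"
  unfolding has_partials_def by (rule has_derivative_eq_rhs, rule has_derivative_mult, assumption, assumption) (simp add: fun_eq_iff algebra_simps)

lemma has_partials_compose:
  "has_partials f a b y \<Longrightarrow> (g has_real_derivative d) (at (f y)) \<Longrightarrow> has_partials (\<lambda>y. g (f y)) (d * a) (d * b) y"
  unfolding has_partials_def has_field_derivative_def
  by (rule has_derivative_eq_rhs, rule has_derivative_compose, assumption, assumption) (simp add: fun_eq_iff algebra_simps)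

lemma has_partials_cong:
  "open V \<Longrightarrow> y \<in> V \<Longrightarrow> (\<And>x. x \<in> V \<Longrightarrow> f x = g x) \<Longrightarrow> has_partials f a b y \<longleftrightarrow> has_partials g a b y"
  unfolding has_partials_def
  by (rule iffI; erule has_derivative_transform_within_open[of _ _ _ _ V]) simp_all

lemma Ck_has_partials:
  assumes "Ck_on (Suc k) V f" "y \<in> V" shows "has_partials f (pd1 f y) (pd2 f y) y"
proof -
  note D = Ck_on_SucD(1)[OF assms]
  interpret linear "frechet_derivative f (at y)" using has_derivative_linear[OF D] .
  have "frechet_derivative f (at y) (a, b) = a * pd1 f y + b * pd2 f y" for a b
    using add[of "a *\<^sub>R (1, 0)" "b *\<^sub>R (0, 1)"] scale[of a "(1, 0)"] scale[of b "(0, 1)"]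
    by (simp add: pd1_def pd2_def)
  then have "frechet_derivative f (at y) = (\<lambda>v. fst v * pd1 f y + snd v * pd2 f y)" by force
  then show ?thesis using D by (simp add: has_partials_def)
qed

lemma Ck_pd: "Ck_on (Suc k) V f \<Longrightarrow> Ck_on k V (pd1 f)" "Ck_on (Suc k) V f \<Longrightarrow> Ck_on k V (pd2 f)"
  using Ck_on_SucD(2) unfolding pd1_def[abs_def] pd2_def[abs_def] by auto

text \<open>The bootstrapping step: a function whose partial derivatives are expressed through the
  function itself gains one order at each application. The density \<open>\<rho>\<close> and the
  implicit functions below obtain their regularity in this way.\<close>

lemma Ck_partialsI:
  assumes "open V" "\<And>y. y \<in> V \<Longrightarrow> has_partials f (a y) (b y) y" "Ck_on k V a" "Ck_on k V b"
  shows "Ck_on (Suc k) V f"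
proof (rule Ck_on_SucI[OF assms(1)])
  show "(f has_derivative (\<lambda>v. fst v * a y + snd v * b y)) (at y)" if "y \<in> V" for y
    using assms(2)[OF that] by (simp add: has_partials_def)
  show "Ck_on k V (\<lambda>x. fst v * a x + snd v * b x)" for v
    by (intro Ck_on_add Ck_on_cmult assms)
qed

text \<open>The closedness of a gradient field. Every compatibility condition in the integration of
  the quadric is an instance.\<close>

lemma partials_integrability:
  assumes V: "open V" "y \<in> V" and h: "\<And>y. y \<in> V \<Longrightarrow> has_partials h (a y) (b y) y"
    and ab: "Ck_on 1 V a" "Ck_on 1 V b" and "has_partials a a1 a2 y" "has_partials b b1 b2 y"
  shows "a2 = b1"
proof -
  have "Ck_on 2 V h" using Ck_partialsI[OF V(1) h ab] by (simp add: numeral_2_eq_2)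
  from mixed_derivatives_commute[OF V this, of "(1, 0)" "(0, 1)"]
  have c: "pd2 (pd1 h) y = pd1 (pd2 h) y" by (simp add: pd1_def[abs_def] pd2_def[abs_def])
  have "has_partials (pd1 h) a1 a2 y \<longleftrightarrow> has_partials a a1 a2 y" "has_partials (pd2 h) b1 b2 y \<longleftrightarrow> has_partials b b1 b2 y"
    using has_partials_unique[OF h] by (auto intro!: has_partials_cong[OF V])
  then show ?thesis using assms c has_partials_unique by metis
qed

lemma has_partials_zero_constant:
  assumes "convex V" "open V" "\<And>y. y \<in> V \<Longrightarrow> has_partials h 0 0 y"
  obtains c where "\<And>y. y \<in> V \<Longrightarrow> h y = c"
proof -
  have "\<exists>c. \<forall>y\<in>V. h y = c"
    by (rule has_derivative_zero_constant[OF assms(1)])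
      (use assms(3) in \<open>auto simp: has_partials_def intro: has_derivative_at_withinI\<close>)
  then show ?thesis using that by blast
qed

lemma pd_0: "pd f 0 0 = f" and pd_Suc: "pd f (Suc i) j = pd1 (pd f i j)"
  by (simp_all add: pd_def)

lemma Ck_on_pd: "Ck_on (i + j + k) V f \<Longrightarrow> Ck_on k V (pd f i j)"
proof (induction i arbitrary: k)
  case 0
  then show ?case
  proof (induction j arbitrary: k)
    case (Suc j)
    then have "Ck_on (Suc k) V (pd f 0 j)" by simp
    then show ?case using Ck_pd(2) by (simp add: pd_def)
  qed (simp add: pd_def)
next
  case (Suc i)
  then have "Ck_on (Suc k) V (pd f i j)" by simp
  then show ?case using Ck_pd(1) by (simp add: pd_Suc)
qed

lemma pd2_pd: "open V \<Longrightarrow> Ck_on (Suc (i + j)) V f \<Longrightarrow> y \<in> V \<Longrightarrow> pd2 (pd f i j) y = pd f i (Suc j) y"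
proof (induction i arbitrary: y)
  case 0
  then show ?case by (simp add: pd_def)
next
  case (Suc i)
  have c2: "Ck_on 2 V (pd f i j)" using Suc.prems by (intro Ck_on_pd) (simp del: Ck_on.simps)
  have cS: "Ck_on (Suc (i + j)) V f" using Ck_on_le[OF Suc.prems(2)] by simp
  have "pd2 (pd f (Suc i) j) y = pd1 (pd2 (pd f i j)) y"
    using mixed_derivatives_commute[OF Suc.prems(1,3) c2, of "(1, 0)" "(0, 1)"]
    by (simp add: pd1_def[abs_def] pd2_def[abs_def] pd_Suc)
  also have "\<dots> = pd1 (pd f i (Suc j)) y"
  proof -
    have "Ck_on (Suc 0) V (pd f i (Suc j))" using Suc.prems by (intro Ck_on_pd) (simp del: Ck_on.simps)
    then have "has_partials (pd f i (Suc j)) (pd1 (pd f i (Suc j)) y) (pd2 (pd f i (Suc j)) y) y"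
      using Ck_has_partials Suc.prems by blast
    then have "has_partials (pd2 (pd f i j)) (pd1 (pd f i (Suc j)) y) (pd2 (pd f i (Suc j)) y) y"
      using Suc.IH[OF Suc.prems(1) cS] by (subst has_partials_cong[OF Suc.prems(1,3)])
    then show ?thesis using has_partials_unique by blast
  qed
  finally show ?case by (simp add: pd_Suc)
qed

lemma has_partials_pd:
  assumes "open V" "Ck_on (Suc (i + j)) V f" "y \<in> V"
  shows "has_partials (pd f i j) (pd f (Suc i) j y) (pd f i (Suc j) y) y"
proof -
  have "Ck_on (Suc 0) V (pd f i j)" using assms by (intro Ck_on_pd) (simp del: Ck_on.simps)
  from Ck_has_partials[OF this assms(3)] show ?thesis
    using pd2_pd[OF assms] by (simp add: pd_Suc)
qed

section \<open>Taylor's formula in the plane with Peano remainder\<close>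

definition taylor_poly :: "(nat \<Rightarrow> nat \<Rightarrow> real) \<Rightarrow> nat \<Rightarrow> real \<times> real \<Rightarrow> real" where
  "taylor_poly c m v = (\<Sum>k\<le>m. \<Sum>l\<le>m - k. c k l * (fst v ^ k / fact k) * (snd v ^ l / fact l))"

lemma has_partials_monomial:
  "has_partials (\<lambda>v. fst v ^ k / fact k) (case k of 0 \<Rightarrow> 0 | Suc k \<Rightarrow> fst v ^ k / fact k) 0 v"
  "has_partials (\<lambda>v. snd v ^ k / fact k) 0 (case k of 0 \<Rightarrow> 0 | Suc k \<Rightarrow> snd v ^ k / fact k) v"
proof -
  have d: "((\<lambda>x. x ^ k / fact k) has_real_derivative (case k of 0 \<Rightarrow> 0 | Suc k \<Rightarrow> x ^ k / fact k)) (at x)" for x :: real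
  proof (cases k)
    case (Suc n)
    have "((\<lambda>x. x ^ Suc n / fact (Suc n)) has_real_derivative (real (Suc n) * x ^ n) / fact (Suc n)) (at x)"
      using DERIV_pow[of "Suc n" x] by (intro DERIV_cdivide) simp
    then show ?thesis unfolding Suc by (simp add: field_simps del: of_nat_Suc)
  qed simp
  show "has_partials (\<lambda>v. fst v ^ k / fact k) (case k of 0 \<Rightarrow> 0 | Suc k \<Rightarrow> fst v ^ k / fact k) 0 v"
    "has_partials (\<lambda>v. snd v ^ k / fact k) 0 (case k of 0 \<Rightarrow> 0 | Suc k \<Rightarrow> snd v ^ k / fact k) v"
    using has_partials_compose[OF has_partials_fst d] has_partials_compose[OF has_partials_snd d] by simp_all
qed

lemma has_partials_sum:
  "(\<And>i. i \<in> I \<Longrightarrow> has_partials (f i) (a i) (b i) y) \<Longrightarrow>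
    has_partials (\<lambda>y. \<Sum>i\<in>I. f i y) (\<Sum>i\<in>I. a i) (\<Sum>i\<in>I. b i) y"
  by (induction I rule: infinite_finite_induct) (auto intro: has_partials_add has_partials_const)

text \<open>Differentiation shifts the array of coefficients and lowers the degree by one; this
  makes the induction for the remainder close.\<close>

lemma has_partials_taylor_poly:
  "has_partials (taylor_poly c (Suc m)) (taylor_poly (\<lambda>k. c (Suc k)) m v) (taylor_poly (\<lambda>k l. c k (Suc l)) m v) v"
proof -
  let ?x = "\<lambda>k. case k of 0 \<Rightarrow> 0 | Suc k \<Rightarrow> fst v ^ k / fact k"
  let ?y = "\<lambda>k. case k of 0 \<Rightarrow> 0 | Suc k \<Rightarrow> snd v ^ k / fact k"
  have t: "has_partials (\<lambda>v. c k l * (fst v ^ k / fact k) * (snd v ^ l / fact l))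
     (c k l * ?x k * (snd v ^ l / fact l)) (c k l * (fst v ^ k / fact k) * ?y l) v" for k l
    by (rule has_partials_eq[OF has_partials_mult[OF has_partials_mult[OF has_partials_const
      has_partials_monomial(1)] has_partials_monomial(2)]]) simp_all
  have "has_partials (taylor_poly c (Suc m))
     (\<Sum>k\<le>Suc m. \<Sum>l\<le>Suc m - k. c k l * ?x k * (snd v ^ l / fact l))
     (\<Sum>k\<le>Suc m. \<Sum>l\<le>Suc m - k. c k l * (fst v ^ k / fact k) * ?y l) v"
    unfolding taylor_poly_def[abs_def] by (intro has_partials_sum t)
  moreover have "(\<Sum>k\<le>Suc m. \<Sum>l\<le>Suc m - k. c k l * ?x k * (snd v ^ l / fact l)) = taylor_poly (\<lambda>k. c (Suc k)) m v"
    by (subst sum.atMost_Suc_shift) (simp add: taylor_poly_def)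
  moreover have "(\<Sum>k\<le>Suc m. \<Sum>l\<le>Suc m - k. c k l * (fst v ^ k / fact k) * ?y l) = taylor_poly (\<lambda>k l. c k (Suc l)) m v"
  proof -
    have "(\<Sum>l\<le>Suc m - k. c k l * (fst v ^ k / fact k) * ?y l) = (\<Sum>l\<le>m - k. c k (Suc l) * (fst v ^ k / fact k) * (snd v ^ l / fact l))"
      if "k \<le> m" for k
      using that by (simp add: Suc_diff_le sum.atMost_Suc_shift mult_ac del: sum.atMost_Suc)
    then show ?thesis by (simp add: taylor_poly_def)
  qed
  ultimately show ?thesis by simp
qed

lemma taylor_poly_0: "taylor_poly c m (0, 0) = c 0 0"
proof -
  have *: "(\<Sum>l\<le>n. a l * (0 ^ l / fact l)) = a 0" for a :: "nat \<Rightarrow> real" and n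
    by (induction n) auto
  have in0: "(\<Sum>l\<le>n. c k l * x * (0 ^ l / fact l)) = c k 0 * x" for k x n
    using *[of "\<lambda>l. c k l * x" n] .
  have "taylor_poly c m (0, 0) = (\<Sum>k\<le>m. c k 0 * (0 ^ k / fact k))"
    unfolding taylor_poly_def fst_conv snd_conv in0 ..
  then show ?thesis unfolding * .
qed

text \<open>The mean value inequality on the ball of radius |v|: a gradient bounded there by c
  |v|^m, together with the value 0 at the origin, gives the bound c |v|^(m+1).\<close>

lemma smallo_norm_power_Suc:
  fixes h :: "real \<times> real \<Rightarrow> real"
  assumes r: "r > 0" and h: "\<And>v. v \<in> ball 0 r \<Longrightarrow> has_partials h (a v) (b v) v" and 0: "h 0 = 0"
    and ab: "a \<in> o[nhds 0](\<lambda>v. norm v ^ m)" "b \<in> o[nhds 0](\<lambda>v. norm v ^ m)"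
  shows "h \<in> o[nhds 0](\<lambda>v. norm v ^ Suc m)"
proof (rule landau_o.smallI)
  fix c :: real assume c: "c > 0"
  have ea: "eventually (\<lambda>v. norm (a v) \<le> c / 2 * norm (norm v ^ m)) (nhds 0)"
    using landau_o.smallD[OF ab(1) half_gt_zero[OF c]] .
  have eb: "eventually (\<lambda>v. norm (b v) \<le> c / 2 * norm (norm v ^ m)) (nhds 0)"
    using landau_o.smallD[OF ab(2) half_gt_zero[OF c]] .
  obtain d where d0: "d > 0" "\<forall>v. dist v 0 < d \<longrightarrow> norm (a v) \<le> c / 2 * norm (norm v ^ m) \<and> norm (b v) \<le> c / 2 * norm (norm v ^ m)"
    using iffD1[OF eventually_nhds_metric eventually_conj[OF ea eb]] by (elim exE conjE) (rule that)
  have d2: "\<bar>a v\<bar> \<le> c / 2 * norm v ^ m \<and> \<bar>b v\<bar> \<le> c / 2 * norm v ^ m" if "norm v < d" for v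
    using d0(2)[rule_format, of v] that unfolding dist_0_norm by simp
  have hv: "\<bar>h v\<bar> \<le> c * norm v ^ Suc m" if v: "norm v < min d r" for v
  proof -
    let ?B = "c * norm v ^ m"
    have B: "\<bar>fst w * a x + snd w * b x\<bar> \<le> ?B * norm w" if x: "x \<in> cball (0 :: real \<times> real) (norm v)" for x w :: "real \<times> real"
    proof -
      have "norm x \<le> norm v" using x by simp
      then have "c / 2 * norm x ^ m \<le> c / 2 * norm v ^ m" using c by (intro mult_left_mono power_mono) auto
      moreover have "norm x < d" using \<open>norm x \<le> norm v\<close> v by simp
      ultimately have ax: "\<bar>a x\<bar> \<le> c / 2 * norm v ^ m" "\<bar>b x\<bar> \<le> c / 2 * norm v ^ m"
        using d2[of x] by linarith+
      have w: "\<bar>fst w\<bar> \<le> norm w" "\<bar>snd w\<bar> \<le> norm w"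
        using norm_fst_le[of "fst w" "snd w"] norm_snd_le[of "snd w" "fst w"] by simp_all
      have "\<bar>fst w * a x + snd w * b x\<bar> \<le> \<bar>fst w\<bar> * \<bar>a x\<bar> + \<bar>snd w\<bar> * \<bar>b x\<bar>"
        using abs_triangle_ineq[of "fst w * a x" "snd w * b x"] by (simp only: abs_mult)
      also have "\<dots> \<le> norm w * (c / 2 * norm v ^ m) + norm w * (c / 2 * norm v ^ m)"
        by (intro add_mono mult_mono ax w abs_ge_zero norm_ge_zero)
      finally show ?thesis by (simp add: algebra_simps)
    qed
    have "norm (h v - h 0) \<le> ?B * norm (v - 0)"
    proof (rule differentiable_bound[where f = h and f' = "\<lambda>x w. fst w * a x + snd w * b x" and B = ?B and S = "cball (0 :: real \<times> real) (norm v)"])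
      fix x :: "real \<times> real" assume x: "x \<in> cball (0 :: real \<times> real) (norm v)"
      then have "x \<in> ball 0 r" using v by simp
      from h[OF this] show "(h has_derivative (\<lambda>w. fst w * a x + snd w * b x)) (at x within cball (0 :: real \<times> real) (norm v))"
        unfolding has_partials_def by (rule has_derivative_at_withinI)
      show "onorm (\<lambda>w. fst w * a x + snd w * b x) \<le> ?B"
        by (rule onorm_le, unfold real_norm_def, rule B[OF x])
    next
      show "convex (cball (0 :: real \<times> real) (norm v))" "v \<in> cball (0 :: real \<times> real) (norm v)" "0 \<in> cball (0 :: real \<times> real) (norm v)" by simp_all
    qed
    then show ?thesis by (simp add: 0 mult_ac)
  qed
  have "norm (h v) \<le> c * norm (norm v ^ Suc m)" if "dist v 0 < min d r" for v
    using hv[of v] that by (simp del: power_Suc)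
  then show "eventually (\<lambda>v. norm (h v) \<le> c * norm (norm v ^ Suc m)) (nhds 0)"
    unfolding eventually_nhds_metric by (intro exI[of _ "min d r"] conjI allI impI) (simp add: d0(1) r)
qed

text \<open>Induction on the degree for all derivatives simultaneously: a remainder vanishes at 0,
  and its partial derivatives are the remainders, of one degree less, of the next derivatives.
  Degree 0 is continuity.\<close>

lemma taylor_expansion:
  assumes V: "open V" "y \<in> V" and f: "Ck_on n V f"
  shows "i + j + m \<le> n \<Longrightarrow>
    (\<lambda>v. pd f i j (y + v) - taylor_poly (\<lambda>k l. pd f (i + k) (j + l) y) m v) \<in> o[nhds 0](\<lambda>v. norm v ^ m)"
proof (induction m arbitrary: i j)
  case 0
  have "Ck_on 0 V (pd f i j)" by (rule Ck_on_pd[OF Ck_on_le[OF f]]) (use 0 in simp)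
  then have "isCont (pd f i j) y" using V by (simp add: continuous_on_eq_continuous_at)
  then have "((\<lambda>v. pd f i j (y + v)) \<longlongrightarrow> pd f i j y) (at 0)"
    by (simp add: isCont_iff)
  then have "((\<lambda>v. pd f i j (y + v)) \<longlongrightarrow> pd f i j (y + 0)) (nhds 0)"
    by (simp add: tendsto_nhds_iff)
  then have "((\<lambda>v. pd f i j (y + v) - pd f i j y) \<longlongrightarrow> 0) (nhds 0)"
    using tendsto_diff[OF _ tendsto_const[of "pd f i j y"]] by fastforce
  then show ?case by (auto simp: taylor_poly_def intro!: smalloI_tendsto)
next
  case (Suc m)
  obtain r where r: "r > 0" "ball y r \<subseteq> V" using V openE by blast
  show ?case
  proof (rule smallo_norm_power_Suc[OF r(1)])
    fix v :: "real \<times> real" assume "v \<in> ball 0 r"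
    then have "y + v \<in> ball y r" by (simp add: dist_norm)
    then have "y + v \<in> V" using r(2) by blast
    then have A: "has_partials (pd f i j) (pd f (Suc i) j (y + v)) (pd f i (Suc j) (y + v)) (y + v)"
      using has_partials_pd[OF V(1) Ck_on_le[OF f]] Suc.prems by simp
    have sh: "((\<lambda>v. y + v) has_derivative (\<lambda>w. w)) (at v)"
      by (auto intro!: derivative_eq_intros)
    have "has_partials (\<lambda>v. pd f i j (y + v)) (pd f (Suc i) j (y + v)) (pd f i (Suc j) (y + v)) v"
      using has_derivative_compose[OF sh A[unfolded has_partials_def]] unfolding has_partials_def .
    from has_partials_diff[OF this has_partials_taylor_poly[of "\<lambda>k l. pd f (i + k) (j + l) y" m v]]
    show "has_partials (\<lambda>v. pd f i j (y + v) - taylor_poly (\<lambda>k l. pd f (i + k) (j + l) y) (Suc m) v)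
      (pd f (Suc i) j (y + v) - taylor_poly (\<lambda>k l. pd f (Suc i + k) (j + l) y) m v)
      (pd f i (Suc j) (y + v) - taylor_poly (\<lambda>k l. pd f (i + k) (Suc j + l) y) m v) v"
      by simp
  next
    show "pd f i j (y + 0) - taylor_poly (\<lambda>k l. pd f (i + k) (j + l) y) (Suc m) 0 = 0"
      using taylor_poly_0[of "\<lambda>k l. pd f (i + k) (j + l) y" "Suc m"] by (simp flip: zero_prod_def)
  qed (use Suc.IH[of "Suc i" j] Suc.IH[of i "Suc j"] Suc.prems in simp_all)
qed

section \<open>Graphs with vanishing cubic form\<close>

lemmas has_partials_rules = has_partials_add has_partials_diff has_partials_mult has_partials_const
  has_partials_fst has_partials_snd

text \<open>With \<open>\<rho> = (det H)\<^sup>-\<^sup>1\<^sup>/\<^sup>4\<close> the hypothesis on the third derivatives says that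
  \<open>\<partial>\<^sub>k (\<rho> f\<^sub>i\<^sub>j) = - \<rho>\<^sub>i f\<^sub>j\<^sub>k - \<rho>\<^sub>j f\<^sub>i\<^sub>k\<close>. The integrability conditions
  force \<open>\<rho>\<^sub>i\<^sub>j = \<sigma> f\<^sub>i\<^sub>j\<close> with \<open>\<sigma>\<close> constant, and the equation of the quadric is obtained by
  integrating; \<open>\<rho>\<close> is its derivative in the vertical direction.\<close>

lemma graph_on_quadric:
  assumes V: "open V" "convex V" and f: "Ck_on 5 V f"
    and det: "\<And>y. y \<in> V \<Longrightarrow> pd f 2 0 y * pd f 0 2 y - (pd f 1 1 y)^2 > 0"
    and cubic: "\<And>y. y \<in> V \<Longrightarrow> \<exists>l1 l2. pd f 3 0 y = 3 * l1 * pd f 2 0 y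
      \<and> pd f 2 1 y = 2 * l1 * pd f 1 1 y + l2 * pd f 2 0 y
      \<and> pd f 1 2 y = l1 * pd f 0 2 y + 2 * l2 * pd f 1 1 y \<and> pd f 0 3 y = 3 * l2 * pd f 0 2 y"
  obtains \<sigma> b1 b2 c c11 c12 c22 m1 m2 m0 where
    "\<And>y. y \<in> V \<Longrightarrow> (\<sigma> * f y + b1 * fst y + b2 * snd y + c) * f y - \<sigma> * f y * f y / 2
      - (c11 * fst y * fst y + 2 * c12 * fst y * snd y + c22 * snd y * snd y) / 2
      - (m1 * fst y + m2 * snd y + m0) = 0"
    "\<And>y. y \<in> V \<Longrightarrow> \<sigma> * f y + b1 * fst y + b2 * snd y + c > 0"
proof -
  define f1 f2 p q r where "f1 = pd f 1 0" and "f2 = pd f 0 1" and "p = pd f 2 0" and "q = pd f 1 1" and "r = pd f 0 2"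
  note fdefs = f1_def f2_def p_def q_def r_def
  define u where "u y = p y * r y - q y * q y" for y
  have upos: "u y > 0" if "y \<in> V" for y using det[OF that] by (simp add: u_def fdefs power2_eq_square)
  have p0: "p y \<noteq> 0" if "y \<in> V" for y
    using upos[OF that] zero_le_square[of "q y"] by (auto simp: u_def)
  note hpf = has_partials_pd[OF V(1) Ck_on_le[OF f]]
  \<comment> \<open>The formal partial derivatives of the determinant \<open>u\<close>. The factors
    in \<open>cubic\<close> are given only pointwise; the hypothesis turns these derivatives into 4
    times the factors times \<open>u\<close>, which recovers the factors as functions of class
    C^2.\<close>
  define u1 u2 where "u1 y = p y * pd f 1 2 y + pd f 3 0 y * r y - 2 * (q y * pd f 2 1 y)"
    and "u2 y = p y * pd f 0 3 y + pd f 2 1 y * r y - 2 * (q y * pd f 1 2 y)" for y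
  define l1 l2 where "l1 y = u1 y / (4 * u y)" and "l2 y = u2 y / (4 * u y)" for y
  have third: "pd f 3 0 y = 3 * l1 y * p y" "pd f 2 1 y = 2 * l1 y * q y + l2 y * p y"
     "pd f 1 2 y = l1 y * r y + 2 * l2 y * q y" "pd f 0 3 y = 3 * l2 y * r y" if y: "y \<in> V" for y
  proof -
    obtain k1 k2 where k: "pd f 3 0 y = 3 * k1 * p y" "pd f 2 1 y = 2 * k1 * q y + k2 * p y"
     "pd f 1 2 y = k1 * r y + 2 * k2 * q y" "pd f 0 3 y = 3 * k2 * r y"
      using cubic[OF y] unfolding fdefs by blast
    have "u1 y = k1 * (4 * u y)" "u2 y = k2 * (4 * u y)" unfolding u1_def u2_def k u_def by algebra+
    then have "l1 y = k1" "l2 y = k2" using upos[OF y] by (simp_all add: l1_def l2_def)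
    then show "pd f 3 0 y = 3 * l1 y * p y" "pd f 2 1 y = 2 * l1 y * q y + l2 y * p y"
     "pd f 1 2 y = l1 y * r y + 2 * l2 y * q y" "pd f 0 3 y = 3 * l2 y * r y" using k by simp_all
  qed
  have hf: "has_partials f (f1 y) (f2 y) y" and hf1: "has_partials f1 (p y) (q y) y" and hf2: "has_partials f2 (q y) (r y) y"
    and hp: "has_partials p (3 * l1 y * p y) (2 * l1 y * q y + l2 y * p y) y"
    and hq: "has_partials q (2 * l1 y * q y + l2 y * p y) (l1 y * r y + 2 * l2 y * q y) y"
    and hr: "has_partials r (l1 y * r y + 2 * l2 y * q y) (3 * l2 y * r y) y" if y: "y \<in> V" for y
    using hpf[of 0 0 y] hpf[of 1 0 y] hpf[of 0 1 y] hpf[of 2 0 y] hpf[of 1 1 y] hpf[of 0 2 y] y third[OF y]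
    unfolding fdefs by (simp_all add: pd_0 numeral_2_eq_2 numeral_3_eq_3)
  have Cpd: "Ck_on k V (pd f i j)" if "i + j + k \<le> 5" for i j k by (rule Ck_on_pd[OF Ck_on_le[OF f that]])
  have Cpqr: "Ck_on 3 V p" "Ck_on 3 V q" "Ck_on 3 V r" unfolding fdefs by (rule Cpd, simp)+
  have Cu: "Ck_on 2 V u" unfolding u_def
    by (intro Ck_on_diff Ck_on_mult V Ck_on_le[OF Cpqr(1)] Ck_on_le[OF Cpqr(2)] Ck_on_le[OF Cpqr(3)]) simp_all
  have Cp2: "Ck_on 2 V p" "Ck_on 2 V q" "Ck_on 2 V r" using Cpqr Ck_on_le[of 3 V _ 2] by simp_all
  have Cu1: "Ck_on 2 V u1" "Ck_on 2 V u2" unfolding u1_def u2_def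
    by (intro Ck_on_diff Ck_on_add Ck_on_mult Ck_on_const V Cp2 Cpd; simp)+
  have Cl: "Ck_on 2 V l1" "Ck_on 2 V l2" unfolding l1_def l2_def
    using upos by (intro Ck_on_divide Ck_on_mult Ck_on_const V Cu Cu1, force)+
  define \<rho> where "\<rho> y = exp (- (1/4) * ln (u y))" for y
  have \<rho>pos: "\<rho> y > 0" for y by (simp add: \<rho>_def)
  have hu: "has_partials u (4 * l1 y * u y) (4 * l2 y * u y) y" if y: "y \<in> V" for y
    unfolding u_def[abs_def]
    by (rule has_partials_eq, (rule has_partials_rules hp hq hr y)+) (simp_all add: algebra_simps)
  define \<rho>1 \<rho>2 where "\<rho>1 y = - l1 y * \<rho> y" and "\<rho>2 y = - l2 y * \<rho> y" for y
  have h\<rho>: "has_partials \<rho> (\<rho>1 y) (\<rho>2 y) y" if y: "y \<in> V" for y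
  proof -
    have "((\<lambda>x. exp (- (1/4) * ln x)) has_real_derivative - (1/4) * inverse (u y) * exp (- (1/4) * ln (u y))) (at (u y))"
      using upos[OF y] by (auto intro!: derivative_eq_intros simp: field_simps)
    from has_partials_compose[OF hu[OF y] this] show ?thesis
      unfolding \<rho>_def[abs_def] \<rho>1_def \<rho>2_def using upos[OF y] by (rule_tac has_partials_eq) (auto simp: field_simps)
  qed
  have C\<rho>_step: "Ck_on (Suc k) V \<rho>" if "Ck_on k V \<rho>" "k \<le> 2" for k
    by (rule Ck_partialsI[OF V(1) h\<rho>]) (auto simp: \<rho>1_def[abs_def] \<rho>2_def[abs_def] intro!: Ck_on_mult Ck_on_minus V that Ck_on_le[OF Cl(1)] Ck_on_le[OF Cl(2)])
  have "Ck_on 0 V \<rho>" unfolding \<rho>_def Ck_on.simps(1)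
    using upos Ck_on_continuous[OF Cu] by (intro continuous_intros) force+
  then have C\<rho>2: "Ck_on 2 V \<rho>" using C\<rho>_step[of 0] C\<rho>_step[of 1] by (simp add: numeral_2_eq_2)
  then have C\<rho>: "Ck_on 3 V \<rho>" using C\<rho>_step[of 2] by (simp add: numeral_3_eq_3 numeral_2_eq_2)
  have C\<rho>1: "Ck_on 2 V \<rho>1" "Ck_on 2 V \<rho>2" unfolding \<rho>1_def \<rho>2_def
    by (intro Ck_on_mult Ck_on_minus V Cl C\<rho>2)+
  define \<rho>11 \<rho>12 \<rho>21 \<rho>22 where "\<rho>11 = pd1 \<rho>1" and "\<rho>12 = pd2 \<rho>1" and "\<rho>21 = pd1 \<rho>2" and "\<rho>22 = pd2 \<rho>2"
  have hr1: "has_partials \<rho>1 (\<rho>11 y) (\<rho>12 y) y" and hr2: "has_partials \<rho>2 (\<rho>21 y) (\<rho>22 y) y" if y: "y \<in> V" for y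
    using Ck_has_partials[of 1 V \<rho>1 y] Ck_has_partials[of 1 V \<rho>2 y] C\<rho>1 y
    unfolding \<rho>11_def \<rho>12_def \<rho>21_def \<rho>22_def by (simp_all add: numeral_2_eq_2)
  have C11: "Ck_on 1 V \<rho>11" using Ck_pd(1)[of 1 V \<rho>1] C\<rho>1 by (simp add: \<rho>11_def numeral_2_eq_2)
  have C1: "Ck_on 1 V g" if "Ck_on 2 V g" for g using Ck_on_le[OF that] by simp
  note C1s = C1[OF C\<rho>1(1)] C1[OF C\<rho>1(2)] C1[OF Cp2(1)] C1[OF Cp2(2)] C1[OF Cp2(3)] C1[OF C\<rho>2]
  have cm: "Ck_on 1 V (\<lambda>y. g y * h y)" "Ck_on 1 V (\<lambda>y. k * (g y * h y))" if "Ck_on 1 V g" "Ck_on 1 V h" for k g h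
    by (intro Ck_on_mult Ck_on_const V that)+
  have cm2: "Ck_on 1 V (\<lambda>y. k * (g y * h y + g' y * h' y))" if "Ck_on 1 V g" "Ck_on 1 V h" "Ck_on 1 V g'" "Ck_on 1 V h'" for k g h g' h'
    by (intro Ck_on_mult Ck_on_add Ck_on_const V that)
  have sym: "\<rho>12 y = \<rho>21 y" if y: "y \<in> V" for y
    by (rule partials_integrability[OF V(1) y h\<rho> C1s(1,2) hr1[OF y] hr2[OF y]])
  have hrp: "has_partials (\<lambda>y. \<rho> y * p y) ((- 2) * (\<rho>1 y * p y)) ((- 2) * (\<rho>1 y * q y)) y" if y: "y \<in> V" for y
    by (rule has_partials_eq, (rule has_partials_rules h\<rho> hp y)+) (simp_all add: \<rho>1_def \<rho>2_def algebra_simps)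
  have hrq: "has_partials (\<lambda>y. \<rho> y * q y) ((- 1) * (\<rho>1 y * q y + \<rho>2 y * p y)) ((- 1) * (\<rho>1 y * r y + \<rho>2 y * q y)) y" if y: "y \<in> V" for y
    by (rule has_partials_eq, (rule has_partials_rules h\<rho> hq y)+) (simp_all add: \<rho>1_def \<rho>2_def algebra_simps)
  have hrr: "has_partials (\<lambda>y. \<rho> y * r y) ((- 2) * (\<rho>2 y * q y)) ((- 2) * (\<rho>2 y * r y)) y" if y: "y \<in> V" for y
    by (rule has_partials_eq, (rule has_partials_rules h\<rho> hr y)+) (simp_all add: \<rho>1_def \<rho>2_def algebra_simps)
  \<comment> \<open>The integrability conditions of the three products of \<open>\<rho>\<close> with
    second derivatives of \<open>f\<close> make the Hessian of \<open>\<rho>\<close> proportional to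
    that of \<open>f\<close>. Division by \<open>p\<close> is legitimate because p r > q^2.\<close>
  define \<sigma> where "\<sigma> y = \<rho>11 y / p y" for y
  have s11: "\<rho>11 y = \<sigma> y * p y" and s12: "\<rho>12 y = \<sigma> y * q y" and s22: "\<rho>22 y = \<sigma> y * r y" if y: "y \<in> V" for y
  proof -
    note H1 = has_partials_mult[OF has_partials_const has_partials_mult[OF hr1[OF y] hp[OF y]]]
    note H2 = has_partials_mult[OF has_partials_const has_partials_mult[OF hr1[OF y] hq[OF y]]]
    note H3 = has_partials_mult[OF has_partials_const has_partials_mult[OF hr2[OF y] hq[OF y]]]
    note H4 = has_partials_mult[OF has_partials_const has_partials_mult[OF hr2[OF y] hr[OF y]]]
    have "\<rho>12 y * p y = \<rho>11 y * q y"
      using partials_integrability[OF V(1) y hrp cm(2)[OF C1s(1,3)] cm(2)[OF C1s(1,4)] H1 H2] by (simp add: algebra_simps)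
    moreover have "\<rho>22 y * q y = \<rho>12 y * r y"
      using partials_integrability[OF V(1) y hrr cm(2)[OF C1s(2,4)] cm(2)[OF C1s(2,5)] H3 H4] sym[OF y] by (simp add: algebra_simps)
    moreover have "\<rho>22 y * p y = \<rho>11 y * r y"
    proof -
      note H5 = has_partials_mult[OF has_partials_const has_partials_add[OF has_partials_mult[OF hr1[OF y] hq[OF y]] has_partials_mult[OF hr2[OF y] hp[OF y]]]]
      note H6 = has_partials_mult[OF has_partials_const has_partials_add[OF has_partials_mult[OF hr1[OF y] hr[OF y]] has_partials_mult[OF hr2[OF y] hq[OF y]]]]
      show ?thesis
        using partials_integrability[OF V(1) y hrq cm2[OF C1s(1,4,2,3)] cm2[OF C1s(1,5,2,4)] H5 H6] sym[OF y]
        by (simp add: algebra_simps)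
    qed
    ultimately show "\<rho>11 y = \<sigma> y * p y" "\<rho>12 y = \<sigma> y * q y" "\<rho>22 y = \<sigma> y * r y"
      using p0[OF y] by (simp_all add: \<sigma>_def field_simps)
  qed
  have C\<sigma>: "Ck_on 1 V \<sigma>" unfolding \<sigma>_def using p0 by (intro Ck_on_divide V C11 C1s)
  define \<sigma>1 \<sigma>2 where "\<sigma>1 = pd1 \<sigma>" and "\<sigma>2 = pd2 \<sigma>"
  have h\<sigma>: "has_partials \<sigma> (\<sigma>1 y) (\<sigma>2 y) y" if y: "y \<in> V" for y
    using Ck_has_partials[of 0 V \<sigma> y] C\<sigma> y unfolding \<sigma>1_def \<sigma>2_def by simp
  have hr1': "has_partials \<rho>1 (\<sigma> y * p y) (\<sigma> y * q y) y" and hr2': "has_partials \<rho>2 (\<sigma> y * q y) (\<sigma> y * r y) y" if y: "y \<in> V" for y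
    using hr1[OF y] hr2[OF y] sym[OF y] s11[OF y] s12[OF y] s22[OF y] by simp_all
  \<comment> \<open>Integrability of the two gradients of \<open>\<rho>1\<close> and
    \<open>\<rho>2\<close> gives a homogeneous linear system for the gradient of
    \<open>\<sigma>\<close>, whose determinant is \<open>u\<close>.\<close>
  have "\<sigma>1 y = 0 \<and> \<sigma>2 y = 0" if y: "y \<in> V" for y
  proof -
    have 1: "\<sigma>2 y * p y = \<sigma>1 y * q y"
      using partials_integrability[OF V(1) y hr1' cm(1)[OF C\<sigma> C1s(3)] cm(1)[OF C\<sigma> C1s(4)] has_partials_mult[OF h\<sigma>[OF y] hp[OF y]] has_partials_mult[OF h\<sigma>[OF y] hq[OF y]]]
      by (simp add: algebra_simps)
    have 2: "\<sigma>2 y * q y = \<sigma>1 y * r y"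
      using partials_integrability[OF V(1) y hr2' cm(1)[OF C\<sigma> C1s(4)] cm(1)[OF C\<sigma> C1s(5)] has_partials_mult[OF h\<sigma>[OF y] hq[OF y]] has_partials_mult[OF h\<sigma>[OF y] hr[OF y]]]
      by (simp add: algebra_simps)
    have "\<sigma>1 y * u y = 0" "\<sigma>2 y * u y = 0" using 1 2 unfolding u_def by algebra+
    then show ?thesis using upos[OF y] by simp
  qed
  then have "\<exists>s. \<forall>y\<in>V. \<sigma> y = s" using has_partials_zero_constant[OF V(2,1), of \<sigma>] h\<sigma> by metis
  then obtain s where s: "\<sigma> y = s" if "y \<in> V" for y by blast
  have h1: "has_partials \<rho>1 (s * p y) (s * q y) y" and h2: "has_partials \<rho>2 (s * q y) (s * r y) y" if y: "y \<in> V" for y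
    using hr1'[OF y] hr2'[OF y] s[OF y] by simp_all
  note R = has_partials_rules h1 h2 hrp hrq hrr h\<rho> hf hf1 hf2
  \<comment> \<open>With \<open>\<sigma>\<close> constant, \<open>\<rho>\<close> and s f have the
    same second derivatives, so they differ by an affine function; \<open>b1\<close>,
    \<open>b2\<close>, \<open>c\<close> are its coefficients.\<close>
  obtain b1 where b1: "\<rho>1 y - s * f1 y = b1" if "y \<in> V" for y
  proof (rule has_partials_zero_constant[OF V(2,1), of "\<lambda>y. \<rho>1 y - s * f1 y"])
    fix y assume y: "y \<in> V"
    show "has_partials (\<lambda>y. \<rho>1 y - s * f1 y) 0 0 y"
      by (rule has_partials_eq, (rule R y)+) simp_all
  qed blast
  obtain b2 where b2: "\<rho>2 y - s * f2 y = b2" if "y \<in> V" for y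
  proof (rule has_partials_zero_constant[OF V(2,1), of "\<lambda>y. \<rho>2 y - s * f2 y"])
    fix y assume y: "y \<in> V"
    show "has_partials (\<lambda>y. \<rho>2 y - s * f2 y) 0 0 y"
      by (rule has_partials_eq, (rule R y)+) simp_all
  qed blast
  obtain c where c: "\<rho> y - (s * f y + b1 * fst y + b2 * snd y) = c" if "y \<in> V" for y
  proof (rule has_partials_zero_constant[OF V(2,1), of "\<lambda>y. \<rho> y - (s * f y + b1 * fst y + b2 * snd y)"])
    fix y assume y: "y \<in> V"
    show "has_partials (\<lambda>y. \<rho> y - (s * f y + b1 * fst y + b2 * snd y)) 0 0 y"
      by (rule has_partials_eq, (rule R y)+) (simp_all add: b1[OF y, symmetric] b2[OF y, symmetric])
  qed blast
  \<comment> \<open>The three expressions \<open>c11\<close>, \<open>c12\<close>, \<open>c22\<close>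
    are the second derivatives of \<rho> f - s f^2 / 2. Since they are constant this function is a
    quadratic polynomial in the base point, whose lower coefficients are \<open>m1\<close>,
    \<open>m2\<close>, \<open>m0\<close>.\<close>
  obtain c11 where c11: "\<rho> y * p y + 2 * (\<rho>1 y * f1 y) - s * (f1 y * f1 y) = c11" if "y \<in> V" for y
  proof (rule has_partials_zero_constant[OF V(2,1), of "\<lambda>y. \<rho> y * p y + 2 * (\<rho>1 y * f1 y) - s * (f1 y * f1 y)"])
    fix y assume y: "y \<in> V"
    show "has_partials (\<lambda>y. \<rho> y * p y + 2 * (\<rho>1 y * f1 y) - s * (f1 y * f1 y)) 0 0 y"
      by (rule has_partials_eq, rule has_partials_diff, rule has_partials_add, rule hrp[OF y], (rule R y)+) (simp_all add: algebra_simps)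
  qed blast
  obtain c12 where c12: "\<rho> y * q y + (\<rho>1 y * f2 y + \<rho>2 y * f1 y) - s * (f1 y * f2 y) = c12" if "y \<in> V" for y
  proof (rule has_partials_zero_constant[OF V(2,1), of "\<lambda>y. \<rho> y * q y + (\<rho>1 y * f2 y + \<rho>2 y * f1 y) - s * (f1 y * f2 y)"])
    fix y assume y: "y \<in> V"
    show "has_partials (\<lambda>y. \<rho> y * q y + (\<rho>1 y * f2 y + \<rho>2 y * f1 y) - s * (f1 y * f2 y)) 0 0 y"
      by (rule has_partials_eq, rule has_partials_diff, rule has_partials_add, rule hrq[OF y], (rule R y)+) (simp_all add: algebra_simps)
  qed blast
  obtain c22 where c22: "\<rho> y * r y + 2 * (\<rho>2 y * f2 y) - s * (f2 y * f2 y) = c22" if "y \<in> V" for y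
  proof (rule has_partials_zero_constant[OF V(2,1), of "\<lambda>y. \<rho> y * r y + 2 * (\<rho>2 y * f2 y) - s * (f2 y * f2 y)"])
    fix y assume y: "y \<in> V"
    show "has_partials (\<lambda>y. \<rho> y * r y + 2 * (\<rho>2 y * f2 y) - s * (f2 y * f2 y)) 0 0 y"
      by (rule has_partials_eq, rule has_partials_diff, rule has_partials_add, rule hrr[OF y], (rule R y)+) (simp_all add: algebra_simps)
  qed blast
  obtain m1 where m1: "\<rho>1 y * f y + \<rho> y * f1 y - s * (f y * f1 y) - (c11 * fst y + c12 * snd y) = m1" if "y \<in> V" for y
  proof (rule has_partials_zero_constant[OF V(2,1), of "\<lambda>y. \<rho>1 y * f y + \<rho> y * f1 y - s * (f y * f1 y) - (c11 * fst y + c12 * snd y)"])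
    fix y assume y: "y \<in> V"
    show "has_partials (\<lambda>y. \<rho>1 y * f y + \<rho> y * f1 y - s * (f y * f1 y) - (c11 * fst y + c12 * snd y)) 0 0 y"
      by (rule has_partials_eq, (rule R y)+) (simp_all add: c11[OF y, symmetric] c12[OF y, symmetric] algebra_simps)
  qed blast
  obtain m2 where m2: "\<rho>2 y * f y + \<rho> y * f2 y - s * (f y * f2 y) - (c12 * fst y + c22 * snd y) = m2" if "y \<in> V" for y
  proof (rule has_partials_zero_constant[OF V(2,1), of "\<lambda>y. \<rho>2 y * f y + \<rho> y * f2 y - s * (f y * f2 y) - (c12 * fst y + c22 * snd y)"])
    fix y assume y: "y \<in> V"
    show "has_partials (\<lambda>y. \<rho>2 y * f y + \<rho> y * f2 y - s * (f y * f2 y) - (c12 * fst y + c22 * snd y)) 0 0 y"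
      by (rule has_partials_eq, (rule R y)+) (simp_all add: c12[OF y, symmetric] c22[OF y, symmetric] algebra_simps)
  qed blast
  let ?W = "\<lambda>y. \<rho> y * f y - (s / 2) * (f y * f y) - (1 / 2) * (c11 * (fst y * fst y) + 2 * (c12 * (fst y * snd y)) + c22 * (snd y * snd y)) - (m1 * fst y + m2 * snd y)"
  obtain m0 where m0: "?W y = m0" if "y \<in> V" for y
  proof (rule has_partials_zero_constant[OF V(2,1), of ?W])
    fix y assume y: "y \<in> V"
    show "has_partials ?W 0 0 y"
      by (rule has_partials_eq, (rule R y)+) (simp_all add: m1[OF y, symmetric] m2[OF y, symmetric] algebra_simps)
  qed blast
  show thesis
  proof (rule that)
    fix y assume y: "y \<in> V"
    have *: "s * f y + b1 * fst y + b2 * snd y + c = \<rho> y" using c[OF y] by simp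
    show "s * f y + b1 * fst y + b2 * snd y + c > 0" unfolding * by (rule \<rho>pos)
    show "(s * f y + b1 * fst y + b2 * snd y + c) * f y - s * f y * f y / 2
      - (c11 * fst y * fst y + 2 * c12 * fst y * snd y + c22 * snd y * snd y) / 2
      - (m1 * fst y + m2 * snd y + m0) = 0"
      unfolding * m0[OF y, symmetric] by (simp add: field_simps)
  qed
qed

section \<open>The cubic form and flat shadow boundaries\<close>

lemma taylor_poly_4: "taylor_poly c 4 (v, w) = c 0 0 + (c 1 0 * v + c 0 1 * w)
    + (c 2 0 / 2 * v^2 + c 1 1 * v * w + c 0 2 / 2 * w^2)
    + (c 3 0 / 6 * v^3 + c 2 1 / 2 * v^2 * w + c 1 2 / 2 * v * w^2 + c 0 3 / 6 * w^3)
    + (c 4 0 / 24 * v^4 + c 3 1 / 6 * v^3 * w + c 2 2 / 4 * v^2 * w^2 + c 1 3 / 6 * v * w^3 + c 0 4 / 24 * w^4)"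
  by (simp add: taylor_poly_def eval_nat_numeral fact_numeral algebra_simps)

lemma taylor_poly_2: "taylor_poly c 2 v = c 0 0 + (c 1 0 * fst v + c 0 1 * snd v)
    + (c 2 0 / 2 * fst v^2 + c 1 1 * fst v * snd v + c 0 2 / 2 * snd v^2)"
  by (simp add: taylor_poly_def eval_nat_numeral algebra_simps)

lemma taylor_poly_1: "taylor_poly c 1 v = c 0 0 + (c 1 0 * fst v + c 0 1 * snd v)"
  by (simp add: taylor_poly_def algebra_simps)

text \<open>\<open>Q\<close> lists the horizontal displacements of the sources from
  \<open>y\<close>. Sixteen slopes make a polynomial of degree 15 vanish; one further source is
  required because the direction conjugate to a source may be vertical in the base plane and then
  has no slope.\<close>

lemma third_derivatives_of_flat_shadows:
  assumes V: "open V" "y \<in> V" and f: "Ck_on 5 V f"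
    and D: "pd f 2 0 y * pd f 0 2 y - (pd f 1 1 y)^2 > 0"
    and Q: "finite Q" "16 < card Q"
    and indep: "\<And>q q'. \<lbrakk>q \<in> Q; q' \<in> Q; q \<noteq> q'\<rbrakk> \<Longrightarrow> fst q * snd q' \<noteq> snd q * fst q'"
    and flat: "\<And>q. q \<in> Q \<Longrightarrow> \<exists>l m k. (l, m, k) \<noteq> (0, 0, 0) \<and> (\<forall>x\<in>V.
      f x + pd f 1 0 x * (fst y + fst q - fst x) + pd f 0 1 x * (snd y + snd q - snd x)
        = f y + pd f 1 0 y * fst q + pd f 0 1 y * snd q
      \<longrightarrow> l * (fst x - fst y) + m * (snd x - snd y) + k * (f x - f y) = 0)"
  shows "\<exists>l1 l2. pd f 3 0 y = 3 * l1 * pd f 2 0 y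
      \<and> pd f 2 1 y = 2 * l1 * pd f 1 1 y + l2 * pd f 2 0 y
      \<and> pd f 1 2 y = l1 * pd f 0 2 y + 2 * l2 * pd f 1 1 y \<and> pd f 0 3 y = 3 * l2 * pd f 0 2 y"
proof -
  define h11 h12 h22 where "h11 = pd f 2 0 y" and "h12 = pd f 1 1 y" and "h22 = pd f 0 2 y"
  have Dp: "h11 * h22 - h12^2 > 0" using D by (simp add: h11_def h12_def h22_def)
  obtain r where r: "r > 0" "ball y r \<subseteq> V" using V openE by blast
  \<comment> \<open>The height over the tangent plane at \<open>y\<close>; \<open>\<phi>1\<close>
    and \<open>\<phi>2\<close> are its partial derivatives, in coordinates centred at
    \<open>y\<close>.\<close>
  define \<phi> where "\<phi> v = f (y + v) - f y - (pd f 1 0 y * fst v + pd f 0 1 y * snd v)" for v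
  define \<phi>1 where "\<phi>1 v = pd f 1 0 (y + v) - pd f 1 0 y" for v
  define \<phi>2 where "\<phi>2 v = pd f 0 1 (y + v) - pd f 0 1 y" for v
  have inV: "y + v \<in> V" if "v \<in> ball 0 r" for v
  proof -
    have "y + v \<in> ball y r" using that by (simp add: dist_norm)
    then show ?thesis using r(2) by blast
  qed
  note T = taylor_expansion[OF V f]
  have cont: "continuous_on (ball 0 r) \<phi>" "continuous_on (ball 0 r) \<phi>1" "continuous_on (ball 0 r) \<phi>2"
  proof -
    have c: "continuous_on (ball 0 r) (\<lambda>v. pd f i j (y + v))" if "i + j \<le> 1" for i j
      by (rule continuous_on_compose2[OF Ck_on_continuous[OF Ck_on_pd[OF Ck_on_le[OF f, of "i + j + 0"]]]])
        (use that in simp, intro continuous_intros, use inV in blast)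
    show "continuous_on (ball 0 r) \<phi>" "continuous_on (ball 0 r) \<phi>1" "continuous_on (ball 0 r) \<phi>2"
      unfolding \<phi>_def \<phi>1_def \<phi>2_def using c[of 0 0] c[of 1 0] c[of 0 1]
      by (auto intro!: continuous_intros simp: pd_0)
  qed
  have low: "\<phi> \<in> o[nhds 0](norm)"
      "(\<lambda>v. \<phi>1 v - (h11 * fst v + h12 * snd v)) \<in> o[nhds 0](norm)"
      "(\<lambda>v. \<phi>2 v - (h12 * fst v + h22 * snd v)) \<in> o[nhds 0](norm)"
    using T[of 0 0 1] T[of 1 0 1] T[of 0 1 1]
    by (simp_all add: taylor_poly_1[unfolded One_nat_def] \<phi>_def[abs_def] \<phi>1_def \<phi>2_def h11_def h12_def h22_def pd_0 numeral_2_eq_2 algebra_simps)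
  have mid: "(\<lambda>v. \<phi> v - (h11 * fst v^2 + 2 * h12 * fst v * snd v + h22 * snd v^2) / 2) \<in> o[nhds 0](\<lambda>v. norm v^2)"
    using T[of 0 0 2]
    by (simp add: taylor_poly_2 \<phi>_def[abs_def] h11_def h12_def h22_def pd_0 add_divide_distrib algebra_simps)
  define a0 a1 a2 a3 where "a0 = pd f 3 0 y / 6" and "a1 = pd f 2 1 y / 2" and "a2 = pd f 1 2 y / 2" and "a3 = pd f 0 3 y / 6"
  define b0 b1 b2 b3 b4 where "b0 = pd f 4 0 y / 24" and "b1 = pd f 3 1 y / 6" and "b2 = pd f 2 2 y / 4"
    and "b3 = pd f 1 3 y / 6" and "b4 = pd f 0 4 y / 24"
  define c0 c1 c2 c3 c4 c5 where "c0 = pd f 5 0 y / 120" and "c1 = pd f 4 1 y / 24" and "c2 = pd f 3 2 y / 12"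
    and "c3 = pd f 2 3 y / 12" and "c4 = pd f 1 4 y / 24" and "c5 = pd f 0 5 y / 120"
  note cd = h11_def h12_def h22_def a0_def a1_def a2_def a3_def b0_def b1_def b2_def b3_def b4_def
    c0_def c1_def c2_def c3_def c4_def c5_def
  have num: "1 + 0 = (1::nat)" "1 + 1 = (2::nat)" "1 + 2 = (3::nat)" "1 + 3 = (4::nat)" "1 + 4 = (5::nat)" by simp_all
  have expand: "(\<lambda>(v,w). pd f i j (y + (v,w)) - taylor_poly (\<lambda>k l. pd f (i + k) (j + l) y) 4 (v,w)) \<in> o[nhds 0](\<lambda>v. norm v^4)"
    if "i + j \<le> 1" for i j
    using T[of i j 4] that by (simp add: case_prod_unfold)
  have high: "(\<lambda>(v,w). \<phi> (v,w) - ((h11 * v^2 + 2 * h12 * v * w + h22 * w^2) / 2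
        + (a0 * v^3 + a1 * v^2 * w + a2 * v * w^2 + a3 * w^3)
        + (b0 * v^4 + b1 * v^3 * w + b2 * v^2 * w^2 + b3 * v * w^3 + b4 * w^4))) \<in> o[nhds 0](\<lambda>v. norm v^4)"
      "(\<lambda>(v,w). \<phi>1 (v,w) - ((h11 * v + h12 * w) + (3 * a0 * v^2 + 2 * a1 * v * w + a2 * w^2)
        + (4 * b0 * v^3 + 3 * b1 * v^2 * w + 2 * b2 * v * w^2 + b3 * w^3)
        + (5 * c0 * v^4 + 4 * c1 * v^3 * w + 3 * c2 * v^2 * w^2 + 2 * c3 * v * w^3 + c4 * w^4))) \<in> o[nhds 0](\<lambda>v. norm v^4)"
      "(\<lambda>(v,w). \<phi>2 (v,w) - ((h12 * v + h22 * w) + (a1 * v^2 + 2 * a2 * v * w + 3 * a3 * w^2)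
        + (b1 * v^3 + 2 * b2 * v^2 * w + 3 * b3 * v * w^2 + 4 * b4 * w^3)
        + (c1 * v^4 + 2 * c2 * v^3 * w + 3 * c3 * v^2 * w^2 + 4 * c4 * v * w^3 + 5 * c5 * w^4))) \<in> o[nhds 0](\<lambda>v. norm v^4)"
  proof -
    have e0: "pd f 0 0 (y + (v,w)) - taylor_poly (\<lambda>k l. pd f (0 + k) (0 + l) y) 4 (v,w)
      = \<phi> (v,w) - ((h11 * v^2 + 2 * h12 * v * w + h22 * w^2) / 2
        + (a0 * v^3 + a1 * v^2 * w + a2 * v * w^2 + a3 * w^3)
        + (b0 * v^4 + b1 * v^3 * w + b2 * v^2 * w^2 + b3 * v * w^3 + b4 * w^4))" for v w
      unfolding taylor_poly_4 \<phi>_def cd add_0 fst_conv snd_conv pd_0 by (simp add: field_simps)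
    show "(\<lambda>(v,w). \<phi> (v,w) - ((h11 * v^2 + 2 * h12 * v * w + h22 * w^2) / 2
        + (a0 * v^3 + a1 * v^2 * w + a2 * v * w^2 + a3 * w^3)
        + (b0 * v^4 + b1 * v^3 * w + b2 * v^2 * w^2 + b3 * v * w^3 + b4 * w^4))) \<in> o[nhds 0](\<lambda>v. norm v^4)"
      using expand[of 0 0] unfolding e0 by simp
    have e1: "pd f 1 0 (y + (v,w)) - taylor_poly (\<lambda>k l. pd f (1 + k) (0 + l) y) 4 (v,w)
      = \<phi>1 (v,w) - ((h11 * v + h12 * w) + (3 * a0 * v^2 + 2 * a1 * v * w + a2 * w^2)
        + (4 * b0 * v^3 + 3 * b1 * v^2 * w + 2 * b2 * v * w^2 + b3 * w^3)
        + (5 * c0 * v^4 + 4 * c1 * v^3 * w + 3 * c2 * v^2 * w^2 + 2 * c3 * v * w^3 + c4 * w^4))" for v w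
      unfolding taylor_poly_4 \<phi>1_def cd num add_0 by (simp add: field_simps)
    show "(\<lambda>(v,w). \<phi>1 (v,w) - ((h11 * v + h12 * w) + (3 * a0 * v^2 + 2 * a1 * v * w + a2 * w^2)
        + (4 * b0 * v^3 + 3 * b1 * v^2 * w + 2 * b2 * v * w^2 + b3 * w^3)
        + (5 * c0 * v^4 + 4 * c1 * v^3 * w + 3 * c2 * v^2 * w^2 + 2 * c3 * v * w^3 + c4 * w^4))) \<in> o[nhds 0](\<lambda>v. norm v^4)"
      using expand[of 1 0] unfolding e1 by simp
    have e2: "pd f 0 1 (y + (v,w)) - taylor_poly (\<lambda>k l. pd f (0 + k) (1 + l) y) 4 (v,w)
      = \<phi>2 (v,w) - ((h12 * v + h22 * w) + (a1 * v^2 + 2 * a2 * v * w + 3 * a3 * w^2)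
        + (b1 * v^3 + 2 * b2 * v^2 * w + 3 * b3 * v * w^2 + 4 * b4 * w^3)
        + (c1 * v^4 + 2 * c2 * v^3 * w + 3 * c3 * v^2 * w^2 + 4 * c4 * v * w^3 + 5 * c5 * w^4))" for v w
      unfolding taylor_poly_4 \<phi>2_def cd num add_0 by (simp add: field_simps)
    show "(\<lambda>(v,w). \<phi>2 (v,w) - ((h12 * v + h22 * w) + (a1 * v^2 + 2 * a2 * v * w + 3 * a3 * w^2)
        + (b1 * v^3 + 2 * b2 * v^2 * w + 3 * b3 * v * w^2 + 4 * b4 * w^3)
        + (c1 * v^4 + 2 * c2 * v^3 * w + 3 * c3 * v^2 * w^2 + 4 * c4 * v * w^3 + 5 * c5 * w^4))) \<in> o[nhds 0](\<lambda>v. norm v^4)"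
      using expand[of 0 1] unfolding e2 by simp
  qed
  \<comment> \<open>\<open>slope q\<close> is the \<open>x\<close> for which (1, x) is conjugate to
    \<open>q\<close>, and \<open>lam q\<close> is the factor by which \<open>q\<close> exceeds the
    vector (e, f) of that slope. The case \<open>den q = 0\<close> means that (0, 1) is conjugate to
    \<open>q\<close>.\<close>
  define den where "den q = h12 * fst q + h22 * snd q" for q :: "real \<times> real"
  define slope where "slope q = - (h11 * fst q + h12 * snd q) / den q" for q
  define lam where "lam q = den q / (h11 * h22 - h12^2)" for q
  have q_eq: "fst q = lam q * (- (h12 + h22 * slope q))" "snd q = lam q * (h11 + h12 * slope q)" if "den q \<noteq> 0" for q
  proof -
    have s: "slope q * den q = - (h11 * fst q + h12 * snd q)" using that by (simp add: slope_def)
    have "den q * (- (h12 + h22 * slope q)) = fst q * (h11 * h22 - h12^2)"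
      "den q * (h11 + h12 * slope q) = snd q * (h11 * h22 - h12^2)"
      using s unfolding den_def by algebra+
    then show "fst q = lam q * (- (h12 + h22 * slope q))" "snd q = lam q * (h11 + h12 * slope q)"
      using Dp by (simp_all add: lam_def divide_simps)
  qed
  define Q' where "Q' = {q \<in> Q. den q \<noteq> 0}"
  have h22: "h22 \<noteq> 0" using Dp by auto
  \<comment> \<open>All displacements with \<open>den q = 0\<close> lie on one line through the
    origin, so \<open>indep\<close> allows at most one.\<close>
  have "card (Q - Q') \<le> 1"
  proof -
    have "q = q'" if "q \<in> Q - Q'" "q' \<in> Q - Q'" for q q'
    proof (rule ccontr)
      assume "q \<noteq> q'"
      moreover have "den q = 0" "den q' = 0" using that by (auto simp: Q'_def)
      then have "h22 * (fst q * snd q' - snd q * fst q') = 0" unfolding den_def by algebra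
      ultimately show False using indep[of q q'] h22 that by auto
    qed
    then show ?thesis using Q(1) by (auto simp: card_le_Suc0_iff_eq)
  qed
  then have "15 < card Q'"
    using card_Diff_subset[of Q' Q] Q by (auto simp: Q'_def)
  moreover have inj: "inj_on slope Q'"
  proof (rule inj_onI, rule ccontr)
    fix q q' assume qq: "q \<in> Q'" "q' \<in> Q'" "slope q = slope q'" "q \<noteq> q'"
    then have "fst q * snd q' = snd q * fst q'"
      using q_eq[of q] q_eq[of q'] by (simp add: Q'_def)
    then show False using indep[of q q'] qq by (auto simp: Q'_def)
  qed
  ultimately have X: "finite (slope ` Q')" "15 < card (slope ` Q')"
    using Q(1) by (auto simp: card_image Q'_def)
  have "\<exists>l1 l2. a0 = l1 * h11 \<and> a1 = l2 * h11 + 2 * l1 * h12 \<and> a2 = l1 * h22 + 2 * l2 * h12 \<and> a3 = l2 * h22"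
  proof (rule cubic_divisible_of_slopes[OF Dp X])
    fix x e ff N a b g d e0 e1 e2 p
    assume x: "x \<in> slope ` Q'"
      and defs: "e = - (h12 + h22 * x)" "ff = h11 + h12 * x"
        "N = (h11 + 2 * h12 * x + h22 * x^2) / 2"
        "a = a0 + a1 * x + a2 * x^2 + a3 * x^3"
        "b = e * (3 * a0 + 2 * a1 * x + a2 * x^2) + ff * (a1 + 2 * a2 * x + 3 * a3 * x^2)"
        "g = e^2 * (3 * a0 + a1 * x) + e * ff * (2 * a1 + 2 * a2 * x) + ff^2 * (a2 + 3 * a3 * x)"
        "d = a0 * e^3 + a1 * e^2 * ff + a2 * e * ff^2 + a3 * ff^3"
        "e0 = b0 + b1 * x + b2 * x^2 + b3 * x^3 + b4 * x^4"
        "e1 = e * (4 * b0 + 3 * b1 * x + 2 * b2 * x^2 + b3 * x^3) + ff * (b1 + 2 * b2 * x + 3 * b3 * x^2 + 4 * b4 * x^3)"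
        "e2 = e^2 * (6 * b0 + 3 * b1 * x + b2 * x^2) + e * ff * (3 * b1 + 4 * b2 * x + 3 * b3 * x^2)
            + ff^2 * (b2 + 3 * b3 * x + 6 * b4 * x^2)"
        "p = e * (5 * c0 + 4 * c1 * x + 3 * c2 * x^2 + 2 * c3 * x^3 + c4 * x^4)
            + ff * (c1 + 2 * c2 * x + 3 * c3 * x^2 + 4 * c4 * x^3 + 5 * c5 * x^4)"
    from x obtain q where q: "q \<in> Q" "den q \<noteq> 0" "x = slope q" by (auto simp: Q'_def)
    have lam: "lam q \<noteq> 0" using q Dp by (simp add: lam_def)
    have qe: "fst q = lam q * e" "snd q = lam q * ff" using q_eq[OF q(2)] unfolding defs(1,2) q(3) by simp_all
    obtain l m k where nz: "(l, m, k) \<noteq> (0, 0, 0)" and fl: "\<forall>x\<in>V.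
      f x + pd f 1 0 x * (fst y + fst q - fst x) + pd f 0 1 x * (snd y + snd q - snd x)
        = f y + pd f 1 0 y * fst q + pd f 0 1 y * snd q
      \<longrightarrow> l * (fst x - fst y) + m * (snd x - snd y) + k * (f x - f y) = 0"
      using flat[OF q(1)] by blast
    \<comment> \<open>The plane is rewritten in terms of the height over the tangent plane, which
      adds multiples of \<open>k\<close> to the two horizontal coefficients.\<close>
    have nz': "(l + k * pd f 1 0 y, m + k * pd f 0 1 y, k) \<noteq> (0, 0, 0)" using nz by auto
    show "\<exists>\<mu> c. \<mu> * N = 2 * N * (h11 * h22 - h12^2) * (c * N) + b \<and>
       - 2 * \<mu> * a + 2 * N * (h11 * h22 - h12^2) * (c * a) + e1 + 2 * g * (c * N) = 0 \<and>
       - \<mu> * (N * (h11 * h22 - h12^2) * (c * N)^2 + 2 * b * (c * N) + 3 * e0)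
        + 2 * N * (h11 * h22 - h12^2) * (c * (N * (h11 * h22 - h12^2) * (c * N)^2 + b * (c * N) + e0))
        + 2 * g * (c * a) + 3 * d * (c * N)^2 + 2 * e2 * (c * N) + p = 0"
    proof (rule shadow_curve_relations[OF refl Dp r(1) lam defs cont low mid high nz'])
      fix v w assume vw: "(v, w) \<in> ball 0 r"
        and 0: "\<phi> (v, w) + \<phi>1 (v, w) * (lam q * e - v) + \<phi>2 (v, w) * (lam q * ff - w) = 0"
      have "f (y + (v,w)) + pd f 1 0 (y + (v,w)) * (fst y + fst q - fst (y + (v,w)))
         + pd f 0 1 (y + (v,w)) * (snd y + snd q - snd (y + (v,w))) = f y + pd f 1 0 y * fst q + pd f 0 1 y * snd q"
        using 0 unfolding qe \<phi>_def \<phi>1_def \<phi>2_def fst_add snd_add fst_conv snd_conv by algebra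
      then have "l * v + m * w + k * (f (y + (v,w)) - f y) = 0"
        using fl inV[OF vw] by fastforce
      then show "(l + k * pd f 1 0 y) * v + (m + k * pd f 0 1 y) * w + k * \<phi> (v, w) = 0"
        unfolding \<phi>_def fst_conv snd_conv by algebra
    qed
  qed
  then obtain l1 l2 where l: "a0 = l1 * h11" "a1 = l2 * h11 + 2 * l1 * h12" "a2 = l1 * h22 + 2 * l2 * h12" "a3 = l2 * h22"
    by blast
  \<comment> \<open>The factor 2 comes from the coefficients 1/6 and 1/2 of the cubic Taylor part
    against the factors 3 and 1 in the claim.\<close>
  show ?thesis
    using l unfolding cd by (intro exI[of _ "2 * l1"] exI[of _ "2 * l2"]) (simp add: field_simps)
qed

section \<open>Graph charts\<close>

definition frame :: "real ^ 3 \<Rightarrow> real ^ 3 \<Rightarrow> real ^ 3 \<Rightarrow> bool" where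
  "frame b1 b2 b3 \<longleftrightarrow> norm b1 = 1 \<and> norm b2 = 1 \<and> norm b3 = 1 \<and>
    b1 \<bullet> b2 = 0 \<and> b1 \<bullet> b3 = 0 \<and> b2 \<bullet> b3 = 0 \<and>
    (\<forall>x. x = (x \<bullet> b1) *\<^sub>R b1 + (x \<bullet> b2) *\<^sub>R b2 + (x \<bullet> b3) *\<^sub>R b3)"

definition graph_map :: "real ^ 3 \<Rightarrow> real ^ 3 \<Rightarrow> real ^ 3 \<Rightarrow> (real \<times> real \<Rightarrow> real) \<Rightarrow> real \<times> real \<Rightarrow> real ^ 3" where
  "graph_map b1 b2 b3 f y = fst y *\<^sub>R b1 + snd y *\<^sub>R b2 + f y *\<^sub>R b3"

text \<open>The last two clauses together make \<open>S \<inter> W\<close> exactly the graph over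
  \<open>V\<close>. The second of them turns a statement about all points over an open part of
  \<open>V\<close> into one about a neighbourhood in \<open>S\<close>.\<close>

definition graph_chart where
  "graph_chart S b1 b2 b3 f V W \<longleftrightarrow> frame b1 b2 b3 \<and> open V \<and> convex V \<and> open W \<and> Ck_on 5 V f \<and>
    (\<forall>y\<in>V. graph_map b1 b2 b3 f y \<in> S \<inter> W) \<and>
    (\<forall>x\<in>S \<inter> W. (x \<bullet> b1, x \<bullet> b2) \<in> V \<and> x = graph_map b1 b2 b3 f (x \<bullet> b1, x \<bullet> b2))"

text \<open>Frames of coordinate vectors suffice: a nonzero differential is nonzero on some
  coordinate vector, and that vector becomes the vertical direction.\<close>

lemma frame_axis:
  fixes k :: 3
  obtains b1 b2 where "frame b1 b2 (axis k 1)"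
proof -
  have "frame (axis 2 1) (axis 3 1) (axis 1 1)" "frame (axis 1 1) (axis 3 1) (axis 2 1)" "frame (axis 1 1) (axis 2 1) (axis 3 1)"
    unfolding frame_def by (simp_all add: inner_axis vec_eq_iff forall_3 inner_axis_axis) (simp_all add: axis_def)
  then show ?thesis using that exhaust_3[of k] by metis
qed

lemma frame_inner:
  assumes "frame b1 b2 b3"
  shows "b1 \<bullet> b1 = 1" "b2 \<bullet> b2 = 1" "b3 \<bullet> b3 = 1" "b1 \<bullet> b2 = 0" "b2 \<bullet> b1 = 0" "b1 \<bullet> b3 = 0" "b3 \<bullet> b1 = 0"
    "b2 \<bullet> b3 = 0" "b3 \<bullet> b2 = 0"
  using assms by (auto simp: frame_def norm_eq_1 inner_commute)

lemma frame_expand: "frame b1 b2 b3 \<Longrightarrow> (x \<bullet> b1) *\<^sub>R b1 + (x \<bullet> b2) *\<^sub>R b2 + (x \<bullet> b3) *\<^sub>R b3 = x"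
  by (metis frame_def)

lemma graph_map_inner:
  assumes "frame b1 b2 b3"
  shows "graph_map b1 b2 b3 f y \<bullet> b1 = fst y" "graph_map b1 b2 b3 f y \<bullet> b2 = snd y" "graph_map b1 b2 b3 f y \<bullet> b3 = f y"
  using frame_inner[OF assms] by (simp_all add: graph_map_def inner_add_left)

lemma abs_fst_le_norm: "\<bar>fst z\<bar> \<le> norm z" and abs_snd_le_norm: "\<bar>snd z\<bar> \<le> norm z" for z :: "real \<times> real"
  using norm_fst_le[of "fst z" "snd z"] norm_snd_le[of "snd z" "fst z"] by simp_all

lemma norm_graph_map_diff_le:
  assumes "frame b1 b2 b3"
  shows "norm (graph_map b1 b2 b3 f x - graph_map b1 b2 b3 g y) \<le> 2 * norm (x - y) + \<bar>f x - g y\<bar>"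
proof -
  have n: "norm b1 = 1" "norm b2 = 1" "norm b3 = 1" using assms by (auto simp: frame_def)
  have "graph_map b1 b2 b3 f x - graph_map b1 b2 b3 g y
     = fst (x - y) *\<^sub>R b1 + snd (x - y) *\<^sub>R b2 + (f x - g y) *\<^sub>R b3"
    by (simp add: graph_map_def algebra_simps)
  also have "norm \<dots> \<le> \<bar>fst (x - y)\<bar> + \<bar>snd (x - y)\<bar> + \<bar>f x - g y\<bar>"
    by (rule order.trans[OF norm_triangle_ineq add_mono[OF order.trans[OF norm_triangle_ineq]]]) (simp_all add: n)
  also have "\<dots> \<le> norm (x - y) + norm (x - y) + \<bar>f x - g y\<bar>"
    by (intro add_mono abs_fst_le_norm abs_snd_le_norm order_refl)
  finally show ?thesis by simp
qed

section \<open>Implicit functions and existence of graph charts\<close>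

lemma implicit_function_continuous:
  fixes G :: "'a::metric_space \<Rightarrow> real \<Rightarrow> real"
  assumes V: "open V" and ab: "a < b"
    and mono: "\<And>y z z'. \<lbrakk>y \<in> V; a \<le> z; z < z'; z' \<le> b\<rbrakk> \<Longrightarrow> G y z < G y z'"
    and cy: "\<And>z. \<lbrakk>a \<le> z; z \<le> b\<rbrakk> \<Longrightarrow> continuous_on V (\<lambda>y. G y z)"
    and cz: "\<And>y. y \<in> V \<Longrightarrow> continuous_on {a..b} (G y)"
    and sgn: "\<And>y. y \<in> V \<Longrightarrow> G y a < 0 \<and> 0 < G y b"
  obtains f where "continuous_on V f" "\<And>y. y \<in> V \<Longrightarrow> a < f y \<and> f y < b \<and> G y (f y) = 0"
    "\<And>y z. \<lbrakk>y \<in> V; a \<le> z; z \<le> b; G y z = 0\<rbrakk> \<Longrightarrow> z = f y"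
proof -
  have ex: "\<exists>z. a < z \<and> z < b \<and> G y z = 0" if y: "y \<in> V" for y
  proof -
    obtain z where "a \<le> z" "z \<le> b" "G y z = 0"
      using IVT'[of "G y" a 0 b] sgn[OF y] ab cz[OF y] by auto
    moreover have "z \<noteq> a" "z \<noteq> b" using \<open>G y z = 0\<close> sgn[OF y] by auto
    ultimately show ?thesis by (intro exI[of _ z]) auto
  qed
  define f where "f y = (SOME z. a < z \<and> z < b \<and> G y z = 0)" for y
  have f: "a < f y" "f y < b" "G y (f y) = 0" if "y \<in> V" for y
    using someI_ex[OF ex[OF that]] by (simp_all add: f_def)
  have uniq: "z = f y" if "y \<in> V" "a \<le> z" "z \<le> b" "G y z = 0" for y z
    using mono[of y z "f y"] mono[of y "f y" z] f[of y] that by (cases z "f y" rule: linorder_cases) auto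
  have "isCont f x" if x: "x \<in> V" for x
    unfolding continuous_at_eps_delta
  proof (intro allI impI)
    fix e :: real assume e: "e > 0"
    \<comment> \<open>By monotonicity \<open>G\<close> is negative at \<open>l\<close> and positive
      at \<open>u\<close> over \<open>x\<close>. Both signs persist for nearby parameters and trap
      the zero between \<open>l\<close> and \<open>u\<close>.\<close>
    define l u where "l = max a (f x - e / 2)" and "u = min b (f x + e / 2)"
    have lu: "a \<le> l" "l < f x" "f x < u" "u \<le> b" "f x - e < l" "u < f x + e"
      using f[OF x] e by (auto simp: l_def u_def)
    have "G x l < 0" "0 < G x u" using mono[OF x, of l "f x"] mono[OF x, of "f x" u] f[OF x] lu by auto
    moreover have "isCont (\<lambda>y. G y l) x" "isCont (\<lambda>y. G y u) x"
      using cy[of l] cy[of u] lu V x by (auto simp: continuous_on_eq_continuous_at)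
    ultimately have "eventually (\<lambda>y. G y l < 0) (at x)" "eventually (\<lambda>y. 0 < G y u) (at x)"
      by (auto simp: isCont_def dest: order_tendstoD)
    then have "eventually (\<lambda>y. y \<noteq> x \<longrightarrow> G y l < 0 \<and> 0 < G y u \<and> y \<in> V) (nhds x)"
      using eventually_nhds_in_open[OF V x] unfolding eventually_at_filter by eventually_elim simp
    then obtain d where d: "d > 0" "\<forall>y. dist y x < d \<longrightarrow> y \<noteq> x \<longrightarrow> G y l < 0 \<and> 0 < G y u \<and> y \<in> V"
      unfolding eventually_nhds_metric by blast
    have "dist (f y) (f x) < e" if "dist y x < d" for y
    proof (cases "y = x")
      case False
      then have y: "G y l < 0" "0 < G y u" "y \<in> V" using d(2) that by auto
      have "l < f y"
      proof (rule ccontr)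
        assume "\<not> l < f y"
        then have "G y (f y) \<le> G y l" using mono[OF y(3), of "f y" l] f[OF y(3)] lu by (cases "f y = l") auto
        then show False using y f[OF y(3)] by simp
      qed
      moreover have "f y < u"
      proof (rule ccontr)
        assume "\<not> f y < u"
        then have "G y u \<le> G y (f y)" using mono[OF y(3), of u "f y"] f[OF y(3)] lu by (cases "f y = u") auto
        then show False using y f[OF y(3)] by simp
      qed
      ultimately show ?thesis using lu by (auto simp: dist_real_def)
    qed (use e in simp)
    then show "\<exists>d>0. \<forall>y. dist y x < d \<longrightarrow> dist (f y) (f x) < e" using d(1) by blast
  qed
  then have "continuous_on V f" by (simp add: continuous_at_imp_continuous_on)
  then show ?thesis using that[of f] f uniq by blast
qed

text \<open>Upgrades continuity of the implicit function to differentiability. Linearizing F = 0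
  bounds the error of the expected linear approximation of \<open>f\<close> by a small multiple of
  the increment of \<open>f\<close>, which itself contains that error; the small factor allows it to
  be absorbed.\<close>

lemma implicit_graph_partials:
  assumes fr: "frame b1 b2 b3" and V: "open V" "y \<in> V" and f: "continuous_on V f"
    and F: "(F has_derivative L) (at (graph_map b1 b2 b3 f y))" and L: "L b3 \<noteq> 0"
    and Fzero: "\<And>x. x \<in> V \<Longrightarrow> F (graph_map b1 b2 b3 f x) = (0::real)"
  shows "has_partials f (- L b1 / L b3) (- L b2 / L b3) y"
  unfolding has_partials_def has_derivative_at_alt
proof (intro conjI allI impI)
  show "bounded_linear (\<lambda>v. fst v * (- L b1 / L b3) + snd v * (- L b2 / L b3))"
    by (intro bounded_linear_add bounded_linear_mult_left[THEN bounded_linear_compose] bounded_linear_fst bounded_linear_snd)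
  fix e :: real assume e: "e > 0"
  let ?\<psi> = "graph_map b1 b2 b3 f"
  define k where "k = \<bar>L b3\<bar>"
  have k: "k > 0" using L by (simp add: k_def)
  define C where "C = (\<bar>L b1\<bar> + \<bar>L b2\<bar>) / k"
  have C: "C \<ge> 0" using k by (simp add: C_def)
  \<comment> \<open>The bound 1/2 permits the absorption and gives |f x - f y| <= (2 C + 2) |x - y|.
    Another 2 |x - y| comes from the horizontal part, whence 2 C + 4.\<close>
  define \<epsilon> where "\<epsilon> = min (1/2) (e / (2 * C + 4))"
  have "2 * C + 4 > 0" using C by simp
  moreover have "\<epsilon> \<le> e / (2 * C + 4)" "\<epsilon> \<le> 1/2" unfolding \<epsilon>_def by (rule min.cobounded2 min.cobounded1)+
  ultimately have \<epsilon>: "\<epsilon> > 0" "\<epsilon> \<le> 1/2" "\<epsilon> * (2 * C + 4) \<le> e"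
    using e by (simp add: \<epsilon>_def, simp, simp add: pos_le_divide_eq)
  obtain d where d: "d > 0" and dF: "\<forall>X. norm (X - ?\<psi> y) < d \<longrightarrow> norm (F X - F (?\<psi> y) - L (X - ?\<psi> y)) \<le> (k * \<epsilon>) * norm (X - ?\<psi> y)"
    using F k \<epsilon>(1) unfolding has_derivative_at_alt by (meson mult_pos_pos)
  have "isCont f y" using f V by (simp add: continuous_on_eq_continuous_at)
  then have "isCont ?\<psi> y" unfolding graph_map_def[abs_def] by (intro continuous_intros)
  then obtain d1 where d1: "d1 > 0" "\<forall>x. dist x y < d1 \<longrightarrow> dist (?\<psi> x) (?\<psi> y) < d"
    using d unfolding continuous_at_eps_delta by blast
  obtain d2 where d2: "d2 > 0" "ball y d2 \<subseteq> V" using V openE by blast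
  have main: "norm (f x - f y - (fst (x - y) * (- L b1 / L b3) + snd (x - y) * (- L b2 / L b3))) \<le> e * norm (x - y)"
    if x: "norm (x - y) < min d1 d2" for x
  proof -
    interpret bounded_linear L using F by (rule has_derivative_bounded_linear)
    let ?n = "norm (x - y)"
    have "x \<in> ball y d2" using x by (simp add: dist_norm norm_minus_commute)
    then have xV: "x \<in> V" using d2 by blast
    have "norm (?\<psi> x - ?\<psi> y) < d" using d1(2)[rule_format, of x] x by (simp add: dist_norm)
    from dF[rule_format, OF this] have "\<bar>L (?\<psi> x - ?\<psi> y)\<bar> \<le> (k * \<epsilon>) * norm (?\<psi> x - ?\<psi> y)"
      using Fzero[OF xV] Fzero[OF V(2)] by simp
    also have "\<dots> \<le> (k * \<epsilon>) * (2 * ?n + \<bar>f x - f y\<bar>)"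
      using norm_graph_map_diff_le[OF fr] k \<epsilon>(1) by (intro mult_left_mono) auto
    finally have 1: "\<bar>L (?\<psi> x - ?\<psi> y)\<bar> \<le> k * (\<epsilon> * (2 * ?n + \<bar>f x - f y\<bar>))" by (simp add: mult.assoc)
    define E where "E = f x - f y - (fst (x - y) * (- L b1 / L b3) + snd (x - y) * (- L b2 / L b3))"
    have "?\<psi> x - ?\<psi> y = fst (x - y) *\<^sub>R b1 + snd (x - y) *\<^sub>R b2 + (f x - f y) *\<^sub>R b3"
      by (simp add: graph_map_def algebra_simps)
    then have "L (?\<psi> x - ?\<psi> y) = fst (x - y) * L b1 + snd (x - y) * L b2 + (f x - f y) * L b3"
      by (simp add: add scaleR)
    also have "\<dots> = L b3 * E" using L by (simp add: E_def field_simps)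
    finally have "\<bar>L (?\<psi> x - ?\<psi> y)\<bar> = k * \<bar>E\<bar>" by (simp add: k_def abs_mult)
    with 1 have E: "\<bar>E\<bar> \<le> \<epsilon> * (2 * ?n + \<bar>f x - f y\<bar>)" using k by simp
    have xy: "\<bar>fst (x - y)\<bar> \<le> ?n" "\<bar>snd (x - y)\<bar> \<le> ?n"
      by (rule abs_fst_le_norm abs_snd_le_norm)+
    have "\<bar>fst (x - y) * (- L b1 / L b3) + snd (x - y) * (- L b2 / L b3)\<bar>
       \<le> \<bar>fst (x - y) * (- L b1 / L b3)\<bar> + \<bar>snd (x - y) * (- L b2 / L b3)\<bar>" by (rule abs_triangle_ineq)
    also have "\<dots> = \<bar>fst (x - y)\<bar> * (\<bar>L b1\<bar> / k) + \<bar>snd (x - y)\<bar> * (\<bar>L b2\<bar> / k)"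
      by (simp only: abs_mult abs_divide abs_minus k_def)
    also have "\<dots> \<le> ?n * (\<bar>L b1\<bar> / k) + ?n * (\<bar>L b2\<bar> / k)"
      using xy k by (intro add_mono mult_right_mono) auto
    also have "\<dots> = C * ?n" by (simp add: C_def add_divide_distrib algebra_simps)
    finally have "\<bar>f x - f y\<bar> \<le> C * ?n + \<bar>E\<bar>" unfolding E_def by linarith
    also have "\<dots> \<le> C * ?n + \<epsilon> * (2 * ?n + \<bar>f x - f y\<bar>)" using E by simp
    also have "\<dots> \<le> C * ?n + (1/2) * (2 * ?n + \<bar>f x - f y\<bar>)" using \<epsilon>(2) by (intro add_left_mono mult_right_mono) auto
    finally have "\<bar>f x - f y\<bar> \<le> (2 * C + 2) * ?n" by (simp add: algebra_simps)
    then have "\<epsilon> * (2 * ?n + \<bar>f x - f y\<bar>) \<le> \<epsilon> * ((2 * C + 4) * ?n)" using \<epsilon>(1) by (intro mult_left_mono) (auto simp: algebra_simps)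
    also have "\<dots> \<le> e * ?n" using mult_right_mono[OF \<epsilon>(3), of ?n] by (simp add: mult.assoc)
    finally show ?thesis using E by (simp add: E_def)
  qed
  show "\<exists>d>0. \<forall>x. norm (x - y) < d \<longrightarrow>
      norm (f x - f y - (fst (x - y) * (- L b1 / L b3) + snd (x - y) * (- L b2 / L b3))) \<le> e * norm (x - y)"
    by (rule exI[of _ "min d1 d2"]) (use d1(1) d2(1) main in \<open>simp del: split_paired_All\<close>)
qed

lemma Ck_on_graph_map:
  assumes "open V" "Ck_on k V f" shows "Ck_on k V (\<lambda>y. graph_map b1 b2 b3 f y \<bullet> i)"
  unfolding graph_map_def inner_add_left inner_scaleR_left
  by (intro Ck_on_add Ck_on_mult Ck_on_const Ck_on_linear assms bounded_linear_fst bounded_linear_snd)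

lemma graph_chart_exists:
  assumes S: "Ck_hypersurface 5 S" and p: "p \<in> S"
  obtains b1 b2 b3 f V W where "graph_chart S b1 b2 b3 f V W" "p \<in> W"
proof -
  obtain U F0 where U: "open U" "p \<in> U" and F0: "Ck_on 5 U F0"
    and dF0: "\<forall>x\<in>U. frechet_derivative F0 (at x) \<noteq> (\<lambda>v. 0)" and SU: "S \<inter> U = {x \<in> U. F0 x = 0}"
    using S p unfolding Ck_hypersurface_def by blast
  have F05: "Ck_on (Suc 4) U F0" using F0 by (simp add: eval_nat_numeral)
  have "linear (frechet_derivative F0 (at p))" using Ck_on_SucD(1)[OF F05 U(2)] by (rule has_derivative_linear)
  then obtain i where i: "i \<in> Basis" "frechet_derivative F0 (at p) i \<noteq> 0"
    using linear_eq_stdbasis[of "frechet_derivative F0 (at p)" "\<lambda>v. 0"] dF0 U(2) by (auto simp: linear_zero)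
  then obtain k :: 3 where "i = axis k 1" by (auto simp: Basis_vec_def)
  then obtain b1 b2 b3 where fr: "frame b1 b2 b3" and b3: "frechet_derivative F0 (at p) b3 \<noteq> 0"
    using frame_axis i by metis
  \<comment> \<open>Normalizes the sign so that the defining function increases in the direction
    \<open>b3\<close>.\<close>
  define \<sigma> where "\<sigma> = sgn (frechet_derivative F0 (at p) b3)"
  have \<sigma>: "\<sigma> \<noteq> 0" using b3 by (simp add: \<sigma>_def sgn_eq_0_iff)
  define F where "F x = \<sigma> * F0 x" for x
  have F5: "Ck_on (Suc 4) U F" unfolding F_def by (intro Ck_on_cmult U F05)
  define dF where "dF x = frechet_derivative F (at x)" for x
  have dF: "(F has_derivative dF x) (at x)" if "x \<in> U" for x
    using Ck_on_SucD(1)[OF F5 that] by (simp add: dF_def)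
  have C4: "Ck_on 4 U (\<lambda>x. dF x v)" for v using Ck_on_SucD(2)[OF F5] by (simp add: dF_def)
  have "(F has_derivative (\<lambda>v. \<sigma> * frechet_derivative F0 (at p) v)) (at p)"
    unfolding F_def using Ck_on_SucD(1)[OF F05 U(2)] by (rule has_derivative_mult_right)
  from frechet_derivative_at[OF this] have "dF p b3 = \<sigma> * frechet_derivative F0 (at p) b3"
    unfolding dF_def by (auto dest: fun_cong[of _ _ b3])
  then have pos: "dF p b3 > 0" using b3 by (simp add: \<sigma>_def sgn_if)
  have "isCont (\<lambda>x. dF x b3) p" using Ck_on_continuous[OF C4] U by (simp add: continuous_on_eq_continuous_at)
  then have "eventually (\<lambda>x. dF x b3 > 0) (nhds p)"
    using pos by (simp add: continuous_at eventually_nhds_conv_at order_tendstoD(1) isCont_def)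
  moreover have "eventually (\<lambda>x. x \<in> U) (nhds p)" by (rule eventually_nhds_in_open[OF U])
  ultimately have "eventually (\<lambda>x. dF x b3 > 0 \<and> x \<in> U) (nhds p)" by eventually_elim simp
  then obtain \<epsilon> where \<epsilon>: "\<epsilon> > 0" "\<And>x. dist x p < \<epsilon> \<Longrightarrow> dF x b3 > 0 \<and> x \<in> U"
    unfolding eventually_nhds_metric by blast
  define y0 z0 where "y0 = (p \<bullet> b1, p \<bullet> b2)" and "z0 = p \<bullet> b3"
  define \<Phi> where "\<Phi> y z = graph_map b1 b2 b3 (\<lambda>_. z) y" for y z
  have p\<Phi>: "p = \<Phi> y0 z0" using frame_expand[OF fr, of p] by (simp add: \<Phi>_def graph_map_def y0_def z0_def)
  \<comment> \<open>Horizontal distance counts twice and vertical distance once in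
    \<open>norm_graph_map_diff_le\<close>, so a quarter of \<open>\<epsilon>\<close> keeps the whole
    cylinder inside the ball.\<close>
  define \<eta> where "\<eta> = \<epsilon> / 4"
  have \<eta>: "\<eta> > 0" using \<epsilon> by (simp add: \<eta>_def)
  have near: "dist (\<Phi> y z) p < \<epsilon>" if "dist y y0 < \<eta>" "\<bar>z - z0\<bar> \<le> \<eta>" for y z
    using norm_graph_map_diff_le[OF fr, of "\<lambda>_. z" y "\<lambda>_. z0" y0] that \<epsilon>(1)
    unfolding p\<Phi> \<Phi>_def \<eta>_def by (simp add: dist_norm)
  define G where "G y z = F (\<Phi> y z)" for y z
  have contF: "continuous_on U F" using Ck_on_continuous[OF F5] .
  have Gz: "(G y has_real_derivative dF (\<Phi> y z) b3) (at z)" if "dist y y0 < \<eta>" "\<bar>z - z0\<bar> \<le> \<eta>" for y z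
  proof -
    have u: "\<Phi> y z \<in> U" using \<epsilon>(2)[OF near[OF that]] by simp
    have "((\<lambda>z. \<Phi> y z) has_derivative (\<lambda>h. h *\<^sub>R b3)) (at z)"
      unfolding \<Phi>_def graph_map_def by (auto intro!: derivative_eq_intros)
    from has_derivative_compose[OF this dF[OF u]] show ?thesis
      using linear_scale[OF has_derivative_linear[OF dF[OF u]]]
      unfolding G_def has_field_derivative_def by (simp add: mult_commute_abs)
  qed
  have mono: "G y z < G y z'" if y: "dist y y0 < \<eta>" and z: "z0 - \<eta> \<le> z" "z < z'" "z' \<le> z0 + \<eta>" for y z z'
  proof (rule DERIV_pos_imp_increasing[OF z(2)])
    fix x assume "z \<le> x" "x \<le> z'"
    then have "\<bar>x - z0\<bar> \<le> \<eta>" using z by auto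
    then show "\<exists>l. (G y has_real_derivative l) (at x) \<and> l > 0" using Gz[OF y] \<epsilon>(2)[OF near[OF y]] by blast
  qed
  have cy: "continuous_on (ball y0 \<eta>) (\<lambda>y. G y z)" if "\<bar>z - z0\<bar> \<le> \<eta>" for z
    unfolding G_def
  proof (rule continuous_on_compose2[OF contF])
    show "continuous_on (ball y0 \<eta>) (\<lambda>y. \<Phi> y z)" unfolding \<Phi>_def graph_map_def by (intro continuous_intros)
    show "(\<lambda>y. \<Phi> y z) ` ball y0 \<eta> \<subseteq> U" using \<epsilon>(2)[OF near[OF _ that]] by (metis dist_commute image_subsetI mem_ball)
  qed
  have cz: "continuous_on {z0 - \<eta>..z0 + \<eta>} (G y)" if "dist y y0 < \<eta>" for y
  proof (rule continuous_at_imp_continuous_on, rule ballI)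
    fix z assume "z \<in> {z0 - \<eta>..z0 + \<eta>}"
    then have "\<bar>z - z0\<bar> \<le> \<eta>" by auto
    from Gz[OF that this] show "isCont (G y) z" by (rule DERIV_isCont)
  qed
  have "F p = 0" using SU p U by (auto simp: F_def)
  then have G0: "G y0 z0 = 0" by (simp add: G_def p\<Phi>[symmetric])
  have "G y0 (z0 - \<eta>) < 0" "0 < G y0 (z0 + \<eta>)"
    using mono[of y0 "z0 - \<eta>" z0] mono[of y0 z0 "z0 + \<eta>"] \<eta> G0 by auto
  moreover have "isCont (\<lambda>y. G y (z0 - \<eta>)) y0" "isCont (\<lambda>y. G y (z0 + \<eta>)) y0"
    using cy[of "z0 - \<eta>"] cy[of "z0 + \<eta>"] \<eta> by (auto simp: continuous_on_eq_continuous_at)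
  ultimately have "eventually (\<lambda>y. G y (z0 - \<eta>) < 0) (nhds y0)" "eventually (\<lambda>y. 0 < G y (z0 + \<eta>)) (nhds y0)"
    by (auto simp: continuous_at eventually_nhds_conv_at isCont_def dest: order_tendstoD)
  then have "eventually (\<lambda>y. G y (z0 - \<eta>) < 0 \<and> 0 < G y (z0 + \<eta>)) (nhds y0)" by eventually_elim simp
  then obtain d where d: "d > 0" "\<And>y. dist y y0 < d \<Longrightarrow> G y (z0 - \<eta>) < 0 \<and> 0 < G y (z0 + \<eta>)"
    unfolding eventually_nhds_metric by blast
  define V where "V = ball y0 (min d \<eta>)"
  have Vd: "dist y y0 < d" "dist y y0 < \<eta>" if "y \<in> V" for y using that by (auto simp: V_def dist_commute)
  have V: "open V" "convex V" "y0 \<in> V" using d(1) \<eta> by (simp_all add: V_def)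
  obtain f where f: "continuous_on V f" "\<And>y. y \<in> V \<Longrightarrow> z0 - \<eta> < f y \<and> f y < z0 + \<eta> \<and> G y (f y) = 0"
    and uniq: "\<And>y z. \<lbrakk>y \<in> V; z0 - \<eta> \<le> z; z \<le> z0 + \<eta>; G y z = 0\<rbrakk> \<Longrightarrow> z = f y"
  proof (rule implicit_function_continuous[OF V(1), of "z0 - \<eta>" "z0 + \<eta>" G])
    show "z0 - \<eta> < z0 + \<eta>" using \<eta> by simp
    show "G y z < G y z'" if "y \<in> V" "z0 - \<eta> \<le> z" "z < z'" "z' \<le> z0 + \<eta>" for y z z'
      using mono Vd that by blast
    show "continuous_on V (\<lambda>y. G y z)" if "z0 - \<eta> \<le> z" "z \<le> z0 + \<eta>" for z
      by (rule continuous_on_subset[OF cy]) (use that in \<open>auto simp: V_def\<close>)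
    show "continuous_on {z0 - \<eta>..z0 + \<eta>} (G y)" if "y \<in> V" for y using cz Vd that by blast
    show "G y (z0 - \<eta>) < 0 \<and> 0 < G y (z0 + \<eta>)" if "y \<in> V" for y using d(2) Vd that by blast
  qed blast
  let ?\<psi> = "graph_map b1 b2 b3 f"
  have \<psi>\<Phi>: "?\<psi> y = \<Phi> y (f y)" for y by (simp add: \<Phi>_def graph_map_def)
  have \<psi>near: "dist (?\<psi> y) p < \<epsilon>" if "y \<in> V" for y
    unfolding \<psi>\<Phi> using near[OF Vd(2)[OF that], of "f y"] f(2)[OF that] by force
  have \<psi>U: "?\<psi> y \<in> U" "dF (?\<psi> y) b3 \<noteq> 0" "F (?\<psi> y) = 0" if "y \<in> V" for y
    using \<epsilon>(2)[OF \<psi>near[OF that]] f(2)[OF that] by (auto simp: G_def \<psi>\<Phi>)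
  have part: "has_partials f (- dF (?\<psi> y) b1 / dF (?\<psi> y) b3) (- dF (?\<psi> y) b2 / dF (?\<psi> y) b3) y" if "y \<in> V" for y
    by (rule implicit_graph_partials[OF fr V(1) that f(1) dF[OF \<psi>U(1)[OF that]] \<psi>U(2)[OF that] \<psi>U(3)])
  \<comment> \<open>The partial derivatives of \<open>f\<close> are quotients of derivatives of
    \<open>F\<close> composed with the graph of \<open>f\<close>, so their order is that of
    \<open>f\<close>, as long as it does not exceed the order 4 of the derivatives of
    \<open>F\<close>.\<close>
  have step: "Ck_on (Suc j) V f" if "Ck_on j V f" "j \<le> 4" for j
  proof (rule Ck_partialsI[OF V(1) part])
    have c: "Ck_on j V (\<lambda>y. dF (?\<psi> y) v)" for v
      by (rule Ck_on_compose[OF U(1) V(1), where G = "\<lambda>x. dF x v"])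
        (use \<psi>U(1) Ck_on_graph_map[OF V(1) that(1)] Ck_on_le[OF C4 that(2)] in auto)
    have "Ck_on j V (\<lambda>y. - dF (?\<psi> y) v / dF (?\<psi> y) b3)" for v
      by (intro Ck_on_divide[OF V(1)] Ck_on_minus[OF V(1)] c \<psi>U(2))
    then show "Ck_on j V (\<lambda>y. - dF (?\<psi> y) b1 / dF (?\<psi> y) b3)" "Ck_on j V (\<lambda>y. - dF (?\<psi> y) b2 / dF (?\<psi> y) b3)"
      by blast+
  qed
  have "Ck_on j V f" if "j \<le> 5" for j using that
  proof (induction j)
    case 0
    then show ?case using f(1) by simp
  next
    case (Suc j)
    then show ?case by (intro step) auto
  qed
  then have f5: "Ck_on 5 V f" by simp
  \<comment> \<open>The vertical bounds belong to \<open>W\<close> because uniqueness of the zero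
    over a point of \<open>V\<close> is known only inside this strip.\<close>
  define W where "W = {x. (x \<bullet> b1, x \<bullet> b2) \<in> V} \<inter> {x. z0 - \<eta> < x \<bullet> b3} \<inter> {x. x \<bullet> b3 < z0 + \<eta>}"
  have "open W" unfolding W_def
  proof (intro open_Int)
    have "open ((\<lambda>x. (x \<bullet> b1, x \<bullet> b2)) -` V)" by (rule open_vimage[OF V(1)]) (intro continuous_intros)
    then show "open {x. (x \<bullet> b1, x \<bullet> b2) \<in> V}" by (simp add: vimage_def)
    show "open {x. z0 - \<eta> < x \<bullet> b3}" "open {x. x \<bullet> b3 < z0 + \<eta>}" by (intro open_Collect_less continuous_intros)+
  qed
  have inS: "?\<psi> y \<in> S \<inter> W" if "y \<in> V" for y
  proof -
    have "?\<psi> y \<in> S" using \<psi>U[OF that] SU \<sigma> by (auto simp: F_def)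
    then show ?thesis using that f(2)[OF that] by (simp add: W_def graph_map_inner[OF fr])
  qed
  have onV: "(x \<bullet> b1, x \<bullet> b2) \<in> V \<and> x = ?\<psi> (x \<bullet> b1, x \<bullet> b2)" if x: "x \<in> S \<inter> W" for x
  proof -
    let ?y = "(x \<bullet> b1, x \<bullet> b2)"
    have y: "?y \<in> V" and z: "z0 - \<eta> < x \<bullet> b3" "x \<bullet> b3 < z0 + \<eta>" using x by (auto simp: W_def)
    have x\<Phi>: "x = \<Phi> ?y (x \<bullet> b3)" using frame_expand[OF fr, of x] by (simp add: \<Phi>_def graph_map_def)
    have "dist x p < \<epsilon>" using near[OF Vd(2)[OF y], of "x \<bullet> b3"] z x\<Phi> by simp
    then have "x \<in> U" using \<epsilon>(2) by blast
    then have "F x = 0" using SU x by (auto simp: F_def)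
    then have "G ?y (x \<bullet> b3) = 0" using x\<Phi> by (simp add: G_def)
    then have "x \<bullet> b3 = f ?y" using uniq[OF y] z by simp
    then show ?thesis using y x\<Phi> by (simp add: \<psi>\<Phi>)
  qed
  have "graph_chart S b1 b2 b3 f V W"
    unfolding graph_chart_def using fr V \<open>open W\<close> f5 inS onV by blast
  moreover have "p \<in> W" using V(3) \<eta> by (simp add: W_def y0_def z0_def)
  ultimately show ?thesis using that by blast
qed

section \<open>Quadrics\<close>

definition quadratic :: "(real ^ 3 \<Rightarrow> real ^ 3 \<Rightarrow> real) \<Rightarrow> (real ^ 3 \<Rightarrow> real) \<Rightarrow> bool" where
  "quadratic B L \<longleftrightarrow> bilinear B \<and> (\<forall>x y. B x y = B y x) \<and> linear L"

definition quadric :: "(real ^ 3 \<Rightarrow> real ^ 3 \<Rightarrow> real) \<Rightarrow> (real ^ 3 \<Rightarrow> real) \<Rightarrow> real \<Rightarrow> real ^ 3 \<Rightarrow> real" where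
  "quadric B L c x = B x x + 2 * L x + c"

text \<open>Triviality of the kernel of the symmetric form that homogenizes the quadric.\<close>

definition nondegenerate_quadric :: "(real ^ 3 \<Rightarrow> real ^ 3 \<Rightarrow> real) \<Rightarrow> (real ^ 3 \<Rightarrow> real) \<Rightarrow> real \<Rightarrow> bool" where
  "nondegenerate_quadric B L c \<longleftrightarrow>
    (\<forall>k k0. (\<forall>x. B k x + k0 * L x = 0) \<and> L k + k0 * c = 0 \<longrightarrow> k = 0 \<and> k0 = 0)"

lemma has_partials_zero_on:
  assumes "open V" "y \<in> V" "\<And>x. x \<in> V \<Longrightarrow> h x = 0" "has_partials h a b y"
  shows "a = 0" "b = 0"
  using has_partials_cong[OF assms(1,2), of h "\<lambda>_. 0" a b] assms(3,4)
    has_partials_unique[of "\<lambda>_. 0" a b y] has_partials_unique[OF has_partials_const[of 0 y]] by auto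

text \<open>Coordinates with respect to the two tangent vectors of a graph with slopes
  \<open>p\<close>, \<open>q\<close> and the vertical vector.\<close>

lemma frame_expand_sheared:
  assumes "frame b1 b2 b3"
  shows "x = (x \<bullet> b1) *\<^sub>R (b1 + p *\<^sub>R b3) + (x \<bullet> b2) *\<^sub>R (b2 + q *\<^sub>R b3)
    + (x \<bullet> b3 - (x \<bullet> b1) * p - (x \<bullet> b2) * q) *\<^sub>R b3"
proof -
  have "(x \<bullet> b1) *\<^sub>R (b1 + p *\<^sub>R b3) + (x \<bullet> b2) *\<^sub>R (b2 + q *\<^sub>R b3)
    + (x \<bullet> b3 - (x \<bullet> b1) * p - (x \<bullet> b2) * q) *\<^sub>R b3
    = (x \<bullet> b1) *\<^sub>R b1 + (x \<bullet> b2) *\<^sub>R b2 + (x \<bullet> b3) *\<^sub>R b3"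
    by (simp add: algebra_simps)
  then show ?thesis using frame_expand[OF assms, of x] by simp
qed

section \<open>Contact of a quadric with a graph\<close>

locale quadric_on_chart =
  fixes b1 b2 b3 :: "real ^ 3" and V and f :: "real \<times> real \<Rightarrow> real" and B L and c :: real
  assumes fr: "frame b1 b2 b3" and V: "open V" and f: "Ck_on 3 V f" and BL: "quadratic B L"
begin

abbreviation "\<psi> \<equiv> graph_map b1 b2 b3 f"
definition "u1 y = b1 + pd f 1 0 y *\<^sub>R b3"
definition "u2 y = b2 + pd f 0 1 y *\<^sub>R b3"
text \<open>Half the derivative of the quadric in the vertical direction at the graph point. The
  functions \<open>g1\<close>, \<open>g2\<close> are half the first, and \<open>k11\<close>,
  \<open>k12\<close>, \<open>k22\<close> half the second partial derivatives of the quadric pulled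
  back to \<open>V\<close>; \<open>u1\<close>, \<open>u2\<close> are the tangent vectors of the
  graph.\<close>

definition "n y = B (\<psi> y) b3 + L b3"
definition "g1 y = B (\<psi> y) (u1 y) + L (u1 y)"
definition "g2 y = B (\<psi> y) (u2 y) + L (u2 y)"
definition "k11 y = B (u1 y) (u1 y) + n y * pd f 2 0 y"
definition "k12 y = B (u1 y) (u2 y) + n y * pd f 1 1 y"
definition "k22 y = B (u2 y) (u2 y) + n y * pd f 0 2 y"

lemma lin: "B (x + x') z = B x z + B x' z" "B z (x + x') = B z x + B z x'"
  "B (r *\<^sub>R x) z = r * B x z" "B z (r *\<^sub>R x) = r * B z x" "L (x + x') = L x + L x'" "L (r *\<^sub>R x) = r * L x"
  using BL by (auto simp: quadratic_def bilinear_ladd bilinear_radd bilinear_lmul bilinear_rmul linear_add linear_scale)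

lemma Bsym: "B x y = B y x" using BL by (auto simp: quadratic_def)

lemma expand: "x = (x \<bullet> b1) *\<^sub>R u1 y + (x \<bullet> b2) *\<^sub>R u2 y
    + (x \<bullet> b3 - (x \<bullet> b1) * pd f 1 0 y - (x \<bullet> b2) * pd f 0 1 y) *\<^sub>R b3"
  unfolding u1_def u2_def by (rule frame_expand_sheared[OF fr])

lemma linear_eq_0:
  assumes "linear h" "h (u1 y) = 0" "h (u2 y) = 0" "h b3 = (0::real)"
  shows "h x = 0"
  by (subst expand[of x y]) (simp add: linear_add[OF assms(1)] linear_scale[OF assms(1)] assms(2-))

lemmas hpd = has_partials_pd[OF V Ck_on_le[OF f]]

lemma hf: "y \<in> V \<Longrightarrow> has_partials f (pd f 1 0 y) (pd f 0 1 y) y"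
  using hpd[of 0 0 y] by (simp add: pd_0)

lemma hdd: assumes "y \<in> V"
  shows "has_partials (pd f 1 0) (pd f 2 0 y) (pd f 1 1 y) y" "has_partials (pd f 0 1) (pd f 1 1 y) (pd f 0 2 y) y"
   "has_partials (pd f 2 0) (pd f 3 0 y) (pd f 2 1 y) y" "has_partials (pd f 1 1) (pd f 2 1 y) (pd f 1 2 y) y"
   "has_partials (pd f 0 2) (pd f 1 2 y) (pd f 0 3 y) y"
  using hpd[of 1 0 y] hpd[of 0 1 y] hpd[of 2 0 y] hpd[of 1 1 y] hpd[of 0 2 y] assms
  by (simp_all add: numeral_2_eq_2 numeral_3_eq_3)

lemma partials_quadric: "y \<in> V \<Longrightarrow> has_partials (\<lambda>y. quadric B L c (\<psi> y)) (2 * g1 y) (2 * g2 y) y"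
  unfolding quadric_def graph_map_def lin
  by (rule has_partials_eq, (rule has_partials_rules hf | assumption)+)
    (simp_all add: g1_def g2_def u1_def u2_def graph_map_def lin Bsym[of b2 b1] Bsym[of b3 b1] Bsym[of b3 b2] algebra_simps)

lemma partials_n: "y \<in> V \<Longrightarrow> has_partials n (B (u1 y) b3) (B (u2 y) b3) y"
  unfolding n_def[abs_def] graph_map_def lin
  by (rule has_partials_eq, (rule has_partials_rules hf | assumption)+)
    (simp_all add: u1_def u2_def lin algebra_simps)

lemma partials_g1: "y \<in> V \<Longrightarrow> has_partials g1 (k11 y) (k12 y) y"
  unfolding g1_def[abs_def] u1_def graph_map_def lin
  by (rule has_partials_eq, (rule has_partials_rules hf hdd | assumption)+)
    (simp_all add: k11_def k12_def n_def u1_def u2_def graph_map_def lin Bsym[of b2 b1] Bsym[of b3 b1] Bsym[of b3 b2] algebra_simps)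

lemma partials_g2: "y \<in> V \<Longrightarrow> has_partials g2 (k12 y) (k22 y) y"
  unfolding g2_def[abs_def] u2_def graph_map_def lin
  by (rule has_partials_eq, (rule has_partials_rules hf hdd | assumption)+)
    (simp_all add: k22_def k12_def n_def u1_def u2_def graph_map_def lin Bsym[of b2 b1] Bsym[of b3 b1] Bsym[of b3 b2] algebra_simps)

text \<open>Third derivatives of the pullback. At a point with n = 0 only the values of
  \<open>B\<close> on a tangent and the vertical vector survive in them, which is how they serve in
  \<open>quadric_trivial\<close>.\<close>

lemma partials_k11: "y \<in> V \<Longrightarrow> has_partials k11 (3 * B (u1 y) b3 * pd f 2 0 y + n y * pd f 3 0 y)
    (2 * B (u1 y) b3 * pd f 1 1 y + B (u2 y) b3 * pd f 2 0 y + n y * pd f 2 1 y) y"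
  unfolding k11_def[abs_def]
  by (simp only: u1_def lin, rule has_partials_eq, (rule has_partials_rules hf hdd partials_n | assumption)+)
    (simp_all add: u1_def u2_def lin Bsym[of b2 b1] Bsym[of b3 b1] Bsym[of b3 b2] algebra_simps)

lemma partials_k22: "y \<in> V \<Longrightarrow> has_partials k22 (2 * B (u2 y) b3 * pd f 1 1 y + B (u1 y) b3 * pd f 0 2 y + n y * pd f 1 2 y)
    (3 * B (u2 y) b3 * pd f 0 2 y + n y * pd f 0 3 y) y"
  unfolding k22_def[abs_def]
  by (simp only: u2_def lin, rule has_partials_eq, (rule has_partials_rules hf hdd partials_n | assumption)+)
    (simp_all add: u1_def u2_def lin Bsym[of b2 b1] Bsym[of b3 b1] Bsym[of b3 b2] algebra_simps)

lemma partials_k12: "y \<in> V \<Longrightarrow> \<exists>a b. has_partials k12 a b y"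
  unfolding k12_def[abs_def] u1_def u2_def lin
  by (intro exI) (rule has_partials_rules hf hdd partials_n | assumption)+

text \<open>The pullback vanishes to second order at \<open>y\<close>. In contrast to vanishing near
  \<open>y\<close> this is a closed condition, and it still ties \<open>B\<close> on tangent vectors
  to the Hessian: B(u_i, u_j) = - n f_ij.\<close>

definition contact :: "real \<times> real \<Rightarrow> bool" where
  "contact y \<longleftrightarrow> quadric B L c (\<psi> y) = 0 \<and> g1 y = 0 \<and> g2 y = 0 \<and> k11 y = 0 \<and> k12 y = 0 \<and> k22 y = 0"

lemma contact_on:
  assumes U: "open U" "U \<subseteq> V" and Q: "\<And>y. y \<in> U \<Longrightarrow> quadric B L c (\<psi> y) = 0" and y: "y \<in> U"
  shows "contact y"
proof -
  have yV: "y \<in> V" if "y \<in> U" for y using that U by blast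
  have g: "g1 y = 0" "g2 y = 0" if "y \<in> U" for y
    using has_partials_zero_on[OF U(1) that Q partials_quadric[OF yV[OF that]]] by simp_all
  have "k11 y = 0" "k12 y = 0" "k22 y = 0"
    using has_partials_zero_on[OF U(1) y g(1) partials_g1[OF yV[OF y]]]
      has_partials_zero_on[OF U(1) y g(2) partials_g2[OF yV[OF y]]] by simp_all
  then show ?thesis using Q g y by (simp add: contact_def)
qed

lemma continuous_has_partials: "has_partials h a b y \<Longrightarrow> isCont h y"
  unfolding has_partials_def by (rule has_derivative_continuous)

lemma contact_closure:
  assumes y: "y \<in> V" "y \<in> closure A" and A: "\<And>x. x \<in> A \<Longrightarrow> contact x" "A \<subseteq> V"
  shows "contact y"
proof -
  have z: "h y = 0" if "isCont h y" "\<And>x. x \<in> A \<Longrightarrow> h x = 0" for h :: "real \<times> real \<Rightarrow> real"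
  proof -
    obtain s where s: "\<And>n. s n \<in> A" "s \<longlonglongrightarrow> y" using y(2) unfolding closure_sequential by blast
    have "(\<lambda>n. h (s n)) \<longlonglongrightarrow> h y" using that(1) s(2) by (rule isCont_tendsto_compose)
    then show ?thesis using that(2)[OF s(1)] by (simp add: LIMSEQ_const_iff)
  qed
  obtain a b where k12: "has_partials k12 a b y" using partials_k12[OF y(1)] by blast
  note z' = z[OF continuous_has_partials]
  show ?thesis
    unfolding contact_def using A(1)[unfolded contact_def]
      z'[OF partials_quadric[OF y(1)]] z'[OF partials_g1[OF y(1)]] z'[OF partials_g2[OF y(1)]]
      z'[OF partials_k11[OF y(1)]] z'[OF k12] z'[OF partials_k22[OF y(1)]] by blast
qed

lemma linear_BL: "linear (\<lambda>x. r * B w x - s * (B z x + L x))"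
  by (rule linearI) (simp_all add: lin algebra_simps)

lemma tangent_inner: "(v *\<^sub>R u1 y + w *\<^sub>R u2 y) \<bullet> b1 = v" "(v *\<^sub>R u1 y + w *\<^sub>R u2 y) \<bullet> b2 = w"
  using frame_inner[OF fr] by (simp_all add: u1_def u2_def inner_add_left)

text \<open>A null vector of the Hessian gives a tangent vector \<open>t\<close> that is
  \<open>B\<close>-orthogonal to all tangent vectors. The functionals B t and half the differential
  of the quadric then both vanish on the tangent plane, hence are linearly dependent, and the
  dependence is a kernel vector of the homogenized form.\<close>

lemma hessian_nonzero_of_nondegenerate:
  assumes nd: "nondegenerate_quadric B L c" and ct: "contact y"
  shows "pd f 2 0 y * pd f 0 2 y - (pd f 1 1 y)^2 \<noteq> 0"
proof
  assume D: "pd f 2 0 y * pd f 0 2 y - (pd f 1 1 y)^2 = 0"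
  have "\<exists>v w. (v, w) \<noteq> (0, 0) \<and> pd f 2 0 y * v + pd f 1 1 y * w = 0 \<and> pd f 1 1 y * v + pd f 0 2 y * w = 0"
  proof (cases "pd f 2 0 y = 0")
    case True
    then show ?thesis using D by (intro exI[of _ 1] exI[of _ 0]) simp
  next
    case False
    then show ?thesis using D
      by (intro exI[of _ "- pd f 1 1 y"] exI[of _ "pd f 2 0 y"]) (simp add: power2_eq_square algebra_simps)
  qed
  then obtain v w where vw: "(v, w) \<noteq> (0, 0)" "pd f 2 0 y * v + pd f 1 1 y * w = 0" "pd f 1 1 y * v + pd f 0 2 y * w = 0"
    by blast
  define t where "t = v *\<^sub>R u1 y + w *\<^sub>R u2 y"
  have t0: "t \<noteq> 0"
  proof
    assume "t = 0"
    then show False using tangent_inner[of v y w] vw(1) by (simp add: t_def)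
  qed
  have B11: "B (u1 y) (u1 y) = - n y * pd f 2 0 y" "B (u1 y) (u2 y) = - n y * pd f 1 1 y" "B (u2 y) (u2 y) = - n y * pd f 0 2 y"
    using ct by (simp_all add: contact_def k11_def k12_def k22_def)
  have Bt: "B t (u1 y) = 0" "B t (u2 y) = 0"
  proof -
    have "B t (u1 y) = - n y * (pd f 2 0 y * v + pd f 1 1 y * w)" "B t (u2 y) = - n y * (pd f 1 1 y * v + pd f 0 2 y * w)"
      unfolding t_def lin Bsym[of "u2 y" "u1 y"] B11 by (simp_all add: algebra_simps)
    then show "B t (u1 y) = 0" "B t (u2 y) = 0" unfolding vw by simp_all
  qed
  define m where "m = B t b3"
  \<comment> \<open>By contact the functional on the left vanishes on \<open>u1\<close> and
    \<open>u2\<close>; on \<open>b3\<close> it vanishes by the choice of the two factors.\<close>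
  have K: "n y * B t x - m * (B (\<psi> y) x + L x) = 0" for x
    by (rule linear_eq_0[OF linear_BL, where y = y])
      (use Bt ct in \<open>simp_all add: contact_def g1_def g2_def m_def n_def\<close>)
  have lt: "B (\<psi> y) t + L t = 0"
  proof -
    have "B (\<psi> y) t + L t = v * g1 y + w * g2 y" by (simp add: t_def lin g1_def g2_def algebra_simps)
    then show ?thesis using ct by (simp add: contact_def)
  qed
  show False
  proof (cases "n y = 0 \<and> m = 0")
    case True
    have "B t x = 0" for x
      using linear_eq_0[of "B t" y x] Bt True BL by (auto simp: m_def quadratic_def bilinear_def)
    then have "(\<forall>x. B t x + 0 * L x = 0) \<and> L t + 0 * c = 0" using lt Bsym[of t "\<psi> y"] by simp
    then show False using nd t0 unfolding nondegenerate_quadric_def by blast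
  next
    case False
    define k where "k = n y *\<^sub>R t + (- m) *\<^sub>R \<psi> y"
    have "B k x + (- m) * L x = 0" for x using K[of x] unfolding k_def lin by (simp add: algebra_simps)
    moreover have "L k + (- m) * c = 0"
    proof -
      have "quadric B L c (\<psi> y) = 0" using ct by (simp add: contact_def)
      then show ?thesis using K[of "\<psi> y"] lt Bsym[of t "\<psi> y"] unfolding quadric_def k_def lin by algebra
    qed
    ultimately have "k = 0 \<and> - m = 0" using nd unfolding nondegenerate_quadric_def by blast
    then show False using False t0 by (auto simp: k_def)
  qed
qed

text \<open>A kernel vector of the homogenized form, reduced modulo the homogeneous vector of the
  contact point, is tangent to the graph and annihilated by the Hessian. So it is zero, and the
  vertical derivative \<open>n\<close> then forces the remaining coordinate \<open>k0\<close> to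
  vanish.\<close>

lemma nondegenerate_of_hessian:
  assumes ct: "contact y" and D: "pd f 2 0 y * pd f 0 2 y - (pd f 1 1 y)^2 \<noteq> 0" and n0: "n y \<noteq> 0"
  shows "nondegenerate_quadric B L c"
  unfolding nondegenerate_quadric_def
proof (intro allI impI)
  fix k k0 assume K: "(\<forall>x. B k x + k0 * L x = 0) \<and> L k + k0 * c = 0"
  then have K1: "B k x = - k0 * L x" and K2: "L k = - k0 * c" for x by (simp_all add: eq_neg_iff_add_eq_0)
  have Q: "B (\<psi> y) (\<psi> y) + 2 * L (\<psi> y) + c = 0" using ct by (simp add: contact_def quadric_def)
  \<comment> \<open>Subtracting \<open>k0\<close> times the homogeneous vector (\<psi> y, 1) makes
    the last coordinate zero.\<close>
  define t where "t = k + (- k0) *\<^sub>R \<psi> y"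
  have lt: "B (\<psi> y) t + L t = 0"
    unfolding t_def lin Bsym[of "\<psi> y" k] K1 K2 using Q by algebra
  have Bt: "B t x = - k0 * (B (\<psi> y) x + L x)" for x unfolding t_def lin K1 by (simp add: algebra_simps)
  define v w z where "v = t \<bullet> b1" and "w = t \<bullet> b2" and "z = t \<bullet> b3 - (t \<bullet> b1) * pd f 1 0 y - (t \<bullet> b2) * pd f 0 1 y"
  have t: "t = v *\<^sub>R u1 y + w *\<^sub>R u2 y + z *\<^sub>R b3" using expand[of t y] by (simp add: v_def w_def z_def)
  have "v * g1 y + w * g2 y + z * n y = 0"
    using lt unfolding t lin g1_def g2_def n_def by algebra
  then have "z = 0" using ct n0 by (simp add: contact_def)
  then have t': "t = v *\<^sub>R u1 y + w *\<^sub>R u2 y" using t by simp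
  have B11: "B (u1 y) (u1 y) = - n y * pd f 2 0 y" "B (u1 y) (u2 y) = - n y * pd f 1 1 y" "B (u2 y) (u2 y) = - n y * pd f 0 2 y"
    using ct by (simp_all add: contact_def k11_def k12_def k22_def)
  have "B t (u1 y) = 0" "B t (u2 y) = 0"
    unfolding Bt using ct by (simp_all add: contact_def g1_def g2_def)
  then have "n y * (pd f 2 0 y * v + pd f 1 1 y * w) = 0" "n y * (pd f 1 1 y * v + pd f 0 2 y * w) = 0"
    unfolding t' lin Bsym[of "u2 y" "u1 y"] B11 by (simp_all add: algebra_simps)
  then have "pd f 2 0 y * v + pd f 1 1 y * w = 0" "pd f 1 1 y * v + pd f 0 2 y * w = 0" using n0 by simp_all
  then have "(pd f 2 0 y * pd f 0 2 y - (pd f 1 1 y)^2) * v = 0" "(pd f 2 0 y * pd f 0 2 y - (pd f 1 1 y)^2) * w = 0"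
    by algebra+
  then have "t = 0" using D t' by simp
  then have "B t b3 = 0" using lin(3)[of 0 0 b3] by simp
  then have "k0 = 0" using Bt[of b3] n0 by (simp add: n_def)
  then show "k = 0 \<and> k0 = 0" using \<open>t = 0\<close> by (simp add: t_def)
qed

text \<open>Contact together with n = 0 makes the whole differential of the quadric vanish at the
  point. The second and third derivatives of the pullback then eliminate \<open>B\<close> piece by
  piece, so two equations with the same vertical derivative at one point coincide;
  \<open>quadric_proportional\<close> applies this to a difference.\<close>

lemma quadric_trivial:
  assumes U: "open U" "U \<subseteq> V" and Q: "\<And>y. y \<in> U \<Longrightarrow> quadric B L c (\<psi> y) = 0" and y: "y \<in> U"
    and D: "pd f 2 0 y * pd f 0 2 y - (pd f 1 1 y)^2 \<noteq> 0" and n0: "n y = 0"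
  shows "quadric B L c x = 0"
proof -
  have yV: "y \<in> V" using y U by blast
  note ct = contact_on[OF U Q]
  have k: "k11 z = 0" "k22 z = 0" if "z \<in> U" for z using ct[OF _ that] by (simp_all add: contact_def)
  note k1 = has_partials_zero_on[OF U(1) y k(1) partials_k11[OF yV]]
  note k2 = has_partials_zero_on[OF U(1) y k(2) partials_k22[OF yV]]
  \<comment> \<open>The third derivatives are linear in B(u1, b3) and B(u2, b3). A nondegenerate
    Hessian has a nonzero entry in its first row, which makes the system solvable in triangular
    form.\<close>
  have bb: "B (u1 y) b3 = 0 \<and> B (u2 y) b3 = 0"
  proof (cases "pd f 2 0 y = 0")
    case True
    then have "pd f 1 1 y \<noteq> 0" using D by auto
    then show ?thesis using k1 k2 True n0 by auto
  next
    case False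
    then show ?thesis using k1 n0 by auto
  qed
  have cy: "contact y" by (rule ct[OF _ y])
  have uu: "B (u1 y) (u1 y) = 0" "B (u1 y) (u2 y) = 0" "B (u2 y) (u2 y) = 0"
    using cy n0 by (simp_all add: contact_def k11_def k12_def k22_def)
  have ell: "B (\<psi> y) x + L x = 0" for x
  proof -
    have "linear (\<lambda>x. B (\<psi> y) x + L x)" by (rule linearI) (simp_all add: lin algebra_simps)
    from linear_eq_0[OF this, of y x] show ?thesis
      using cy n0 by (simp add: contact_def g1_def g2_def n_def)
  qed
  \<comment> \<open>On the graph the quadric has become B(b3, b3) times the square of the deviation
    \<open>e\<close> from the tangent plane. If the factor were nonzero, the graph would be flat
    near \<open>y\<close>, against the Hessian.\<close>
  have b33: "B b3 b3 = 0"
  proof (rule ccontr)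
    assume b: "B b3 b3 \<noteq> 0"
    define e where "e z = f z - (f y + pd f 1 0 y * (fst z - fst y) + pd f 0 1 y * (snd z - snd y))" for z
    have e0: "e z = 0" if z: "z \<in> U" for z
    proof -
      define d where "d = \<psi> z - \<psi> y"
      have d: "d = (fst z - fst y) *\<^sub>R u1 y + (snd z - snd y) *\<^sub>R u2 y + e z *\<^sub>R b3"
        by (simp add: d_def e_def graph_map_def u1_def u2_def algebra_simps)
      have zd: "\<psi> z = \<psi> y + d" by (simp add: d_def)
      have "quadric B L c (\<psi> z) = quadric B L c (\<psi> y) + 2 * (B (\<psi> y) d + L d) + B d d"
        unfolding zd quadric_def lin Bsym[of d "\<psi> y"] by algebra
      then have "B d d = 0" using Q[OF z] Q[OF y] ell[of d] by simp
      then have "e z * e z * B b3 b3 = 0"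
        unfolding d lin Bsym[of "u2 y" "u1 y"] Bsym[of b3 "u1 y"] Bsym[of b3 "u2 y"] uu using bb by simp
      then show ?thesis using b by simp
    qed
    have he: "has_partials e (pd f 1 0 z - pd f 1 0 y) (pd f 0 1 z - pd f 0 1 y) z" if "z \<in> U" for z
    proof -
      have zV: "z \<in> V" using that U by blast
      show ?thesis unfolding e_def[abs_def]
        by (rule has_partials_eq, (rule has_partials_rules hf zV)+) simp_all
    qed
    have e1: "pd f 1 0 z - pd f 1 0 y = 0" "pd f 0 1 z - pd f 0 1 y = 0" if "z \<in> U" for z
      using has_partials_zero_on[OF U(1) that e0 he[OF that]] by simp_all
    have "pd f 2 0 y = 0" "pd f 1 1 y = 0"
      using has_partials_zero_on[OF U(1) y e1(1) has_partials_diff[OF hdd(1)[OF yV] has_partials_const]] by simp_all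
    then show False using D by simp
  qed
  have linB: "linear (B w)" for w by (rule linearI) (simp_all add: lin)
  have B1: "B (u1 y) z = 0" for z
    by (rule linear_eq_0[OF linB uu(1,2) conjunct1[OF bb]])
  have B2: "B (u2 y) z = 0" for z
    by (rule linear_eq_0[OF linB _ uu(3) conjunct2[OF bb]]) (simp add: Bsym[of "u2 y" "u1 y"] uu)
  have B3: "B b3 z = 0" for z
    by (rule linear_eq_0[where h = "B b3" and y = y, OF linB _ _ b33]) (simp_all add: Bsym[of b3 "u1 y"] Bsym[of b3 "u2 y"] B1 B2)
  have B0: "B w z = 0" for w z
    by (rule linear_eq_0[where h = "B w" and y = y, OF linB]) (simp_all only: Bsym[of w "u1 y"] Bsym[of w "u2 y"] Bsym[of w b3] B1 B2 B3)
  have L0: "L z = 0" for z using ell[of z] B0 by simp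
  show ?thesis using Q[OF y] by (simp add: quadric_def B0 L0)
qed

end

lemma quadratic_lincomb:
  assumes "quadratic B L" "quadratic B' L'"
  shows "quadratic (\<lambda>x y. B x y - \<kappa> * B' x y) (\<lambda>x. L x - \<kappa> * L' x)"
proof -
  interpret Q: bounded_bilinear B using assms(1) by (simp add: quadratic_def bilinear_conv_bounded_bilinear)
  interpret Q': bounded_bilinear B' using assms(2) by (simp add: quadratic_def bilinear_conv_bounded_bilinear)
  have s: "B x y = B y x" "B' x y = B' y x" for x y using assms by (simp_all add: quadratic_def)
  have l: "linear L" "linear L'" using assms by (simp_all add: quadratic_def)
  show ?thesis
    unfolding quadratic_def bilinear_def
    by (intro conjI allI linearI)
      (simp_all add: Q.add_left Q.add_right Q.scaleR_left Q.scaleR_right Q'.add_left Q'.add_right Q'.scaleR_left Q'.scaleR_right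
        linear_add[OF l(1)] linear_add[OF l(2)] linear_scale[OF l(1)] linear_scale[OF l(2)] s algebra_simps)
qed

lemma quadric_lincomb:
  "quadric (\<lambda>x y. B x y - \<kappa> * B' x y) (\<lambda>x. L x - \<kappa> * L' x) (c - \<kappa> * c') x = quadric B L c x - \<kappa> * quadric B' L' c' x"
  by (simp add: quadric_def algebra_simps)

text \<open>The factor is determined by comparing vertical derivatives at one point.\<close>

lemma quadric_proportional:
  assumes fr: "frame b1 b2 b3" and V: "open V" and f: "Ck_on 3 V f" and q: "quadratic B L" "quadratic B' L'"
    and U: "open U" "U \<subseteq> V" "y \<in> U"
    and Q: "\<And>y. y \<in> U \<Longrightarrow> quadric B L c (graph_map b1 b2 b3 f y) = 0"
       "\<And>y. y \<in> U \<Longrightarrow> quadric B' L' c' (graph_map b1 b2 b3 f y) = 0"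
    and D: "pd f 2 0 y * pd f 0 2 y - (pd f 1 1 y)^2 \<noteq> 0"
    and n': "B' (graph_map b1 b2 b3 f y) b3 + L' b3 \<noteq> 0"
  obtains \<kappa> where "\<And>x. quadric B L c x = \<kappa> * quadric B' L' c' x"
proof -
  define \<kappa> where "\<kappa> = (B (graph_map b1 b2 b3 f y) b3 + L b3) / (B' (graph_map b1 b2 b3 f y) b3 + L' b3)"
  interpret quadric_on_chart b1 b2 b3 V f "\<lambda>x y. B x y - \<kappa> * B' x y" "\<lambda>x. L x - \<kappa> * L' x" "c - \<kappa> * c'"
    by unfold_locales (rule fr V f quadratic_lincomb[OF q])+
  have "n y = 0" unfolding n_def using n' by (simp add: \<kappa>_def field_simps)
  have "quadric B L c x = \<kappa> * quadric B' L' c' x" for x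
    using quadric_trivial[OF U(1,2) _ U(3) D \<open>n y = 0\<close>, of x] Q unfolding quadric_lincomb by simp
  then show ?thesis using that by blast
qed

section \<open>Convex bodies bounded by a quadric\<close>

text \<open>Gram-Schmidt for the inner product \<open>B\<close>, applied to the coordinate
  vectors.\<close>

lemma positive_definite_orthonormalize:
  fixes B :: "real ^ 3 \<Rightarrow> real ^ 3 \<Rightarrow> real"
  assumes B: "bilinear B" and sym: "\<And>x y. B x y = B y x" and pos: "\<And>x. x \<noteq> 0 \<Longrightarrow> B x x > 0"
  obtains T :: "real ^ 3 \<Rightarrow> real ^ 3" where "linear T" "\<And>x y. B (T x) (T y) = x \<bullet> y"
proof -
  note lin = bilinear_ladd[OF B] bilinear_radd[OF B] bilinear_lmul[OF B] bilinear_rmul[OF B] bilinear_lsub[OF B] bilinear_rsub[OF B]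
  define nrm where "nrm x = (1 / sqrt (B x x)) *\<^sub>R x" for x
  have n1: "B (nrm x) (nrm x) = 1" if "x \<noteq> 0" for x
  proof -
    have "sqrt (B x x) * sqrt (B x x) = B x x" using pos[OF that] by simp
    then show ?thesis using pos[OF that] by (simp add: nrm_def lin field_simps)
  qed
  have n2: "B y (nrm x) = B y x / sqrt (B x x)" for x y by (simp add: nrm_def lin)
  define e1 e2 e3 :: "real ^ 3" where "e1 = axis 1 1" and "e2 = axis 2 1" and "e3 = axis 3 1"
  define m1 where "m1 = nrm e1"
  define d2 where "d2 = e2 - B e2 m1 *\<^sub>R m1"
  define m2 where "m2 = nrm d2"
  define d3 where "d3 = e3 - B e3 m1 *\<^sub>R m1 - B e3 m2 *\<^sub>R m2"
  define m3 where "m3 = nrm d3"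
  \<comment> \<open>Each vector arises from its coordinate vector by subtracting multiples of
    earlier ones, so its own coordinate remains 1 and it is nonzero.\<close>
  have "d2 $ 2 = 1" "d3 $ 3 = 1" "e1 $ 1 = 1"
    unfolding d3_def m2_def d2_def m1_def nrm_def e1_def e2_def e3_def by (simp_all add: axis_def)
  then have nz: "e1 \<noteq> 0" "d2 \<noteq> 0" "d3 \<noteq> 0" by auto
  have 11: "B m1 m1 = 1" and 22: "B m2 m2 = 1" and 33: "B m3 m3 = 1"
    unfolding m1_def m2_def m3_def using nz n1 by blast+
  have "B m1 d2 = 0" unfolding d2_def lin by (simp add: 11 sym[of m1 e2])
  then have 12: "B m1 m2 = 0" unfolding m2_def n2 by simp
  have "B m1 d3 = 0" "B m2 d3 = 0" unfolding d3_def lin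
    using 11 22 12 by (simp_all add: sym[of m1 e3] sym[of m2 e3] sym[of m2 m1])
  then have 13: "B m1 m3 = 0" and 23: "B m2 m3 = 0" unfolding m3_def n2 by simp_all
  define T where "T x = x $ 1 *\<^sub>R m1 + x $ 2 *\<^sub>R m2 + x $ 3 *\<^sub>R m3" for x :: "real ^ 3"
  have lT: "linear T" by (rule linearI) (simp_all add: T_def algebra_simps)
  have "B (T x) (T y) = x \<bullet> y" for x y
    unfolding T_def lin 11 22 33 12 13 23 sym[of m2 m1] sym[of m3 m1] sym[of m3 m2]
    by (simp add: inner_vec_def sum_3)
  then show ?thesis by (rule that[OF lT])
qed

text \<open>After completion of the square the negative set of the quadric is an open solid
  ellipsoid. It is connected, avoids the frontier and meets \<open>K\<close>, hence lies in
  \<open>K\<close>. Conversely \<open>K\<close> is the convex hull of its frontier, which lies in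
  the closed ellipsoid.\<close>

lemma ellipsoid_of_definite_quadric:
  assumes K: "convex_body K" and q: "quadratic B L" and front: "frontier K \<subseteq> {x. quadric B L c x = 0}"
    and x0: "x0 \<in> interior K" "quadric B L c x0 < 0" and pos: "\<And>x. x \<noteq> 0 \<Longrightarrow> B x x > 0"
  shows "ellipsoid K"
proof -
  have B: "bilinear B" and sym: "\<And>x y. B x y = B y x" and L: "linear L" using q by (auto simp: quadratic_def)
  note lin = bilinear_ladd[OF B] bilinear_radd[OF B] bilinear_lmul[OF B] bilinear_rmul[OF B]
    linear_add[OF L] linear_scale[OF L]
  obtain T :: "real ^ 3 \<Rightarrow> real ^ 3" where T: "linear T" "\<And>x y. B (T x) (T y) = x \<bullet> y"
    using positive_definite_orthonormalize[OF B sym pos] by blast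
  have "inj T"
  proof -
    have "x = 0" if "T x = 0" for x using T(2)[of x x] that bilinear_lzero[OF B] by simp
    then show ?thesis using linear_injective_0[OF T(1)] by blast
  qed
  then have bij: "bij T" using linear_inj_imp_surj[OF T(1)] by (simp add: bij_def)
  \<comment> \<open>The vector representing -L in the coordinates given by \<open>T\<close>; its
    image \<open>x1\<close> is the centre of the quadric.\<close>
  define v where "v = (\<Sum>i\<in>Basis. (- L (T i)) *\<^sub>R i)"
  have vL: "v \<bullet> x = - L (T x)" for x
  proof -
    have "T x = (\<Sum>i\<in>Basis. (x \<bullet> i) *\<^sub>R T i)"
      by (subst euclidean_representation[of x, symmetric]) (simp only: linear_sum[OF T(1)] linear_scale[OF T(1)])
    then have "L (T x) = (\<Sum>i\<in>Basis. (x \<bullet> i) * L (T i))"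
      by (simp add: linear_sum[OF L] linear_scale[OF L])
    moreover have "v \<bullet> x = (\<Sum>i\<in>Basis. - ((x \<bullet> i) * L (T i)))"
      unfolding v_def inner_sum_left inner_scaleR_left
      by (intro sum.cong refl) (simp only: inner_commute[of _ x] mult_minus_left mult.commute)
    ultimately show ?thesis by (simp only: sum_negf)
  qed
  define x1 where "x1 = T v"
  have cen: "B x1 (T y) + L (T y) = 0" for y unfolding x1_def T(2) vL by simp
  have Q: "quadric B L c (T y + x1) = y \<bullet> y + quadric B L c x1" for y
    using cen[of y] unfolding quadric_def lin sym[of "T y" x1] T(2) by algebra
  have surjT: "\<exists>y. T y = x" for x using surjD[OF bij_is_surj[OF bij], of x] by auto
  obtain y0 where y0: "T y0 = x0 - x1" using surjT by blast
  define r2 where "r2 = - quadric B L c x1"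
  have "quadric B L c x0 = y0 \<bullet> y0 - r2" using Q[of y0] y0 by (simp add: r2_def)
  then have r2: "r2 > 0" using x0(2) inner_ge_zero[of y0] by linarith
  define r where "r = sqrt r2"
  have r: "r > 0" "r * r = r2" using r2 by (simp_all add: r_def)
  define A where "A y = T (r *\<^sub>R y)" for y
  have lA: "linear A" unfolding A_def by (rule linearI) (simp_all add: linear_add[OF T(1)] linear_scale[OF T(1)] algebra_simps)
  have QA: "quadric B L c (A y + x1) = r2 * ((norm y)^2 - 1)" for y
    unfolding A_def Q by (simp add: r2_def[symmetric] r(2)[symmetric] power2_norm_eq_inner algebra_simps) (simp add: r(2) r2_def)
  have exA: "\<exists>y. x = A y + x1" for x
  proof -
    obtain y where "T y = x - x1" using surjT by blast
    then have "x = A ((1 / r) *\<^sub>R y) + x1" using r by (simp add: A_def)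
    then show ?thesis by blast
  qed
  define O1 where "O1 = (\<lambda>y. A y + x1) ` ball 0 1"
  define E where "E = (\<lambda>y. A y + x1) ` cball 0 1"
  have cA: "continuous_on X (\<lambda>y. A y + x1)" for X
    by (intro continuous_intros linear_continuous_on linear_conv_bounded_linear[THEN iffD1] lA)
  have "connected O1" unfolding O1_def by (intro connected_continuous_image cA) simp
  moreover have "O1 \<inter> frontier K = {}"
  proof -
    have "quadric B L c x < 0" if "x \<in> O1" for x
      using that r2 unfolding O1_def by (auto simp: QA mult_pos_neg power_less_one_iff abs_square_less_1)
    then show ?thesis using front by force
  qed
  moreover have "x0 \<in> O1"
  proof -
    obtain y where y: "x0 = A y + x1" using exA by blast
    then have "(norm y)^2 < 1" using x0(2) r2 unfolding y QA by (simp add: mult_less_0_iff)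
    then show ?thesis using y by (auto simp: O1_def abs_square_less_1)
  qed
  moreover have "x0 \<in> K" using x0 interior_subset by blast
  ultimately have O1K: "O1 \<subseteq> K" using connected_Int_frontier[of O1 K] by blast
  have "closed K" and cK: "convex K" "compact K" using K by (auto simp: convex_body_def compact_imp_closed)
  have "E \<subseteq> K"
  proof -
    have "E = (\<lambda>y. A y + x1) ` closure (ball 0 1)" by (simp add: E_def)
    also have "\<dots> \<subseteq> closure O1" unfolding O1_def by (rule image_closure_subset[OF cA]) (auto simp: closure_subset)
    also have "\<dots> \<subseteq> K" using O1K \<open>closed K\<close> by (rule closure_minimal)
    finally show ?thesis .
  qed
  moreover have "K \<subseteq> E"
  proof -
    have "frontier K \<subseteq> E"
    proof
      fix x assume "x \<in> frontier K"
      then have "quadric B L c x = 0" using front by blast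
      moreover obtain y where y: "x = A y + x1" using exA by blast
      ultimately have "(norm y)^2 = 1" using r2 unfolding y QA by simp
      then have "norm y \<le> 1" by (auto simp: power2_eq_1_iff)
      then show "x \<in> E" using y by (auto simp: E_def)
    qed
    moreover have "convex E"
    proof -
      have "E = (\<lambda>y. x1 + y) ` (A ` cball 0 1)" by (auto simp: E_def image_image add.commute)
      then show ?thesis by (simp only: convex_translation[OF convex_linear_image[OF lA convex_cball]])
    qed
    ultimately have "convex hull (frontier K) \<subseteq> E" by (rule hull_minimal)
    then show ?thesis using Krein_Milman_frontier[OF cK] by simp
  qed
  ultimately have KE: "K = E" by blast
  have mA: "matrix A *v y = A y" for y using fun_cong[OF matrix_vector_mul(2)[OF lA], of y] .
  have "bij A"
  proof -
    have "y = z" if "A y = A z" for y z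
      using injD[OF \<open>inj T\<close>, of "r *\<^sub>R y" "r *\<^sub>R z"] that r by (simp add: A_def)
    then have "inj A" by (rule injI)
    then show ?thesis using linear_inj_imp_surj[OF lA] by (simp add: bij_def)
  qed
  moreover have "(*v) (matrix A) = A" by (rule ext) (rule mA)
  ultimately have "bij ((*v) (matrix A))" by simp
  then have "invertible (matrix A)" by (simp add: invertible_eq_bij)
  moreover have "K = (\<lambda>y. matrix A *v y + x1) ` cball 0 1" unfolding mA KE E_def ..
  ultimately show ?thesis unfolding ellipsoid_def by blast
qed

text \<open>Every line through an interior point meets the frontier on both sides, so the quadric
  restricted to it has roots of both signs. This determines the sign of \<open>B v v\<close> for
  every direction \<open>v\<close> and makes \<open>B\<close> definite.\<close>

lemma ellipsoid_of_quadric: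
  assumes K: "convex_body K" and q: "quadratic B L" and front: "frontier K \<subseteq> {x. quadric B L c x = 0}"
    and nd: "nondegenerate_quadric B L c"
  shows "ellipsoid K"
proof -
  have B: "bilinear B" and sym: "\<And>x y. B x y = B y x" and L: "linear L" using q by (auto simp: quadratic_def)
  note lin = bilinear_ladd[OF B] bilinear_radd[OF B] bilinear_lmul[OF B] bilinear_rmul[OF B]
    linear_add[OF L] linear_scale[OF L]
  have bK: "bounded K" using K by (simp add: convex_body_def compact_imp_bounded)
  have line: "quadric B L c (x + t *\<^sub>R v) = quadric B L c x + 2 * t * (B x v + L v) + t^2 * B v v" for x v t
    unfolding quadric_def lin sym[of v x] by (simp add: algebra_simps power2_eq_square)
  \<comment> \<open>A quadratic polynomial that vanishes on a ball has B = 0 and L = 0, which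
    nondegeneracy excludes.\<close>
  have "\<exists>x0\<in>interior K. quadric B L c x0 \<noteq> 0"
  proof (rule ccontr)
    assume "\<not> ?thesis"
    then have Q0: "quadric B L c x = 0" if "x \<in> interior K" for x using that by blast
    obtain x0 where x0: "x0 \<in> interior K" using K by (auto simp: convex_body_def)
    then obtain e where e: "e > 0" "ball x0 e \<subseteq> interior K" using openE[OF open_interior] by metis
    have *: "B x0 v + L v = 0 \<and> B v v = 0" for v
    proof -
      define t where "t = e / (2 * (norm v + 1))"
      have n: "norm v + 1 > 0" by (simp add: add_nonneg_pos)
      have t: "t > 0" using e n by (simp add: t_def)
      have "t * norm v < t * (2 * (norm v + 1))" using t by (intro mult_strict_left_mono) (auto simp: add_nonneg_pos)
      also have "\<dots> = e" using n by (simp add: t_def)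
      finally have tv: "t * norm v < e" .
      have "x0 + t *\<^sub>R v \<in> ball x0 e" "x0 + (- t) *\<^sub>R v \<in> ball x0 e" using tv t by (simp_all add: dist_norm)
      then have "quadric B L c (x0 + t *\<^sub>R v) = 0" "quadric B L c (x0 + (- t) *\<^sub>R v) = 0" using e Q0 by blast+
      then have "2 * t * (B x0 v + L v) + t^2 * B v v = 0" "- 2 * t * (B x0 v + L v) + t^2 * B v v = 0"
        unfolding line Q0[OF x0] by simp_all
      then have "4 * t * (B x0 v + L v) = 0" "2 * t^2 * B v v = 0" by algebra+
      then show ?thesis using t by simp
    qed
    have "B x y = 0" for x y
      using *[of "x + y"] *[of x] *[of y] unfolding lin sym[of y x] by simp
    moreover have "L x = 0" for x using *[of x] calculation by simp
    ultimately have "(\<forall>x. B (axis 1 1) x + 0 * L x = 0) \<and> L (axis 1 1) + 0 * c = 0" by simp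
    then have "axis 1 1 = (0 :: real ^ 3)" using nd unfolding nondegenerate_quadric_def by blast
    then show False by (simp add: axis_eq_0_iff)
  qed
  then obtain x0 where x0: "x0 \<in> interior K" and Qx0: "quadric B L c x0 \<noteq> 0" by blast
  have opp: "quadric B L c x0 * B v v < 0" if v: "v \<noteq> 0" for v
  proof -
    obtain d where d: "d > 0" "x0 + d *\<^sub>R v \<in> frontier K" using ray_to_frontier[OF bK x0 v] by blast
    obtain d' where d': "d' > 0" "x0 + d' *\<^sub>R (- v) \<in> frontier K" using ray_to_frontier[OF bK x0, of "- v"] v by auto
    have "quadric B L c (x0 + d *\<^sub>R v) = 0" "quadric B L c (x0 + (- d') *\<^sub>R v) = 0"
      using front d d' by auto
    then have 1: "quadric B L c x0 + 2 * d * (B x0 v + L v) + d^2 * B v v = 0"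
       "quadric B L c x0 - 2 * d' * (B x0 v + L v) + d'^2 * B v v = 0" unfolding line by simp_all
    \<comment> \<open>Eliminates the linear term: the product of the roots \<open>d\<close> and
      \<open>- d'\<close> is the quotient of the outer coefficients.\<close>
    have "(d + d') * (quadric B L c x0 + d * d' * B v v) = 0" using 1 by algebra
    then have "quadric B L c x0 = - (d * d') * B v v" using d d' by (simp add: add_eq_0_iff)
    moreover from this have "B v v \<noteq> 0" using Qx0 by auto
    then have "B v v * B v v > 0" using not_real_square_gt_zero by blast
    then have "d * d' * (B v v * B v v) > 0" using d d' by simp
    ultimately show ?thesis by (simp add: mult.assoc)
  qed
  show ?thesis
  proof (cases "quadric B L c x0 < 0")
    case True
    then show ?thesis using ellipsoid_of_definite_quadric[OF K q front x0 True] opp by (simp add: mult_less_0_iff)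
  next
    case False
    \<comment> \<open>If the value at \<open>x0\<close> is positive, the equation is multiplied by
      -1; the negative is obtained as a combination with the zero form.\<close>
    have "quadratic (\<lambda>x y. 0 - 1 * B x y) (\<lambda>x. 0 - 1 * L x)"
      by (rule quadratic_lincomb[OF _ q]) (auto simp: quadratic_def bilinear_def linear_iff)
    then have q': "quadratic (\<lambda>x y. - B x y) (\<lambda>x. - L x)" by simp
    have Q': "quadric (\<lambda>x y. - B x y) (\<lambda>x. - L x) (- c) x = - quadric B L c x" for x
      by (simp add: quadric_def)
    show ?thesis
      by (rule ellipsoid_of_definite_quadric[OF K q' _ x0, where c = "- c"])
        (use False Qx0 opp front in \<open>auto simp: Q' mult_less_0_iff\<close>)
  qed
qed

section \<open>Tangent planes of convex bodies\<close>

lemma second_order_limit: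
  assumes V: "open V" "y \<in> V" and f: "Ck_on 2 V f"
  shows "((\<lambda>t. (f (y + t *\<^sub>R v) - f y - t * (pd f 1 0 y * fst v + pd f 0 1 y * snd v)) / t^2)
    \<longlongrightarrow> (pd f 2 0 y * fst v^2 + 2 * pd f 1 1 y * fst v * snd v + pd f 0 2 y * snd v^2) / 2) (at_right 0)"
proof -
  let ?F = "at_right (0::real)"
  let ?H = "(pd f 2 0 y * fst v^2 + 2 * pd f 1 1 y * fst v * snd v + pd f 0 2 y * snd v^2) / 2"
  let ?R = "\<lambda>v. f (y + v) - taylor_poly (\<lambda>k l. pd f k l y) 2 v"
  have "?R \<in> o[nhds 0](\<lambda>v. norm v^2)"
    using taylor_expansion[OF V f, of 0 0 2] by (simp add: pd_0)
  moreover have "filterlim (\<lambda>t. t *\<^sub>R v) (nhds 0) ?F"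
    by (rule tendsto_eq_intros | simp)+
  ultimately have "(\<lambda>t. ?R (t *\<^sub>R v)) \<in> o[?F](\<lambda>t. norm (t *\<^sub>R v)^2)"
    by (rule landau_o.small.compose)
  moreover have "(\<lambda>t. norm (t *\<^sub>R v)^2) \<in> O[?F](\<lambda>t. t^2)"
    by (rule bigoI[of _ "norm v^2"]) (simp add: power_mult_distrib)
  ultimately have "(\<lambda>t. ?R (t *\<^sub>R v)) \<in> o[?F](\<lambda>t. t^2)" by (rule landau_o.small_big_trans)
  from tendsto_add[OF smalloD_tendsto[OF this] tendsto_const[of ?H]]
  have 1: "((\<lambda>t. ?R (t *\<^sub>R v) / t^2 + ?H) \<longlongrightarrow> ?H) ?F" by simp
  have t0: "eventually (\<lambda>t. t > 0) ?F" by (simp add: eventually_at_right_less)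
  show ?thesis
  proof (rule Lim_transform_eventually[OF 1], rule eventually_mono[OF t0])
    fix t :: real assume t: "t > 0"
    show "?R (t *\<^sub>R v) / t^2 + ?H = (f (y + t *\<^sub>R v) - f y - t * (pd f 1 0 y * fst v + pd f 0 1 y * snd v)) / t^2"
      unfolding taylor_poly_2 pd_0 using t by (simp add: field_simps power2_eq_square)
  qed
qed

lemma semidefinite_of_one_sided:
  assumes V: "open V" "y \<in> V" and f: "Ck_on 2 V f"
    and one: "\<And>z. z \<in> V \<Longrightarrow> 0 \<le> s * (f z - f y - (pd f 1 0 y * (fst z - fst y) + pd f 0 1 y * (snd z - snd y)))"
  shows "0 \<le> s * (pd f 2 0 y * v^2 + 2 * pd f 1 1 y * v * w + pd f 0 2 y * w^2)"
proof -
  note L = tendsto_mult_left[OF second_order_limit[OF V f, of "(v, w)"], of s]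
  obtain r where r: "r > 0" "ball y r \<subseteq> V" using V openE by blast
  have lim: "((\<lambda>t. t * norm (v, w)) \<longlongrightarrow> 0) (at_right 0)" by (rule tendsto_eq_intros | simp)+
  have ev: "eventually (\<lambda>t. 0 < t \<and> t * norm (v, w) < r) (at_right 0)"
    using order_tendstoD(2)[OF lim r(1)] by (intro eventually_conj) (auto simp: eventually_at_right_less)
  have "eventually (\<lambda>t. 0 \<le> s * ((f (y + t *\<^sub>R (v, w)) - f y - t * (pd f 1 0 y * fst (v, w) + pd f 0 1 y * snd (v, w))) / t^2)) (at_right 0)"
    using ev
  proof eventually_elim
    case (elim t)
    have "dist y (y + z) = norm z" for z by (simp add: dist_norm)
    then have "dist y (y + t *\<^sub>R (v, w)) = t * norm (v, w)"
      using norm_scaleR[of t "(v, w)"] elim by (simp del: scaleR_Pair)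
    then have "y + t *\<^sub>R (v, w) \<in> ball y r" using elim by simp
    then have "y + t *\<^sub>R (v, w) \<in> V" using r by blast
    from one[OF this] have "0 \<le> s * (f (y + t *\<^sub>R (v, w)) - f y - t * (pd f 1 0 y * fst (v, w) + pd f 0 1 y * snd (v, w)))"
      by (simp add: algebra_simps)
    then have "0 \<le> s * (f (y + t *\<^sub>R (v, w)) - f y - t * (pd f 1 0 y * fst (v, w) + pd f 0 1 y * snd (v, w))) / t^2"
      by (rule divide_nonneg_nonneg) simp
    then show ?case by simp
  qed
  from tendsto_lowerbound[OF L this] show ?thesis by simp
qed

lemma det_nonneg_of_semidefinite:
  fixes p q r s :: real
  assumes s: "s \<noteq> 0" and sd: "\<And>v w. 0 \<le> s * (p * v^2 + 2 * q * v * w + r * w^2)"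
  shows "0 \<le> p * r - q^2"
proof (cases "p = 0")
  case True
  have "q = 0"
  proof (rule ccontr)
    assume q: "q \<noteq> 0"
    \<comment> \<open>Chosen so that the form, which is affine in \<open>x\<close> when p = 0, takes
      the value \<open>- s\<close> at (x, 1).\<close>
    define x where "x = - (r + s) / (2 * q)"
    have x: "2 * q * x + r = - s" using q by (simp add: x_def)
    have "0 \<le> s * (2 * q * x + r)" using sd[of x 1] True by simp
    then have "0 \<le> - (s * s)" unfolding x by simp
    moreover have "s * s > 0" using s not_real_square_gt_zero by blast
    ultimately show False by simp
  qed
  then show ?thesis using True by simp
next
  case False
  have 1: "s * p \<ge> 0" using sd[of 1 0] by simp
  \<comment> \<open>At (-q, p) the form equals p (p r - q^2).\<close>
  have "0 \<le> (s * p) * (p * r - q^2)" using sd[of "- q" p] by (simp add: algebra_simps power2_eq_square)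
  then show ?thesis using 1 False s by (simp add: zero_le_mult_iff)
qed

lemma has_derivative_along:
  assumes "has_partials f a b y"
  shows "((\<lambda>t. f (y + t *\<^sub>R v)) has_real_derivative (fst v * a + snd v * b)) (at 0)"
proof -
  have "((\<lambda>t. y + t *\<^sub>R v) has_derivative (\<lambda>t. t *\<^sub>R v)) (at 0)" by (auto intro!: derivative_eq_intros)
  moreover have "(f has_derivative (\<lambda>v. fst v * a + snd v * b)) (at (y + 0 *\<^sub>R v))"
    using assms by (simp add: has_partials_def)
  ultimately have "((\<lambda>t. f (y + t *\<^sub>R v)) has_derivative (\<lambda>t. fst (t *\<^sub>R v) * a + snd (t *\<^sub>R v) * b)) (at 0)"
    by (rule has_derivative_compose)
  moreover have "(\<lambda>t. fst (t *\<^sub>R v) * a + snd (t *\<^sub>R v) * b) = (*) (fst v * a + snd v * b)"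
    by (rule ext) (simp add: algebra_simps)
  ultimately show ?thesis by (simp add: has_field_derivative_def)
qed

text \<open>A supporting functional is minimal at the point along every boundary curve, so it
  annihilates all velocities. The images of lines in the chart realize every combination of
  \<open>u1\<close> and \<open>u2\<close>, so the velocities fill its kernel.\<close>

lemma tangent_plane_of_chart:
  assumes K: "convex_body K" and ch: "graph_chart (frontier K) b1 b2 b3 f V W" and y: "y \<in> V"
  obtains a where "a \<noteq> 0" "a \<bullet> (b1 + pd f 1 0 y *\<^sub>R b3) = 0" "a \<bullet> (b2 + pd f 0 1 y *\<^sub>R b3) = 0" "a \<bullet> b3 \<noteq> 0"
    "\<forall>z\<in>K. a \<bullet> graph_map b1 b2 b3 f y \<le> a \<bullet> z"
    "\<forall>z\<in>interior K. a \<bullet> graph_map b1 b2 b3 f y < a \<bullet> z"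
    "tangent_plane (frontier K) (graph_map b1 b2 b3 f y) = {z. a \<bullet> z = a \<bullet> graph_map b1 b2 b3 f y}"
proof -
  let ?\<psi> = "graph_map b1 b2 b3 f"
  let ?X = "?\<psi> y" and ?u1 = "b1 + pd f 1 0 y *\<^sub>R b3" and ?u2 = "b2 + pd f 0 1 y *\<^sub>R b3"
  have fr: "frame b1 b2 b3" and V: "open V" and f: "Ck_on 5 V f" and onF: "\<And>y. y \<in> V \<Longrightarrow> ?\<psi> y \<in> frontier K"
    using ch by (auto simp: graph_chart_def)
  have clK: "closed K" and cK: "convex K" and iK: "interior K \<noteq> {}"
    using K by (auto simp: convex_body_def compact_imp_closed)
  have XK: "?X \<in> K" "?X \<notin> interior K" using onF[OF y] clK by (auto simp: frontier_def)
  \<comment> \<open>The supporting hyperplane theorem for the relative interior is used because it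
    yields the strict inequality in the interior.\<close>
  have ri: "rel_interior K = interior K" using iK by (rule rel_interior_nonempty_interior)
  obtain a where a: "a \<noteq> 0" "\<And>z. z \<in> K \<Longrightarrow> a \<bullet> ?X \<le> a \<bullet> z" "\<And>z. z \<in> interior K \<Longrightarrow> a \<bullet> ?X < a \<bullet> z"
    using supporting_hyperplane_rel_boundary[OF cK XK(1)] XK(2) unfolding ri by blast
  have perp: "a \<bullet> v = 0" if \<gamma>: "\<epsilon> > 0" "\<gamma> 0 = ?X" "\<gamma> ` {-\<epsilon><..<\<epsilon>} \<subseteq> frontier K" "(\<gamma> has_vector_derivative v) (at 0)"
    for \<gamma> :: "real \<Rightarrow> real ^ 3" and \<epsilon> v
  proof (rule DERIV_local_min[OF _ \<gamma>(1)])
    have "((\<lambda>t. a \<bullet> \<gamma> t) has_derivative (\<lambda>t. a \<bullet> (t *\<^sub>R v))) (at 0)"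
      using \<gamma>(4) unfolding has_vector_derivative_def by (rule has_derivative_inner_right)
    moreover have "(\<lambda>t. a \<bullet> (t *\<^sub>R v)) = (*) (a \<bullet> v)" by (rule ext) simp
    ultimately show "((\<lambda>t. a \<bullet> \<gamma> t) has_real_derivative a \<bullet> v) (at 0)" by (simp add: has_field_derivative_def)
    show "\<forall>t. \<bar>0 - t\<bar> < \<epsilon> \<longrightarrow> a \<bullet> \<gamma> 0 \<le> a \<bullet> \<gamma> t"
    proof (intro allI impI)
      fix t assume "\<bar>0 - t\<bar> < \<epsilon>"
      then have "\<gamma> t \<in> frontier K" using \<gamma>(3) by (auto simp: abs_less_iff)
      then have "\<gamma> t \<in> K" using clK by (auto simp: frontier_def)
      then show "a \<bullet> \<gamma> 0 \<le> a \<bullet> \<gamma> t" using a(2) \<gamma>(2) by simp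
    qed
  qed
  have hp: "has_partials f (pd f 1 0 y) (pd f 0 1 y) y"
    using has_partials_pd[OF V Ck_on_le[OF f, of "Suc (0 + 0)"] y] by (simp add: pd_0)
  have curve: "\<exists>\<gamma> \<epsilon>. \<epsilon> > 0 \<and> \<gamma> 0 = ?X \<and> \<gamma> ` {-\<epsilon><..<\<epsilon>} \<subseteq> frontier K \<and>
        (\<gamma> has_vector_derivative fst v *\<^sub>R ?u1 + snd v *\<^sub>R ?u2) (at (0::real))" for v
  proof -
    obtain r where r: "r > 0" "ball y r \<subseteq> V" using V y openE by blast
    define \<epsilon> where "\<epsilon> = r / (norm v + 1)"
    have n: "norm v + 1 > 0" by (simp add: add_nonneg_pos)
    have \<epsilon>: "\<epsilon> > 0" using r n by (simp add: \<epsilon>_def)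
    have "?\<psi> (y + t *\<^sub>R v) \<in> frontier K" if "t \<in> {-\<epsilon><..<\<epsilon>}" for t
    proof -
      have "\<bar>t\<bar> * norm v \<le> \<bar>t\<bar> * (norm v + 1)" by (intro mult_left_mono) auto
      also have "\<dots> < \<epsilon> * (norm v + 1)" using that n by (intro mult_strict_right_mono) auto
      also have "\<dots> = r" using n by (simp add: \<epsilon>_def)
      finally have "y + t *\<^sub>R v \<in> ball y r" by (simp add: dist_norm)
      then show ?thesis using r onF by blast
    qed
    moreover have "((\<lambda>t. ?\<psi> (y + t *\<^sub>R v)) has_vector_derivative fst v *\<^sub>R ?u1 + snd v *\<^sub>R ?u2) (at 0)"
    proof -
      have "((\<lambda>t. f (y + t *\<^sub>R v) *\<^sub>R b3) has_vector_derivative (fst v * pd f 1 0 y + snd v * pd f 0 1 y) *\<^sub>R b3) (at 0)"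
        using has_vector_derivative_scaleR[OF has_derivative_along[OF hp, of v] has_vector_derivative_const[of b3]] by simp
      moreover have "((\<lambda>t. fst (y + t *\<^sub>R v) *\<^sub>R b1) has_vector_derivative fst v *\<^sub>R b1) (at 0)"
        "((\<lambda>t. snd (y + t *\<^sub>R v) *\<^sub>R b2) has_vector_derivative snd v *\<^sub>R b2) (at 0)"
        by (auto intro!: derivative_eq_intros simp: has_vector_derivative_def algebra_simps)
      ultimately have "((\<lambda>t. fst (y + t *\<^sub>R v) *\<^sub>R b1 + snd (y + t *\<^sub>R v) *\<^sub>R b2 + f (y + t *\<^sub>R v) *\<^sub>R b3) has_vector_derivative
        fst v *\<^sub>R b1 + snd v *\<^sub>R b2 + (fst v * pd f 1 0 y + snd v * pd f 0 1 y) *\<^sub>R b3) (at 0)"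
        by (intro has_vector_derivative_add)
      then show ?thesis by (simp add: graph_map_def algebra_simps)
    qed
    ultimately show ?thesis using \<epsilon> by (intro exI[of _ "\<lambda>t. ?\<psi> (y + t *\<^sub>R v)"] exI[of _ \<epsilon>]) auto
  qed
  have u: "a \<bullet> (fst v *\<^sub>R ?u1 + snd v *\<^sub>R ?u2) = 0" for v using curve[of v] perp by blast
  have u1: "a \<bullet> ?u1 = 0" and u2: "a \<bullet> ?u2 = 0" using u[of "(1, 0)"] u[of "(0, 1)"] by simp_all
  have b3: "a \<bullet> b3 \<noteq> 0"
  proof
    assume "a \<bullet> b3 = 0"
    moreover from this have "a \<bullet> b1 = 0" "a \<bullet> b2 = 0" using u1 u2 by (simp_all add: inner_add_right)
    ultimately show False using frame_expand[OF fr, of a] a(1) by simp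
  qed
  have "tangent_plane (frontier K) ?X = {z. a \<bullet> z = a \<bullet> ?X}"
  proof (intro equalityI subsetI)
    fix z assume "z \<in> tangent_plane (frontier K) ?X"
    then obtain v where "z = ?X + v" "a \<bullet> v = 0" unfolding tangent_plane_def using perp by blast
    then show "z \<in> {z. a \<bullet> z = a \<bullet> ?X}" by (simp add: inner_add_right)
  next
    fix z assume "z \<in> {z. a \<bullet> z = a \<bullet> ?X}"
    then have 0: "a \<bullet> (z - ?X) = 0" by (simp add: inner_diff_right)
    define v where "v = ((z - ?X) \<bullet> b1, (z - ?X) \<bullet> b2)"
    define k where "k = (z - ?X) \<bullet> b3 - ((z - ?X) \<bullet> b1) * pd f 1 0 y - ((z - ?X) \<bullet> b2) * pd f 0 1 y"
    have e: "z - ?X = fst v *\<^sub>R ?u1 + snd v *\<^sub>R ?u2 + k *\<^sub>R b3"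
      using frame_expand_sheared[OF fr, of "z - ?X" "pd f 1 0 y" "pd f 0 1 y"] by (simp only: v_def k_def fst_conv snd_conv)
    have "a \<bullet> (z - ?X) = k * (a \<bullet> b3)"
      unfolding e by (simp only: inner_add_right[of a "fst v *\<^sub>R ?u1 + snd v *\<^sub>R ?u2"] u inner_scaleR_right add_0_left)
    then have "k = 0" using 0 b3 by simp
    then have "z - ?X = fst v *\<^sub>R ?u1 + snd v *\<^sub>R ?u2" using e by simp
    then have "z = ?X + (fst v *\<^sub>R ?u1 + snd v *\<^sub>R ?u2)" by (simp add: algebra_simps)
    then show "z \<in> tangent_plane (frontier K) ?X" unfolding tangent_plane_def using curve[of v] by blast
  qed
  then show ?thesis using a(2,3) by (intro that[OF a(1) u1 u2 b3]) simp_all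
qed

lemma tangent_coordinates:
  assumes fr: "frame b1 b2 b3" and a: "a \<bullet> (b1 + p *\<^sub>R b3) = 0" "a \<bullet> (b2 + r *\<^sub>R b3) = 0" "a \<bullet> b3 \<noteq> 0" "a \<bullet> z = 0"
  shows "z = (z \<bullet> b1) *\<^sub>R (b1 + p *\<^sub>R b3) + (z \<bullet> b2) *\<^sub>R (b2 + r *\<^sub>R b3)"
proof -
  define k where "k = z \<bullet> b3 - (z \<bullet> b1) * p - (z \<bullet> b2) * r"
  have e: "z = (z \<bullet> b1) *\<^sub>R (b1 + p *\<^sub>R b3) + (z \<bullet> b2) *\<^sub>R (b2 + r *\<^sub>R b3) + k *\<^sub>R b3"
    unfolding k_def by (rule frame_expand_sheared[OF fr])
  have "a \<bullet> z = k * (a \<bullet> b3)"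
    by (subst e) (simp only: inner_add_right[of a _ "k *\<^sub>R b3"] inner_add_right[of a "_ *\<^sub>R _" "_ *\<^sub>R (_ + _)"] inner_scaleR_right a mult_zero_right add_0_left)
  then have "k = 0" using a by simp
  then show ?thesis using e by simp
qed

text \<open>Flatness is exploited by exhibiting points of the shadow boundary: if the tangent plane
  at \<open>x\<close> contains the source, then so does it contain the line through both, and strict
  support keeps that line out of the interior.\<close>

lemma shadow_boundary_of_tangent:
  assumes x: "x \<in> frontier K" and a: "\<forall>z\<in>interior K. a \<bullet> x < a \<bullet> z" and q: "a \<bullet> q = a \<bullet> x"
  shows "x \<in> shadow_boundary K q"
proof -
  have "affine hull {q, x} \<subseteq> {z. a \<bullet> z = a \<bullet> x}"
    by (rule hull_minimal) (auto simp: q affine_hyperplane)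
  then have "affine hull {q, x} \<inter> interior K = {}" using a by force
  then show ?thesis using x by (simp add: shadow_boundary_def)
qed

section \<open>From light sources to a local quadric\<close>

lemma third_derivatives_of_chart:
  assumes K: "convex_body K" and ch: "graph_chart (frontier K) b1 b2 b3 f V W" and y: "y \<in> V"
    and D: "pd f 2 0 y * pd f 0 2 y - (pd f 1 1 y)^2 > 0"
    and lights: "\<And>p. p \<in> frontier K \<Longrightarrow>
      \<exists>Q. (infinite Q \<or> 31 \<le> card Q) \<and>
          Q \<subseteq> tangent_plane (frontier K) p - K \<and>
          general_linear_position (tangent_plane (frontier K) p) p Q \<and>
          (\<forall>q\<in>Q. flat (shadow_boundary K q))"
  shows "\<exists>l1 l2. pd f 3 0 y = 3 * l1 * pd f 2 0 y
      \<and> pd f 2 1 y = 2 * l1 * pd f 1 1 y + l2 * pd f 2 0 y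
      \<and> pd f 1 2 y = l1 * pd f 0 2 y + 2 * l2 * pd f 1 1 y \<and> pd f 0 3 y = 3 * l2 * pd f 0 2 y"
proof -
  let ?\<psi> = "graph_map b1 b2 b3 f"
  let ?X = "?\<psi> y" and ?u1 = "b1 + pd f 1 0 y *\<^sub>R b3" and ?u2 = "b2 + pd f 0 1 y *\<^sub>R b3"
  have fr: "frame b1 b2 b3" and V: "open V" and f: "Ck_on 5 V f" and onF: "\<And>y. y \<in> V \<Longrightarrow> ?\<psi> y \<in> frontier K"
    using ch by (auto simp: graph_chart_def)
  have XK: "?X \<in> K" using onF[OF y] K by (auto simp: frontier_def convex_body_def compact_imp_closed)
  obtain a where a: "a \<noteq> 0" "a \<bullet> ?u1 = 0" "a \<bullet> ?u2 = 0" "a \<bullet> b3 \<noteq> 0"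
    and "\<forall>z\<in>K. a \<bullet> ?X \<le> a \<bullet> z"
    and ai: "\<forall>z\<in>interior K. a \<bullet> ?X < a \<bullet> z"
    and T: "tangent_plane (frontier K) ?X = {z. a \<bullet> z = a \<bullet> ?X}"
    by (rule tangent_plane_of_chart[OF K ch y]) (rule that; assumption)
  have dimT: "aff_dim (tangent_plane (frontier K) ?X) = 2" unfolding T using a(1) by simp
  obtain Q where Q: "infinite Q \<or> 31 \<le> card Q" "Q \<subseteq> tangent_plane (frontier K) ?X - K"
    and glp: "general_linear_position (tangent_plane (frontier K) ?X) ?X Q"
    and flatQ: "\<forall>q\<in>Q. flat (shadow_boundary K q)"
    using lights[OF onF[OF y]] by blast
  have "\<exists>Q0. finite Q0 \<and> card Q0 = 31 \<and> Q0 \<subseteq> Q"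
  proof (cases "finite Q")
    case True
    then have "31 \<le> card Q" using Q(1) by blast
    then obtain Q0 where "Q0 \<subseteq> Q" "card Q0 = 31" by (rule obtain_subset_with_card_n)
    then show ?thesis using finite_subset[OF _ True] by blast
  next
    case False
    then show ?thesis by (rule infinite_arbitrarily_large)
  qed
  then obtain Q0 where Q0: "finite Q0" "card Q0 = 31" "Q0 \<subseteq> Q" by blast
  \<comment> \<open>Horizontal coordinates of a source relative to the point; in the tangent plane
    they determine it, with respect to the basis \<open>?u1\<close>, \<open>?u2\<close>.\<close>
  define dir where "dir q = ((q - ?X) \<bullet> b1, (q - ?X) \<bullet> b2)" for q
  have qd: "q - ?X = fst (dir q) *\<^sub>R ?u1 + snd (dir q) *\<^sub>R ?u2" if "a \<bullet> q = a \<bullet> ?X" for q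
  proof -
    have "a \<bullet> (q - ?X) = 0" using that by (simp add: inner_diff_right)
    from tangent_coordinates[OF fr a(2-4) this] show ?thesis
      unfolding dir_def fst_conv snd_conv .
  qed
  have q_eq: "q = ?X + (fst (dir q) *\<^sub>R ?u1 + snd (dir q) *\<^sub>R ?u2)" if "a \<bullet> q = a \<bullet> ?X" for q
    by (rule trans[OF iffD1[OF diff_eq_eq qd[OF that]] add.commute])
  have QT: "a \<bullet> q = a \<bullet> ?X" "q \<notin> K" if "q \<in> Q" for q using Q(2) that unfolding T by auto
  \<comment> \<open>In a plane the hyperplanes through the point are lines. Parallel displacements
    would put both sources on the line \<open>H\<close> through the point.\<close>
  have indep: "fst (dir q) * snd (dir q') \<noteq> snd (dir q) * fst (dir q')" if q: "q \<in> Q" "q' \<in> Q" "q \<noteq> q'" for q q'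
  proof
    assume par: "fst (dir q) * snd (dir q') = snd (dir q) * fst (dir q')"
    have qX: "q \<noteq> ?X" using QT(2)[OF q(1)] XK by auto
    define H where "H = affine hull {?X, q}"
    have dH: "aff_dim H = 1" using qX by (simp add: H_def aff_dim_affine_hull aff_dim_2)
    have "H \<subseteq> tangent_plane (frontier K) ?X" unfolding H_def T
      by (rule hull_minimal) (auto simp: QT[OF q(1)] affine_hyperplane)
    moreover have XH: "?X \<in> H" "q \<in> H" unfolding H_def by (simp_all add: hull_inc)
    moreover have "q' \<in> H"
    proof -
      have dq: "fst (dir q) \<noteq> 0 \<or> snd (dir q) \<noteq> 0" using qd[OF QT(1)[OF q(1)]] qX by fastforce
      have "\<exists>s. fst (dir q') = s * fst (dir q) \<and> snd (dir q') = s * snd (dir q)"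
      proof (cases "fst (dir q) = 0")
        case True
        then show ?thesis using dq par by (intro exI[of _ "snd (dir q') / snd (dir q)"]) auto
      next
        case False
        then show ?thesis using par by (intro exI[of _ "fst (dir q') / fst (dir q)"]) (simp add: field_simps)
      qed
      then obtain s where s: "fst (dir q') = s * fst (dir q)" "snd (dir q') = s * snd (dir q)" by blast
      have "q' = ?X + (fst (dir q') *\<^sub>R ?u1 + snd (dir q') *\<^sub>R ?u2)" by (rule q_eq[OF QT(1)[OF q(2)]])
      also have "\<dots> = ?X + s *\<^sub>R (fst (dir q) *\<^sub>R ?u1 + snd (dir q) *\<^sub>R ?u2)"
        unfolding s by (simp only: scaleR_add_right scaleR_scaleR mult.assoc)
      also have "\<dots> = ?X + s *\<^sub>R (q - ?X)"
        unfolding qd[OF QT(1)[OF q(1)]] ..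
      also have "\<dots> = (1 - s) *\<^sub>R ?X + s *\<^sub>R q" by (simp add: algebra_simps)
      finally have e: "q' = (1 - s) *\<^sub>R ?X + s *\<^sub>R q" .
      show ?thesis unfolding H_def affine_hull_2 by (intro CollectI exI[of _ "1 - s"] exI[of _ s] conjI e) simp
    qed
    moreover have "affine H" by (simp add: H_def)
    ultimately have "\<exists>H. affine H \<and> H \<subseteq> tangent_plane (frontier K) ?X \<and>
        aff_dim H = aff_dim (tangent_plane (frontier K) ?X) - 1 \<and> ?X \<in> H \<and> {q, q'} \<subseteq> H"
      using dH dimT by (intro exI[of _ H]) simp
    moreover have "{q, q'} \<subseteq> Q" "finite {q, q'}" "int (card {q, q'}) = aff_dim (tangent_plane (frontier K) ?X)"
      using q dimT by auto
    ultimately show False using glp unfolding general_linear_position_def by blast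
  qed
  have inj: "inj_on dir Q"
  proof (rule inj_onI)
    fix q q' assume q: "q \<in> Q" "q' \<in> Q" "dir q = dir q'"
    have "q - ?X = q' - ?X" unfolding qd[OF QT(1)[OF q(1)]] qd[OF QT(1)[OF q(2)]] q(3) ..
    then show "q = q'" by simp
  qed
  show ?thesis
  proof (rule third_derivatives_of_flat_shadows[OF V y f D])
    show "finite (dir ` Q0)" using Q0 by simp
    have "card (dir ` Q0) = 31" using card_image[OF inj_on_subset[OF inj Q0(3)]] Q0 by simp
    then show "16 < card (dir ` Q0)" by simp
    show "fst d * snd d' \<noteq> snd d * fst d'" if "d \<in> dir ` Q0" "d' \<in> dir ` Q0" "d \<noteq> d'" for d d'
      using that indep Q0(3) by blast
    fix d assume "d \<in> dir ` Q0"
    then obtain q where q: "q \<in> Q" and d: "d = dir q" using Q0(3) by blast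
    obtain P where P: "affine P" "aff_dim P = 2" "shadow_boundary K q \<subseteq> P"
      using flatQ q unfolding flat_def by blast
    have "aff_dim P = DIM(real ^ 3) - 1" using P(2) by simp
    then obtain n e where n: "n \<noteq> 0" and "affine hull P = {z. n \<bullet> z = e}"
      unfolding aff_dim_eq_hyperplane by blast
    then have Pn: "P = {z. n \<bullet> z = e}" using P(1) by (simp add: hull_same)
    \<comment> \<open>The base point belongs to each of these shadow boundaries, so the constant of
      the plane can be expressed by it.\<close>
    have "?X \<in> shadow_boundary K q" by (rule shadow_boundary_of_tangent[OF onF[OF y] ai QT(1)[OF q]])
    from subsetD[OF P(3) this] have nX: "n \<bullet> ?X = e" unfolding Pn by simp
    have nz: "(n \<bullet> b1, n \<bullet> b2, n \<bullet> b3) \<noteq> (0, 0, 0)" using frame_expand[OF fr, of n] n by auto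
    have main: "n \<bullet> b1 * (fst x - fst y) + n \<bullet> b2 * (snd x - snd y) + n \<bullet> b3 * (f x - f y) = 0"
      if x: "x \<in> V" and eq: "f x + pd f 1 0 x * (fst y + fst d - fst x) + pd f 0 1 x * (snd y + snd d - snd x)
        = f y + pd f 1 0 y * fst d + pd f 0 1 y * snd d" for x
    proof -
      obtain a' where "a' \<noteq> 0" and a': "a' \<bullet> (b1 + pd f 1 0 x *\<^sub>R b3) = 0" "a' \<bullet> (b2 + pd f 0 1 x *\<^sub>R b3) = 0"
        and "a' \<bullet> b3 \<noteq> 0" "\<forall>z\<in>K. a' \<bullet> ?\<psi> x \<le> a' \<bullet> z"
        and ai': "\<forall>z\<in>interior K. a' \<bullet> ?\<psi> x < a' \<bullet> z"
        and "tangent_plane (frontier K) (?\<psi> x) = {z. a' \<bullet> z = a' \<bullet> ?\<psi> x}"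
        by (rule tangent_plane_of_chart[OF K ch x]) (rule that; assumption)
      define v w where "v = fst y + fst d - fst x" and "w = snd y + snd d - snd x"
      have "q = ?X + (fst d *\<^sub>R ?u1 + snd d *\<^sub>R ?u2)" unfolding d by (rule q_eq[OF QT(1)[OF q]])
      also have "\<dots> = (fst y + fst d) *\<^sub>R b1 + (snd y + snd d) *\<^sub>R b2 + (f y + pd f 1 0 y * fst d + pd f 0 1 y * snd d) *\<^sub>R b3"
        by (simp add: graph_map_def algebra_simps)
      \<comment> \<open>The hypothesis \<open>eq\<close> says that the source lies at the height of
        the tangent plane at \<open>?\<psi> x\<close>.\<close>
      also have "\<dots> = ?\<psi> x + (v *\<^sub>R (b1 + pd f 1 0 x *\<^sub>R b3) + w *\<^sub>R (b2 + pd f 0 1 x *\<^sub>R b3))"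
        unfolding eq[symmetric] v_def w_def by (simp add: graph_map_def algebra_simps)
      finally have "a' \<bullet> q = a' \<bullet> ?\<psi> x"
        by (simp only: inner_add_right[of a' "?\<psi> x"] inner_add_right[of a' "v *\<^sub>R _"] inner_scaleR_right a' mult_zero_right add_0_right)
      from subsetD[OF P(3) shadow_boundary_of_tangent[OF onF[OF x] ai' this]] have "n \<bullet> ?\<psi> x = e" unfolding Pn by simp
      then have "n \<bullet> ?\<psi> x - n \<bullet> ?X = 0" using nX by simp
      then show ?thesis by (simp add: graph_map_def inner_add_right algebra_simps)
    qed
    show "\<exists>l m k. (l, m, k) \<noteq> (0, 0, 0) \<and> (\<forall>x\<in>V.
      f x + pd f 1 0 x * (fst y + fst d - fst x) + pd f 0 1 x * (snd y + snd d - snd x)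
        = f y + pd f 1 0 y * fst d + pd f 0 1 y * snd d
      \<longrightarrow> l * (fst x - fst y) + m * (snd x - snd y) + k * (f x - f y) = 0)"
      by (intro exI conjI ballI impI; (rule nz | rule main))
  qed
qed

lemma local_quadric:
  assumes K: "convex_body K" and ch: "graph_chart (frontier K) b1 b2 b3 f V W" and y: "y \<in> V"
    and D: "pd f 2 0 y * pd f 0 2 y - (pd f 1 1 y)^2 > 0"
    and lights: "\<And>p. p \<in> frontier K \<Longrightarrow>
      \<exists>Q. (infinite Q \<or> 31 \<le> card Q) \<and>
          Q \<subseteq> tangent_plane (frontier K) p - K \<and>
          general_linear_position (tangent_plane (frontier K) p) p Q \<and>
          (\<forall>q\<in>Q. flat (shadow_boundary K q))"
  obtains U B L c where "open U" "y \<in> U" "U \<subseteq> V" "quadratic B L"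
    "\<And>z. z \<in> U \<Longrightarrow> pd f 2 0 z * pd f 0 2 z - (pd f 1 1 z)^2 > 0"
    "\<And>z. z \<in> U \<Longrightarrow> quadric B L c (graph_map b1 b2 b3 f z) = 0"
    "\<And>z. z \<in> U \<Longrightarrow> B (graph_map b1 b2 b3 f z) b3 + L b3 \<noteq> 0"
proof -
  have fr: "frame b1 b2 b3" and V: "open V" and f: "Ck_on 5 V f"
    using ch by (auto simp: graph_chart_def)
  define D where "D z = pd f 2 0 z * pd f 0 2 z - (pd f 1 1 z)^2" for z
  have c: "continuous_on V (pd f i j)" if "i + j \<le> 5" for i j
    using Ck_on_continuous[OF Ck_on_pd[OF Ck_on_le[OF f], of i j 0]] that by simp
  have "continuous_on V D" unfolding D_def[abs_def] by (intro continuous_intros c) simp_all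
  then have "open (V \<inter> D -` {0<..})" by (rule continuous_open_preimage[OF _ V]) simp
  moreover have "y \<in> V \<inter> D -` {0<..}" using D y by (simp add: D_def)
  ultimately obtain r where r: "r > 0" "ball y r \<subseteq> V \<inter> D -` {0<..}" using openE by blast
  define U where "U = ball y r"
  have U: "open U" "convex U" "y \<in> U" "U \<subseteq> V" using r by (auto simp: U_def)
  have DU: "pd f 2 0 z * pd f 0 2 z - (pd f 1 1 z)^2 > 0" if "z \<in> U" for z
    using r(2) that by (auto simp: U_def D_def)
  show ?thesis
  proof (rule graph_on_quadric[OF U(1,2) Ck_on_subset[OF f U(4)] DU])
    show "\<exists>l1 l2. pd f 3 0 z = 3 * l1 * pd f 2 0 z \<and> pd f 2 1 z = 2 * l1 * pd f 1 1 z + l2 * pd f 2 0 z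
      \<and> pd f 1 2 z = l1 * pd f 0 2 z + 2 * l2 * pd f 1 1 z \<and> pd f 0 3 z = 3 * l2 * pd f 0 2 z" if "z \<in> U" for z
      by (rule third_derivatives_of_chart[OF K ch subsetD[OF U(4) that] DU[OF that] lights])
  next
    fix s p1 p2 c0 c11 c12 c22 m1 m2 m0
    assume Q: "\<And>y. y \<in> U \<Longrightarrow> (s * f y + p1 * fst y + p2 * snd y + c0) * f y - s * f y * f y / 2
      - (c11 * fst y * fst y + 2 * c12 * fst y * snd y + c22 * snd y * snd y) / 2
      - (m1 * fst y + m2 * snd y + m0) = 0"
      and pos: "\<And>y. y \<in> U \<Longrightarrow> s * f y + p1 * fst y + p2 * snd y + c0 > 0"
    \<comment> \<open>The equation of \<open>graph_on_quadric\<close>, polarized in frame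
      coordinates. The functional B(x, b3) + L b3 is half the positive function found there, which
      gives \<open>n0\<close>.\<close>
    define B where "B x x' = s * (x \<bullet> b3) * (x' \<bullet> b3) / 2 + p1 * ((x \<bullet> b1) * (x' \<bullet> b3) + (x' \<bullet> b1) * (x \<bullet> b3)) / 2
       + p2 * ((x \<bullet> b2) * (x' \<bullet> b3) + (x' \<bullet> b2) * (x \<bullet> b3)) / 2
       - (c11 * (x \<bullet> b1) * (x' \<bullet> b1) + c12 * ((x \<bullet> b1) * (x' \<bullet> b2) + (x' \<bullet> b1) * (x \<bullet> b2)) + c22 * (x \<bullet> b2) * (x' \<bullet> b2)) / 2"
      for x x' :: "real ^ 3"
    define L where "L x = (c0 * (x \<bullet> b3) - m1 * (x \<bullet> b1) - m2 * (x \<bullet> b2)) / 2" for x :: "real ^ 3"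
    have q: "quadratic B L" unfolding quadratic_def bilinear_def
      by (intro conjI allI linearI) (simp_all add: B_def L_def inner_add_left field_simps)
    have Q0: "quadric B L (- m0) (graph_map b1 b2 b3 f z) = 0" if "z \<in> U" for z
      using Q[OF that] unfolding quadric_def B_def L_def graph_map_inner[OF fr] by (simp add: field_simps)
    have n0: "B (graph_map b1 b2 b3 f z) b3 + L b3 \<noteq> 0" if "z \<in> U" for z
      using pos[OF that] unfolding B_def L_def graph_map_inner[OF fr] frame_inner[OF fr] by (simp add: field_simps)
    show ?thesis by (rule that[OF U(1,3,4) q DU Q0 n0])
  qed
qed

text \<open>At a maximum of the squared distance from the origin its Hessian 2 (I + grad f grad f^T
  + f Hess f) is negative semidefinite. So f Hess f is bounded above by -I, and its determinant, f^2
  times that of Hess f, is positive.\<close>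

lemma farthest_point_hessian:
  assumes ch: "graph_chart S b1 b2 b3 f V W" and y: "y \<in> V"
    and far: "\<And>z. z \<in> S \<Longrightarrow> norm z \<le> norm (graph_map b1 b2 b3 f y)"
  shows "pd f 2 0 y * pd f 0 2 y - (pd f 1 1 y)^2 > 0"
proof -
  let ?\<psi> = "graph_map b1 b2 b3 f"
  have fr: "frame b1 b2 b3" and V: "open V" and f: "Ck_on 5 V f" and onS: "\<And>y. y \<in> V \<Longrightarrow> ?\<psi> y \<in> S"
    using ch by (auto simp: graph_chart_def)
  define \<phi> where "\<phi> z = fst z * fst z + snd z * snd z + f z * f z" for z
  have "\<phi> z = ?\<psi> z \<bullet> ?\<psi> z" for z
    unfolding \<phi>_def graph_map_def using frame_inner[OF fr] by (simp add: inner_add_left inner_add_right)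
  then have \<phi>n: "\<phi> z = norm (?\<psi> z)^2" for z by (simp add: power2_norm_eq_inner)
  have max: "\<phi> z \<le> \<phi> y" if "z \<in> V" for z
    unfolding \<phi>n using far[OF onS[OF that]] by (intro power_mono) auto
  note hp = has_partials_pd[OF V Ck_on_le[OF f]]
  have hf: "has_partials f (pd f 1 0 z) (pd f 0 1 z) z" and h1: "has_partials (pd f 1 0) (pd f 2 0 z) (pd f 1 1 z) z"
    and h2: "has_partials (pd f 0 1) (pd f 1 1 z) (pd f 0 2 z) z" if "z \<in> V" for z
    using hp[of 0 0 z] hp[of 1 0 z] hp[of 0 1 z] that by (simp_all add: pd_0 numeral_2_eq_2)
  have \<phi>1: "has_partials \<phi> (2 * (fst z + f z * pd f 1 0 z)) (2 * (snd z + f z * pd f 0 1 z)) z" if z: "z \<in> V" for z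
    unfolding \<phi>_def[abs_def] by (rule has_partials_eq, (rule has_partials_rules hf z)+) simp_all
  have g1: "has_partials (\<lambda>z. 2 * (fst z + f z * pd f 1 0 z)) (2 * (1 + pd f 1 0 z * pd f 1 0 z + f z * pd f 2 0 z))
       (2 * (pd f 0 1 z * pd f 1 0 z + f z * pd f 1 1 z)) z" if z: "z \<in> V" for z
    by (rule has_partials_eq, (rule has_partials_rules hf h1 z)+) simp_all
  have g2: "has_partials (\<lambda>z. 2 * (snd z + f z * pd f 0 1 z)) (2 * (pd f 1 0 z * pd f 0 1 z + f z * pd f 1 1 z))
       (2 * (1 + pd f 0 1 z * pd f 0 1 z + f z * pd f 0 2 z)) z" if z: "z \<in> V" for z
    by (rule has_partials_eq, (rule has_partials_rules hf h2 z)+) simp_all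
  have C2: "Ck_on 2 V \<phi>" unfolding \<phi>_def[abs_def]
    by (intro Ck_on_add Ck_on_mult V Ck_on_linear bounded_linear_fst bounded_linear_snd Ck_on_le[OF f]) simp_all
  have p1: "pd \<phi> 1 0 z = 2 * (fst z + f z * pd f 1 0 z)" and p2: "pd \<phi> 0 1 z = 2 * (snd z + f z * pd f 0 1 z)" if "z \<in> V" for z
    using has_partials_unique[OF \<phi>1[OF that]] by (simp_all add: pd_def)
  have pp: "has_partials (pd \<phi> 1 0) (2 * (1 + pd f 1 0 y * pd f 1 0 y + f y * pd f 2 0 y)) (2 * (pd f 0 1 y * pd f 1 0 y + f y * pd f 1 1 y)) y"
    "has_partials (pd \<phi> 0 1) (2 * (pd f 1 0 y * pd f 0 1 y + f y * pd f 1 1 y)) (2 * (1 + pd f 0 1 y * pd f 0 1 y + f y * pd f 0 2 y)) y"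
    by (rule iffD2[OF has_partials_cong[OF V y p1] g1[OF y]] iffD2[OF has_partials_cong[OF V y p2] g2[OF y]]; assumption)+
  have P: "pd \<phi> 2 0 y = 2 * (1 + pd f 1 0 y * pd f 1 0 y + f y * pd f 2 0 y)"
    "pd \<phi> 1 1 y = 2 * (pd f 1 0 y * pd f 0 1 y + f y * pd f 1 1 y)"
    "pd \<phi> 0 2 y = 2 * (1 + pd f 0 1 y * pd f 0 1 y + f y * pd f 0 2 y)"
    using has_partials_unique(1)[OF pp(1)] has_partials_unique[OF pp(2)] by (simp_all add: pd_def numeral_2_eq_2)
  have "(\<lambda>v. fst v * pd \<phi> 1 0 y + snd v * pd \<phi> 0 1 y) = (\<lambda>v. 0)"
    by (rule differential_zero_maxmin[OF y V]) (use \<phi>1[OF y] max p1[OF y] p2[OF y] in \<open>auto simp: has_partials_def\<close>)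
  from fun_cong[OF this, of "(1, 0)"] fun_cong[OF this, of "(0, 1)"] have crit: "pd \<phi> 1 0 y = 0" "pd \<phi> 0 1 y = 0" by simp_all
  have sd: "0 \<le> (- 1) * (pd \<phi> 2 0 y * v^2 + 2 * pd \<phi> 1 1 y * v * w + pd \<phi> 0 2 y * w^2)" for v w
    by (rule semidefinite_of_one_sided[OF V y C2]) (use max crit in simp)
  define p q r where "p = f y * pd f 2 0 y" and "q = f y * pd f 1 1 y" and "r = f y * pd f 0 2 y"
  have neg: "p * v^2 + 2 * q * v * w + r * w^2 \<le> - (v^2 + w^2)" for v w
  proof -
    have "v^2 + w^2 + (pd f 1 0 y * v + pd f 0 1 y * w)^2 + (p * v^2 + 2 * q * v * w + r * w^2) \<le> 0"
      using sd[of v w] unfolding P p_def q_def r_def by (simp add: power2_eq_square algebra_simps)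
    then show ?thesis using zero_le_power2[of "pd f 1 0 y * v + pd f 0 1 y * w"] by linarith
  qed
  have "p \<le> - 1" using neg[of 1 0] by simp
  \<comment> \<open>The same test vector (-q, p) as for semidefinite forms, now with a strict
    bound.\<close>
  have "p * (p * r - q^2) \<le> - (q^2 + p^2)" using neg[of "- q" p] by (simp add: power2_eq_square algebra_simps)
  also have "\<dots> < 0"
  proof -
    have "p^2 > 0" using \<open>p \<le> - 1\<close> by simp
    then show ?thesis using zero_le_power2[of q] by linarith
  qed
  finally have "p * r - q^2 > 0" using \<open>p \<le> - 1\<close> by (simp add: mult_less_0_iff)
  then have "(f y)^2 * (pd f 2 0 y * pd f 0 2 y - (pd f 1 1 y)^2) > 0"
    by (simp add: p_def q_def r_def power2_eq_square algebra_simps)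
  then show ?thesis using zero_le_power2[of "f y"] by (simp add: zero_less_mult_iff)
qed

lemma convex_body_det_nonneg:
  assumes K: "convex_body K" and ch: "graph_chart (frontier K) b1 b2 b3 f V W" and y: "y \<in> V"
  shows "0 \<le> pd f 2 0 y * pd f 0 2 y - (pd f 1 1 y)^2"
proof -
  let ?\<psi> = "graph_map b1 b2 b3 f"
  have fr: "frame b1 b2 b3" and V: "open V" and f: "Ck_on 5 V f" and onF: "\<And>y. y \<in> V \<Longrightarrow> ?\<psi> y \<in> frontier K"
    using ch by (auto simp: graph_chart_def)
  obtain a where "a \<noteq> 0" and a: "a \<bullet> (b1 + pd f 1 0 y *\<^sub>R b3) = 0" "a \<bullet> (b2 + pd f 0 1 y *\<^sub>R b3) = 0" "a \<bullet> b3 \<noteq> 0"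
    and aK: "\<forall>z\<in>K. a \<bullet> ?\<psi> y \<le> a \<bullet> z"
    and "\<forall>z\<in>interior K. a \<bullet> ?\<psi> y < a \<bullet> z" "tangent_plane (frontier K) (?\<psi> y) = {z. a \<bullet> z = a \<bullet> ?\<psi> y}"
    by (rule tangent_plane_of_chart[OF K ch y]) (rule that; assumption)
  have 0: "a \<bullet> b1 = - pd f 1 0 y * (a \<bullet> b3)" "a \<bullet> b2 = - pd f 0 1 y * (a \<bullet> b3)" using a by (simp_all add: inner_add_right)
  have one: "0 \<le> (a \<bullet> b3) * (f z - f y - (pd f 1 0 y * (fst z - fst y) + pd f 0 1 y * (snd z - snd y)))" if "z \<in> V" for z
  proof -
    have "?\<psi> z \<in> K" using onF[OF that] K by (auto simp: frontier_def convex_body_def compact_imp_closed)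
    from bspec[OF aK this] show ?thesis by (simp add: graph_map_def inner_add_right 0 algebra_simps)
  qed
  show ?thesis
    by (rule det_nonneg_of_semidefinite[OF a(3) semidefinite_of_one_sided[OF V y Ck_on_le[OF f] one]]) simp_all
qed

section \<open>From local to global\<close>

text \<open>Vanishing is required on a whole relative neighbourhood, so that openness of the set of
  such points is immediate and only closedness has to be proved.\<close>

definition on_quadric_near where
  "on_quadric_near S B L c x \<longleftrightarrow> x \<in> S \<and> (\<exists>W. open W \<and> x \<in> W \<and> (\<forall>z\<in>S \<inter> W. quadric B L c z = 0))"

lemma continuous_on_graph_map: "continuous_on V f \<Longrightarrow> continuous_on V (graph_map b1 b2 b3 f)"
  unfolding graph_map_def[abs_def] by (intro continuous_intros)

text \<open>Contact with the quadric passes to the limit point. Nondegeneracy and convexity then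
  make the Hessian determinant positive there, so the point has a local quadric of its own; this one
  must share the given equation up to a factor, since both hold near some common point.\<close>

lemma on_quadric_near_closed:
  assumes K: "convex_body K" and S: "Ck_hypersurface 5 (frontier K)"
    and lights: "\<And>p. p \<in> frontier K \<Longrightarrow>
      \<exists>Q. (infinite Q \<or> 31 \<le> card Q) \<and>
          Q \<subseteq> tangent_plane (frontier K) p - K \<and>
          general_linear_position (tangent_plane (frontier K) p) p Q \<and>
          (\<forall>q\<in>Q. flat (shadow_boundary K q))"
    and q: "quadratic B L" and nd: "nondegenerate_quadric B L c"
    and x: "x \<in> frontier K" "x \<in> closure {x. on_quadric_near (frontier K) B L c x}"
  shows "on_quadric_near (frontier K) B L c x"
proof -
  let ?S = "frontier K"
  obtain b1 b2 b3 f V W where ch: "graph_chart ?S b1 b2 b3 f V W" and xW: "x \<in> W"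
    by (rule graph_chart_exists[OF S x(1)]) (rule that; assumption)
  let ?\<psi> = "graph_map b1 b2 b3 f"
  have fr: "frame b1 b2 b3" and V: "open V" and f: "Ck_on 5 V f" and W: "open W"
    and on: "\<And>y. y \<in> V \<Longrightarrow> ?\<psi> y \<in> ?S \<inter> W"
    and co: "\<And>x. x \<in> ?S \<inter> W \<Longrightarrow> (x \<bullet> b1, x \<bullet> b2) \<in> V \<and> x = ?\<psi> (x \<bullet> b1, x \<bullet> b2)"
    using ch unfolding graph_chart_def by blast+
  have f3: "Ck_on 3 V f" by (rule Ck_on_le[OF f]) simp
  interpret quadric_on_chart b1 b2 b3 V f B L c by unfold_locales (rule fr V f3 q)+
  define \<pi> where "\<pi> z = (z \<bullet> b1, z \<bullet> b2)" for z :: "real ^ 3"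
  define y where "y = \<pi> x"
  have yV: "y \<in> V" and xy: "x = ?\<psi> y" using co[of x] x(1) xW by (auto simp: y_def \<pi>_def)
  have c\<psi>: "continuous_on V ?\<psi>" by (rule continuous_on_graph_map[OF Ck_on_continuous[OF f]])
  have c\<pi>: "continuous_on X \<pi>" for X unfolding \<pi>_def[abs_def] by (intro continuous_intros)
  have patch: "\<exists>U'. open U' \<and> z \<in> U' \<and> U' \<subseteq> V \<and> (\<forall>w\<in>U'. quadric B L c (?\<psi> w) = 0)"
    if z: "z \<in> V" "on_quadric_near ?S B L c (?\<psi> z)" for z
  proof -
    obtain W' where W': "open W'" "?\<psi> z \<in> W'" "\<forall>z\<in>?S \<inter> W'. quadric B L c z = 0"
      using z(2) unfolding on_quadric_near_def by blast
    have "open (V \<inter> ?\<psi> -` W')" by (rule continuous_open_preimage[OF c\<psi> V W'(1)])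
    moreover have "z \<in> V \<inter> ?\<psi> -` W'" using z W' by simp
    moreover have "\<forall>w\<in>V \<inter> ?\<psi> -` W'. quadric B L c (?\<psi> w) = 0" using W'(3) on by blast
    ultimately show ?thesis by (intro exI[of _ "V \<inter> ?\<psi> -` W'"]) blast
  qed
  \<comment> \<open>The good points in chart coordinates. The closure is taken in space, so
    \<open>meets\<close> transports its neighbourhoods to the chart.\<close>
  define A where "A = {z \<in> V. on_quadric_near ?S B L c (?\<psi> z)}"
  have meets: "\<exists>z\<in>U. z \<in> A" if U: "open U" "y \<in> U" "U \<subseteq> V" for U
  proof -
    have "open (W \<inter> \<pi> -` U)" by (rule continuous_open_preimage[OF c\<pi> W U(1)])
    moreover have "x \<in> W \<inter> \<pi> -` U" using xW U by (simp add: y_def)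
    ultimately obtain g where g: "g \<in> W" "\<pi> g \<in> U" "on_quadric_near ?S B L c g"
      using x(2) unfolding closure_iff_nhds_not_empty by blast
    then have "g \<in> ?S \<inter> W" by (simp add: on_quadric_near_def)
    from co[OF this] have "\<pi> g \<in> V" "g = ?\<psi> (\<pi> g)" by (simp_all add: \<pi>_def)
    then have "\<pi> g \<in> A" using g(3) by (simp add: A_def)
    then show ?thesis using g(2) by blast
  qed
  have "contact y"
  proof (rule contact_closure[OF yV])
    show "y \<in> closure A"
      unfolding closure_iff_nhds_not_empty
    proof (intro allI impI)
      fix N T assume "T \<subseteq> N" "open T" "y \<in> T"
      then have "open (T \<inter> V)" "y \<in> T \<inter> V" using V yV by auto
      from meets[OF this] show "A \<inter> N \<noteq> {}" using \<open>T \<subseteq> N\<close> by blast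
    qed
    show "contact z" if "z \<in> A" for z
    proof -
      obtain U' where "open U'" "z \<in> U'" "U' \<subseteq> V" "\<forall>w\<in>U'. quadric B L c (?\<psi> w) = 0"
        using patch[of z] \<open>z \<in> A\<close> unfolding A_def by blast
      then show ?thesis by (intro contact_on[of U' z]) auto
    qed
    show "A \<subseteq> V" by (auto simp: A_def)
  qed
  \<comment> \<open>Contact excludes a zero determinant and convexity a negative one.\<close>
  from hessian_nonzero_of_nondegenerate[OF nd this] convex_body_det_nonneg[OF K ch yV]
  have D: "pd f 2 0 y * pd f 0 2 y - (pd f 1 1 y)^2 > 0" by simp
  obtain U B' L' c' where U: "open U" "y \<in> U" "U \<subseteq> V" and q': "quadratic B' L'"
    and DU: "\<And>z. z \<in> U \<Longrightarrow> pd f 2 0 z * pd f 0 2 z - (pd f 1 1 z)^2 > 0"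
    and Q': "\<And>z. z \<in> U \<Longrightarrow> quadric B' L' c' (?\<psi> z) = 0"
    and n': "\<And>z. z \<in> U \<Longrightarrow> B' (?\<psi> z) b3 + L' b3 \<noteq> 0"
    by (rule local_quadric[OF K ch yV D lights]) (assumption | rule that)+
  \<comment> \<open>At \<open>z\<close> both equations hold on a neighbourhood; proportionality
    obtained there is an identity on all of space, hence valid near \<open>x\<close>.\<close>
  obtain z where z: "z \<in> U" "z \<in> A" using meets[OF U] by blast
  then obtain U' where U': "open U'" "z \<in> U'" "U' \<subseteq> V" "\<forall>w\<in>U'. quadric B L c (?\<psi> w) = 0"
    using patch[of z] unfolding A_def by blast
  obtain \<kappa> where \<kappa>: "\<And>x. quadric B L c x = \<kappa> * quadric B' L' c' x"
  proof (rule quadric_proportional[OF fr V f3 q q', of "U \<inter> U'" z c c'])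
    show "open (U \<inter> U')" "U \<inter> U' \<subseteq> V" "z \<in> U \<inter> U'" using U U' z by auto
    show "quadric B L c (?\<psi> w) = 0" "quadric B' L' c' (?\<psi> w) = 0" if "w \<in> U \<inter> U'" for w
      using that U' Q' by auto
    show "pd f 2 0 z * pd f 0 2 z - (pd f 1 1 z)^2 \<noteq> 0" using DU[OF z(1)] by simp
    show "B' (?\<psi> z) b3 + L' b3 \<noteq> 0" by (rule n'[OF z(1)])
  qed blast
  have "open (W \<inter> \<pi> -` U)" by (rule continuous_open_preimage[OF c\<pi> W U(1)])
  moreover have "x \<in> W \<inter> \<pi> -` U" using xW U by (simp add: y_def)
  moreover have "quadric B L c g = 0" if g: "g \<in> ?S \<inter> (W \<inter> \<pi> -` U)" for g
  proof -
    have "g = ?\<psi> (\<pi> g)" using co[of g] g by (simp add: \<pi>_def)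
    moreover have "quadric B' L' c' (?\<psi> (\<pi> g)) = 0" using Q' g by simp
    ultimately show ?thesis unfolding \<kappa> by simp
  qed
  ultimately show ?thesis unfolding on_quadric_near_def using x(1) by blast
qed

theorem theorem1p4:
  fixes K :: "(real ^ 3) set"
  assumes "convex_body K"
    and "Ck_hypersurface 5 (frontier K)"
    and "\<And>p. p \<in> frontier K \<Longrightarrow>
      \<exists>Q. (infinite Q \<or> 31 \<le> card Q) \<and>
          Q \<subseteq> tangent_plane (frontier K) p - K \<and>
          general_linear_position (tangent_plane (frontier K) p) p Q \<and>
          (\<forall>q\<in>Q. flat (shadow_boundary K q))"
  shows "ellipsoid K"
proof -
  note K = assms(1) and S = assms(2) and lights = assms(3)
  let ?S = "frontier K"
  have iK: "interior K \<noteq> {}" and bK: "bounded K" and cK: "convex K"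
    using K by (auto simp: convex_body_def compact_imp_bounded)
  obtain x0 where x0: "x0 \<in> interior K" using iK by blast
  have "?S \<noteq> {}"
  proof -
    have "axis 1 1 \<noteq> (0 :: real ^ 3)" by (simp add: axis_eq_0_iff)
    from ray_to_frontier[OF bK x0 this] show ?thesis by blast
  qed
  moreover have "compact ?S" using bK by (rule compact_frontier_bounded)
  ultimately obtain p0 where p0: "p0 \<in> ?S" and far: "\<forall>z\<in>?S. norm z \<le> norm p0"
    using continuous_attains_sup[of ?S norm] continuous_on_norm_id by blast
  obtain b1 b2 b3 f V W where ch: "graph_chart ?S b1 b2 b3 f V W" and p0W: "p0 \<in> W"
    by (rule graph_chart_exists[OF S p0]) (rule that; assumption)
  let ?\<psi> = "graph_map b1 b2 b3 f"
  have fr: "frame b1 b2 b3" and V: "open V" and f: "Ck_on 5 V f" and W: "open W"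
    and co: "\<And>x. x \<in> ?S \<inter> W \<Longrightarrow> (x \<bullet> b1, x \<bullet> b2) \<in> V \<and> x = ?\<psi> (x \<bullet> b1, x \<bullet> b2)"
    using ch unfolding graph_chart_def by blast+
  have f3: "Ck_on 3 V f" by (rule Ck_on_le[OF f]) simp
  define \<pi> where "\<pi> z = (z \<bullet> b1, z \<bullet> b2)" for z :: "real ^ 3"
  define y0 where "y0 = \<pi> p0"
  have y0: "y0 \<in> V" "p0 = ?\<psi> y0" using co[of p0] p0 p0W by (auto simp: y0_def \<pi>_def)
  have c\<pi>: "continuous_on X \<pi>" for X unfolding \<pi>_def[abs_def] by (intro continuous_intros)
  have D: "pd f 2 0 y0 * pd f 0 2 y0 - (pd f 1 1 y0)^2 > 0"
    by (rule farthest_point_hessian[OF ch y0(1)]) (use far y0(2) in simp)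
  obtain U B L c where U: "open U" "y0 \<in> U" "U \<subseteq> V" and q: "quadratic B L"
    and "\<And>z. z \<in> U \<Longrightarrow> pd f 2 0 z * pd f 0 2 z - (pd f 1 1 z)^2 > 0"
    and Q: "\<And>z. z \<in> U \<Longrightarrow> quadric B L c (?\<psi> z) = 0"
    and n: "\<And>z. z \<in> U \<Longrightarrow> B (?\<psi> z) b3 + L b3 \<noteq> 0"
    by (rule local_quadric[OF K ch y0(1) D lights]) (assumption | rule that)+
  interpret quadric_on_chart b1 b2 b3 V f B L c by unfold_locales (rule fr V f3 q)+
  \<comment> \<open>Only the initial quadric has to be shown nondegenerate, because the continuation
    keeps the same equation.\<close>
  have nd: "nondegenerate_quadric B L c"
    by (rule nondegenerate_of_hessian[OF contact_on[OF U(1,3) Q U(2)]]) (use D n[OF U(2)] in \<open>simp_all add: n_def\<close>)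
  define G where "G = {x. on_quadric_near ?S B L c x}"
  have GS: "G \<subseteq> ?S" by (auto simp: G_def on_quadric_near_def)
  have "p0 \<in> G"
  proof -
    have "open (W \<inter> \<pi> -` U)" by (rule continuous_open_preimage[OF c\<pi> W U(1)])
    moreover have "p0 \<in> W \<inter> \<pi> -` U" using p0W U by (simp add: y0_def)
    moreover have "quadric B L c g = 0" if g: "g \<in> ?S \<inter> (W \<inter> \<pi> -` U)" for g
    proof -
      have "g = ?\<psi> (\<pi> g)" using co[of g] g by (simp add: \<pi>_def)
      moreover have "quadric B L c (?\<psi> (\<pi> g)) = 0" using Q g by simp
      ultimately show ?thesis by simp
    qed
    ultimately show ?thesis unfolding G_def on_quadric_near_def using p0 by blast
  qed
  have "openin (top_of_set ?S) G"
    unfolding openin_open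
  proof (intro exI conjI)
    show "open (\<Union>{W. open W \<and> (\<forall>z\<in>?S \<inter> W. quadric B L c z = 0)})" by (rule open_Union) blast
    show "G = ?S \<inter> \<Union>{W. open W \<and> (\<forall>z\<in>?S \<inter> W. quadric B L c z = 0)}"
      unfolding G_def on_quadric_near_def by blast
  qed
  moreover have "closedin (top_of_set ?S) G"
  proof -
    have "G = ?S \<inter> closure G"
      using GS closure_subset[of G] on_quadric_near_closed[OF K S lights q nd] unfolding G_def by blast
    then show ?thesis using closedin_closed_Int[of "closure G" ?S] by simp
  qed
  \<comment> \<open>The relative frontier of a bounded convex set is connected unless the set has
    dimension 1; here it is the frontier because the interior is nonempty.\<close>
  moreover have "connected ?S"
  proof -
    have "aff_dim K = 3" using iK aff_dim_nonempty_interior[of K] by simp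
    moreover have "rel_frontier K = ?S" using iK by (simp add: rel_frontier_def frontier_def rel_interior_nonempty_interior)
    ultimately show ?thesis using connected_sphere_gen[OF cK bK] by simp
  qed
  ultimately have "G = ?S" using \<open>p0 \<in> G\<close> unfolding connected_clopen by blast
  then have "?S \<subseteq> {x. quadric B L c x = 0}" by (auto simp: G_def on_quadric_near_def)
  then show ?thesis by (rule ellipsoid_of_quadric[OF K q _ nd])
qed

end
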